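(* (Linearized uniqueness) Let $d\ge1$ and let $\beta:\mathbb{R}\to\mathbb{R}$, $b:\mathbb{R}\to\mathbb{R}$, $D:\mathbb{R}^d\to\mathbb{R}^d$ satisfy Hypotheses (j)--(jv) listed in the context. Let $T>0$ and $u\in L^\infty((0,T)\times\mathbb{R}^d)$. Let $y_1,y_2\in L^2((0,T)\times\mathbb{R}^d)$ be such that $y_1-y_2\in L^\infty(0,T;H^{-1}(\mathbb{R}^d))$ and such that $\rho=y_1$ and $\rho=y_2$ both satisfy $$\int_0^T\!\!\int_{\mathbb{R}^d}\Big(\varphi_t+\frac{\beta(u)}{u}\Delta\varphi+b(u)D\cdot\nabla\varphi\Big)\rho\,dx\,dt+\int_{\mathbb{R}^d}\varphi(0,x)\,\rho_0(dx)=0\quad\text{for all }\varphi\in C_0^\infty([0,T)\times\mathbb{R}^d)$$ for some $\rho_0\in\mathcal{M}(\mathbb{R}^d)$ (the same for $y_1$ and $y_2$), where $\frac{\beta(0)}{0}:=\beta'(0)$. Assume also that $$\lim_{t\to0}\ \operatorname*{ess\,sup}_{s\in(0,t)}\left|\int_{\mathbb{R}^d}(y_1(s,x)-y_2(s,x))\varphi(x)\,dx\right|=0\quad\text{for all }\varphi\in C_0^\infty(\mathbb{R}^d).$$ Then $y_1\equiv y_2$ (a.e. on $(0,T)\times\mathbb{R}^d$).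
   Context: Hypotheses: (j) $\beta\in C^1(\mathbb{R})$, $\beta'(r)\ge0$ for all $r\in\mathbb{R}$, $\beta(0)=0$. (jj) $D\in L^\infty(\mathbb{R}^d;\mathbb{R}^d)$. (jjj) $b\in C^1(\mathbb{R})$. (jv) For each compact $K\subset\mathbb{R}$ there exists $\alpha_K\in(0,\infty)$ such that $|b'(r)r+b(r)|\le\alpha_K|\beta'(r)|$ for all $r\in K$ (or, equivalently, $|b(r)r-b(\bar r)\bar r|\le\alpha_K|\beta(r)-\beta(\bar r)|$ for all $r,\bar r\in K$). $\mathcal{M}(\mathbb{R}^d)$ is the space of signed Radon measures on $\mathbb{R}^d$ of bounded variation. $C_0^\infty([0,T)\times\mathbb{R}^d)$ denotes smooth functions with compact support in $[0,T)\times\mathbb{R}^d$. $H^{-1}(\mathbb{R}^d)$ is the dual of $H^1(\mathbb{R}^d)$. *)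

theory Defs
  imports "HOL-Analysis.Analysis" "HOL-Probability.Essential_Supremum"
begin

section \<open>Differential operators and test functions\<close>

definition partial_deriv :: "'a::euclidean_space \<Rightarrow> ('a \<Rightarrow> real) \<Rightarrow> 'a \<Rightarrow> real" where
  "partial_deriv e f x = frechet_derivative f (at x) e"

definition grad :: "('a::euclidean_space \<Rightarrow> real) \<Rightarrow> 'a \<Rightarrow> 'a" where
  "grad f x = (\<Sum>e\<in>Basis. partial_deriv e f x *\<^sub>R e)"

definition laplacian :: "('a::euclidean_space \<Rightarrow> real) \<Rightarrow> 'a \<Rightarrow> real" where
  "laplacian f x = (\<Sum>e\<in>Basis. partial_deriv e (partial_deriv e f) x)"

primrec Ck :: "nat \<Rightarrow> ('a::euclidean_space \<Rightarrow> real) \<Rightarrow> bool" where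
  "Ck 0 f \<longleftrightarrow> continuous_on UNIV f"
| "Ck (Suc k) f \<longleftrightarrow>
     (\<forall>x. f differentiable (at x)) \<and> (\<forall>e\<in>Basis. Ck k (partial_deriv e f))"

definition test_functions :: "('a::euclidean_space \<Rightarrow> real) set" where
  "test_functions = {\<phi>. (\<forall>k. Ck k \<phi>) \<and> compact (closure {x. \<phi> x \<noteq> 0})}"

text \<open>
  The space \<open>C\<^sub>0\<^sup>\<infinity>([0,T) \<times> \<real>\<^sup>d)\<close>. As \<open>[0,T) \<times> \<real>\<^sup>d\<close> is not open, a smooth function on it
  is understood as the restriction of a smooth function on the whole space-time; after a
  cutoff the extension has compact support in \<open>(-\<infinity>,T) \<times> \<real>\<^sup>d\<close>. The elements below are these
  extensions; only their values for \<open>t \<ge> 0\<close> are used.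
\<close>

definition test_functions_upto :: "real \<Rightarrow> (real \<times> 'a::euclidean_space \<Rightarrow> real) set" where
  "test_functions_upto T =
     {\<phi> \<in> test_functions. closure {z. \<phi> z \<noteq> 0} \<subseteq> {..<T} \<times> UNIV}"


section \<open>Lebesgue spaces\<close>

text \<open>
  Elements of \<open>L\<^sup>p\<close> are represented by measurable functions; all notions below are invariant
  under modification on null sets.
\<close>

definition Linf :: "'a measure \<Rightarrow> ('a \<Rightarrow> 'b::euclidean_space) set" where
  "Linf M = {f \<in> borel_measurable M. \<exists>C. AE x in M. norm (f x) \<le> C}"

definition L2 :: "'a measure \<Rightarrow> ('a \<Rightarrow> 'b::euclidean_space) set" where
  "L2 M = {f \<in> borel_measurable M. integrable M (\<lambda>x. (norm (f x))\<^sup>2)}"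

abbreviation space_time :: "real \<Rightarrow> (real \<times> 'a::euclidean_space) measure" where
  "space_time T \<equiv> lebesgue_on ({0<..<T} \<times> UNIV)"


section \<open>The Sobolev space \<open>H\<^sup>1\<close> and its dual\<close>

definition weak_gradient :: "('a::euclidean_space \<Rightarrow> real) \<Rightarrow> ('a \<Rightarrow> 'a) \<Rightarrow> bool" where
  "weak_gradient v g \<longleftrightarrow>
     (\<forall>\<phi>\<in>test_functions.
        (LINT x|lebesgue. v x *\<^sub>R grad \<phi> x) = - (LINT x|lebesgue. \<phi> x *\<^sub>R g x))"

definition H1 :: "('a::euclidean_space \<Rightarrow> real) set" where
  "H1 = {v \<in> L2 lebesgue. \<exists>g\<in>L2 lebesgue. weak_gradient v g}"

text \<open>The weak gradient is unique up to null sets, so the choice below does not matter.\<close>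

definition H1_norm :: "('a::euclidean_space \<Rightarrow> real) \<Rightarrow> real" where
  "H1_norm v =
     (let g = (SOME g. g \<in> L2 lebesgue \<and> weak_gradient v g)
      in sqrt ((LINT x|lebesgue. (v x)\<^sup>2) + (LINT x|lebesgue. (norm (g x))\<^sup>2)))"

text \<open>
  Functionals on \<open>H\<^sup>1\<close> are represented by functions whose values outside \<^const>\<open>H1\<close> are
  irrelevant. Boundedness forces equal values on representatives that agree almost everywhere.
\<close>

definition Hm1 :: "(('a::euclidean_space \<Rightarrow> real) \<Rightarrow> real) set" where
  "Hm1 = {F. (\<forall>v\<in>H1. \<forall>w\<in>H1. F (\<lambda>x. v x + w x) = F v + F w) \<and>
             (\<forall>c. \<forall>v\<in>H1. F (\<lambda>x. c * v x) = c * F v) \<and>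
             (\<exists>C. \<forall>v\<in>H1. \<bar>F v\<bar> \<le> C * H1_norm v)}"

definition Hm1_norm :: "(('a::euclidean_space \<Rightarrow> real) \<Rightarrow> real) \<Rightarrow> real" where
  "Hm1_norm F = (SUP v\<in>{v\<in>H1. H1_norm v \<le> 1}. \<bar>F v\<bar>)"

text \<open>
  The Bochner space \<open>L\<^sup>\<infinity>(0,T;H\<^sup>-\<^sup>1)\<close>: strongly measurable (almost everywhere limits of
  simple functions in the dual norm) and essentially bounded.
\<close>

definition Linf_Hm1 :: "real \<Rightarrow> (real \<Rightarrow> ('a::euclidean_space \<Rightarrow> real) \<Rightarrow> real) set" where
  "Linf_Hm1 T =
     {F. (AE t in lebesgue_on {0<..<T}. F t \<in> Hm1) \<and>
         (\<exists>S. (\<forall>n. simple_function (lebesgue_on {0<..<T}) (S n) \<and> (\<forall>t\<in>{0<..<T}. S n t \<in> Hm1)) \<and>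
              (AE t in lebesgue_on {0<..<T}.
                 (\<lambda>n. Hm1_norm (\<lambda>v. S n t v - F t v)) \<longlonglongrightarrow> 0)) \<and>
         (\<exists>C. AE t in lebesgue_on {0<..<T}. Hm1_norm (F t) \<le> C)}"

text \<open>
  The identification of \<open>L\<^sup>2\<close> with a subspace of \<open>H\<^sup>-\<^sup>1\<close> in the triple
  \<open>H\<^sup>1 \<subseteq> L\<^sup>2 \<subseteq> H\<^sup>-\<^sup>1\<close>. For \<open>y\<close> in \<open>L\<^sup>2((0,T) \<times> \<real>\<^sup>d)\<close> almost every slice
  \<open>y(t,\<cdot>)\<close> is in \<open>L\<^sup>2\<close>.
\<close>

definition pairing :: "('a::euclidean_space \<Rightarrow> real) \<Rightarrow> ('a \<Rightarrow> real) \<Rightarrow> real" where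
  "pairing w v = (LINT x|lebesgue. w x * v x)"


section \<open>Signed Radon measures of bounded variation\<close>

text \<open>
  A signed measure is a real-valued set function on the Borel sets. The positive variation
  is \<open>\<rho>\<^sup>+(A) = sup {\<rho>(B) | B \<subseteq> A}\<close>; the coercion \<^const>\<open>ennreal\<close> truncates negative
  values, which is harmless because \<open>B = {}\<close> is admitted.
\<close>

definition pos_variation :: "('a::topological_space set \<Rightarrow> real) \<Rightarrow> 'a measure" where
  "pos_variation \<rho> =
     measure_of UNIV (sets borel) (\<lambda>A. SUP B\<in>{B\<in>sets borel. B \<subseteq> A}. ennreal (\<rho> B))"

definition neg_variation :: "('a::topological_space set \<Rightarrow> real) \<Rightarrow> 'a measure" where
  "neg_variation \<rho> = pos_variation (\<lambda>A. - \<rho> A)"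

definition total_variation :: "('a::topological_space set \<Rightarrow> real) \<Rightarrow> 'a set \<Rightarrow> ennreal" where
  "total_variation \<rho> A = emeasure (pos_variation \<rho>) A + emeasure (neg_variation \<rho>) A"

definition signed_measure :: "('a::topological_space set \<Rightarrow> real) \<Rightarrow> bool" where
  "signed_measure \<rho> \<longleftrightarrow>
     (\<forall>A::nat \<Rightarrow> 'a set. range A \<subseteq> sets borel \<and> disjoint_family A \<longrightarrow>
        (\<lambda>i. \<rho> (A i)) sums \<rho> (\<Union>i. A i))"

definition signed_radon_measure_bv :: "('a::topological_space set \<Rightarrow> real) \<Rightarrow> bool" where
  "signed_radon_measure_bv \<rho> \<longleftrightarrow>
     signed_measure \<rho> \<and> total_variation \<rho> UNIV < \<infinity> \<and>
     (\<forall>A\<in>sets borel. \<forall>\<epsilon>>0. \<exists>K. compact K \<and> K \<subseteq> A \<and> total_variation \<rho> (A - K) < ennreal \<epsilon>)"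

definition signed_integral :: "('a::topological_space set \<Rightarrow> real) \<Rightarrow> ('a \<Rightarrow> real) \<Rightarrow> real" where
  "signed_integral \<rho> f = (LINT x|pos_variation \<rho>. f x) - (LINT x|neg_variation \<rho>. f x)"

lemma emeasure_pos_variation:
  fixes \<rho> :: "'a::topological_space set \<Rightarrow> real"
  assumes sm: "signed_measure \<rho>" and A: "A \<in> sets borel"
  shows "emeasure (pos_variation \<rho>) A = (SUP B\<in>{B\<in>sets borel. B \<subseteq> A}. ennreal (\<rho> B))"
proof -
  define \<mu> where "\<mu> = (\<lambda>A. SUP B\<in>{B\<in>sets borel. B \<subseteq> A}. ennreal (\<rho> B))"
  have sums: "(\<lambda>i. \<rho> (F i)) sums \<rho> (\<Union>i. F i)"
    if "range F \<subseteq> sets borel" "disjoint_family F" for F :: "nat \<Rightarrow> 'a set"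
    using sm that unfolding signed_measure_def by blast
  have "(\<lambda>i::nat. \<rho> {}) sums \<rho> {}"
    using sums[of "\<lambda>_. {}"] by (simp add: disjoint_family_on_def)
  then have "summable (\<lambda>i::nat. \<rho> {})" by (rule sums_summable)
  then have e0: "\<rho> {} = 0" by (simp add: summable_const_iff)
  have add: "\<rho> (B \<union> C) = \<rho> B + \<rho> C"
    if "B \<in> sets borel" "C \<in> sets borel" "B \<inter> C = {}" for B C
  proof -
    have "(\<lambda>i. \<rho> (binaryset B C i)) sums \<rho> (\<Union>i. binaryset B C i)"
      using that by (intro sums) (auto simp: range_binaryset_eq disjoint_family_on_def binaryset_def)
    then have "(\<lambda>i. \<rho> (binaryset B C i)) sums \<rho> (B \<union> C)"
      by (simp add: UN_binaryset_eq)
    moreover have "(\<lambda>i. \<rho> (binaryset B C i)) sums (\<rho> B + \<rho> C)"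
      using binaryset_sums[of \<rho> B C] e0 by simp
    ultimately show ?thesis by (rule sums_unique2)
  qed
  have up: "ennreal (\<rho> B) \<le> \<mu> A" if "B \<in> sets borel" "B \<subseteq> A" for A B
    unfolding \<mu>_def using that by (intro SUP_upper) auto
  have mono: "\<mu> A \<le> \<mu> B" if "A \<subseteq> B" for A B
    unfolding \<mu>_def using that by (intro SUP_subset_mono) auto
  have super: "\<mu> A + \<mu> B \<le> \<mu> (A \<union> B)" if AB: "A \<inter> B = {}" for A B
  proof -
    have 1: "ennreal (\<rho> C) + ennreal (\<rho> D) \<le> \<mu> (A \<union> B)"
      if "C \<in> sets borel" "C \<subseteq> A" "D \<in> sets borel" "D \<subseteq> B" for C D
    proof (cases "\<rho> C \<ge> 0 \<and> \<rho> D \<ge> 0")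
      case True
      have "ennreal (\<rho> C) + ennreal (\<rho> D) = ennreal (\<rho> (C \<union> D))"
        using True that AB by (subst add) (auto simp: ennreal_plus)
      also have "\<dots> \<le> \<mu> (A \<union> B)" using that by (intro up) auto
      finally show ?thesis .
    next
      case False
      then have "ennreal (\<rho> C) + ennreal (\<rho> D) = ennreal (\<rho> D) \<or>
                 ennreal (\<rho> C) + ennreal (\<rho> D) = ennreal (\<rho> C)"
        by (auto simp: ennreal_neg)
      then show ?thesis using that up[of C "A \<union> B"] up[of D "A \<union> B"] le_supI1[of C A B] le_supI2[of D B A]
        by (elim disjE) simp_all
    qed
    have "\<mu> A + ennreal (\<rho> D) \<le> \<mu> (A \<union> B)" if "D \<in> sets borel" "D \<subseteq> B" for D
    proof -
      have "\<mu> A + ennreal (\<rho> D) = (SUP C\<in>{C\<in>sets borel. C \<subseteq> A}. ennreal (\<rho> C) + ennreal (\<rho> D))"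
        unfolding \<mu>_def by (rule ennreal_SUP_add_left[symmetric]) auto
      also have "\<dots> \<le> \<mu> (A \<union> B)" using 1 that by (intro SUP_least) auto
      finally show ?thesis .
    qed
    moreover have "\<mu> A + \<mu> B = (SUP D\<in>{D\<in>sets borel. D \<subseteq> B}. \<mu> A + ennreal (\<rho> D))"
      unfolding \<mu>_def by (rule ennreal_SUP_add_right) auto
    ultimately show ?thesis by (auto intro: SUP_least)
  qed
  have ca: "countably_additive (sets borel) \<mu>"
  proof (rule countably_additiveI)
    fix F :: "nat \<Rightarrow> 'a set"
    assume F: "range F \<subseteq> sets borel" "disjoint_family F"
    have "(\<Sum>i<n. \<mu> (F i)) \<le> \<mu> (\<Union>i<n. F i)" for n
    proof (induction n)
      case (Suc n)
      have dis: "(\<Union>i<n. F i) \<inter> F n = {}"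
      proof -
        have "F i \<inter> F n = {}" if "i < n" for i
          using F(2) that unfolding disjoint_family_on_def by (metis UNIV_I nat_neq_iff)
        then show ?thesis by blast
      qed
      have "(\<Sum>i<Suc n. \<mu> (F i)) \<le> \<mu> (\<Union>i<n. F i) + \<mu> (F n)"
        using Suc by (simp add: add_right_mono)
      also have "\<dots> \<le> \<mu> ((\<Union>i<n. F i) \<union> F n)" by (rule super[OF dis])
      finally show ?case by (simp add: lessThan_Suc Un_commute)
    qed simp
    moreover have "\<mu> (\<Union>i<n. F i) \<le> \<mu> (\<Union>i. F i)" for n by (rule mono) blast
    ultimately have "(\<Sum>i<n. \<mu> (F i)) \<le> \<mu> (\<Union>i. F i)" for n by (rule order_trans)
    then have le: "(\<Sum>i. \<mu> (F i)) \<le> \<mu> (\<Union>i. F i)"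
      by (intro suminf_le_const summableI) auto
    have "ennreal (\<rho> B) \<le> (\<Sum>i. \<mu> (F i))" if B: "B \<in> sets borel" "B \<subseteq> (\<Union>i. F i)" for B
    proof -
      have "(\<lambda>i. \<rho> (B \<inter> F i)) sums \<rho> (\<Union>i. B \<inter> F i)"
        using F B by (intro sums) (auto simp: disjoint_family_on_def)
      moreover have "(\<Union>i. B \<inter> F i) = B" using B by auto
      ultimately have "(\<lambda>n. \<Sum>i<n. \<rho> (B \<inter> F i)) \<longlonglongrightarrow> \<rho> B" by (simp add: sums_def)
      then have lim: "(\<lambda>n. ennreal (\<Sum>i<n. \<rho> (B \<inter> F i))) \<longlonglongrightarrow> ennreal (\<rho> B)"
        by (rule tendsto_ennrealI)
      have "ennreal (\<Sum>i<n. \<rho> (B \<inter> F i)) \<le> (\<Sum>i. \<mu> (F i))" for n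
      proof -
        have "ennreal (\<Sum>i<n. \<rho> (B \<inter> F i)) \<le> ennreal (\<Sum>i<n. max 0 (\<rho> (B \<inter> F i)))"
          by (intro ennreal_leI sum_mono) auto
        also have "\<dots> = (\<Sum>i<n. ennreal (max 0 (\<rho> (B \<inter> F i))))"
          by (rule sum_ennreal[symmetric]) auto
        also have "\<dots> \<le> (\<Sum>i<n. \<mu> (F i))"
          using F B by (intro sum_mono) (auto simp: max_def ennreal_neg intro!: up)
        also have "\<dots> \<le> (\<Sum>i. \<mu> (F i))" by (rule sum_le_suminf) auto
        finally show ?thesis .
      qed
      then show ?thesis by (intro LIMSEQ_le_const2[OF lim]) auto
    qed
    then have "\<mu> (\<Union>i. F i) \<le> (\<Sum>i. \<mu> (F i))"
      unfolding \<mu>_def by (intro SUP_least) auto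
    with le show "(\<Sum>i. \<mu> (F i)) = \<mu> (\<Union>i. F i)" by (rule antisym)
  qed
  have pos: "positive (sets borel) \<mu>"
    unfolding positive_def \<mu>_def using e0 by (auto intro!: antisym SUP_least)
  have "emeasure (measure_of UNIV (sets borel) \<mu>) A = \<mu> A"
    using pos ca A sets.sigma_algebra_axioms[of "borel :: 'a measure"]
    by (intro emeasure_measure_of_sigma) auto
  then show ?thesis unfolding pos_variation_def \<mu>_def .
qed


section \<open>The linearized equation\<close>

definition hyp_j :: "(real \<Rightarrow> real) \<Rightarrow> bool" where
  "hyp_j \<beta> \<longleftrightarrow> \<beta> C1_differentiable_on UNIV \<and> (\<forall>r. deriv \<beta> r \<ge> 0) \<and> \<beta> 0 = 0"

definition hyp_jv :: "(real \<Rightarrow> real) \<Rightarrow> (real \<Rightarrow> real) \<Rightarrow> bool" where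
  "hyp_jv \<beta> b \<longleftrightarrow>
     (\<forall>K. compact K \<longrightarrow> (\<exists>\<alpha>>0. \<forall>r\<in>K. \<bar>deriv b r * r + b r\<bar> \<le> \<alpha> * \<bar>deriv \<beta> r\<bar>))"

definition beta_quot :: "(real \<Rightarrow> real) \<Rightarrow> real \<Rightarrow> real" where
  "beta_quot \<beta> r = (if r = 0 then deriv \<beta> 0 else \<beta> r / r)"

definition linearized_solution ::
  "(real \<Rightarrow> real) \<Rightarrow> (real \<Rightarrow> real) \<Rightarrow> ('a::euclidean_space \<Rightarrow> 'a) \<Rightarrow> real \<Rightarrow>
   (real \<times> 'a \<Rightarrow> real) \<Rightarrow> ('a set \<Rightarrow> real) \<Rightarrow> (real \<times> 'a \<Rightarrow> real) \<Rightarrow> bool" where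
  "linearized_solution \<beta> b D T u \<rho>\<^sub>0 \<rho> \<longleftrightarrow>
     (\<forall>\<phi>\<in>test_functions_upto T.
        (LINT (t, x)|space_time T.
           (deriv (\<lambda>s. \<phi> (s, x)) t
            + beta_quot \<beta> (u (t, x)) * laplacian (\<lambda>x. \<phi> (t, x)) x
            + b (u (t, x)) * (D x \<bullet> grad (\<lambda>x. \<phi> (t, x)) x)) * \<rho> (t, x))
        + signed_integral \<rho>\<^sub>0 (\<lambda>x. \<phi> (0, x)) = 0)"

end

theory Submission
  imports Defs "HOL-Probability.Distributions"
begin

text \<open>
  The difference \<open>z = y\<^sub>1 - y\<^sub>2\<close> solves \<open>z\<^sub>t = \<Delta>(a z) - div(c z)\<close> weakly with zero initial datum, where
  \<open>a = \<beta>(u)/u \<ge> 0\<close> is bounded and \<open>c = b(u) D\<close> satisfies \<open>|c| \<le> C a\<close> by (jv). With \<open>G\<close> the kernel of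
  \<open>(1 - \<Delta>)\<^sup>-\<^sup>1\<close>, the energy \<open>|G \<star> z|\<^sup>2 + |\<nabla>G \<star> z|\<^sup>2\<close>, that is the squared \<open>H\<^sup>-\<^sup>1\<close> norm of \<open>z\<close>, has half its
  time derivative equal to \<open>- \<integral> a z\<^sup>2 + \<integral> (G \<star> z) a z + \<integral> (\<nabla>G \<star> z) \<cdot> c z\<close>. The last two terms are absorbed by the
  first one and a multiple of the energy, because \<open>(a z)\<^sup>2\<close> and \<open>|c z|\<^sup>2\<close> are bounded by multiples of \<open>a z\<^sup>2\<close>; so the
  energy vanishes.

  The identity is made rigorous with even test functions \<open>k\<close> in place of \<open>G\<close>, chosen such that \<open>q = k - \<Delta>k\<close> runs
  through an approximate identity; they are cut-off truncated time integrals of the heat kernel. The first term becomes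
  \<open>- \<integral> (q \<star> z) (q \<star> (a z))\<close>, and only this one needs the limit. In place of Gronwall's lemma, the identity is
  integrated in time against \<open>exp(-l t)\<close> for large \<open>l\<close>.
\<close>

section \<open>Calculus of smooth functions\<close>

text \<open>Since a may vanish, an L2 energy for z would give no control, whereas in H^-1 the
  diffusion becomes the signed term a z^2. Multiplication by a does not commute with convolution, so
  this sign is visible only once q has disappeared; the other terms tolerate any q of bounded L1
  norm.

  Nothing is known about z in time beyond the weak equation. For each fixed x the convolution of z
  with k is almost everywhere a primitive of an integrable function, and test functions that do not
  vanish at time 0 fix its constant of integration. Energies therefore appear only under time
  integrals: integration by parts in time becomes Fubini on a triangle, and the weight exp(-l t)
  then gains the factor 1/l that absorbs the energy. Taking k even makes convolution self-adjoint,
  so the two halves of the derivative of the energy coincide.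

  The kernels k tend to G and not to the identity, so vanishing energies do not at once give z = 0.
  The operator 1 - \<Delta> has to be moved from k to a fixed smooth convolution of z before the
  limit is taken.\<close>

lemma partial_deriv_eq: "(f has_derivative f') (at x) \<Longrightarrow> partial_deriv e f x = f' e"
  unfolding partial_deriv_def by (metis frechet_derivative_at)

lemma partial_deriv_real: "(f has_real_derivative f') (at x) \<Longrightarrow> partial_deriv e f x = f' * e"
  unfolding has_field_derivative_def by (subst partial_deriv_eq) auto

lemma frechet_has: "f differentiable (at x) \<Longrightarrow> (f has_derivative frechet_derivative f (at x)) (at x)"
  by (simp add: frechet_derivative_works)

lemma frechet_derivative_eq_sum_partial_deriv:
  fixes f :: "'a::euclidean_space \<Rightarrow> real"
  assumes "f differentiable (at x)"
  shows "frechet_derivative f (at x) v = (\<Sum>b\<in>Basis. (v \<bullet> b) * partial_deriv b f x)"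
proof -
  interpret linear "frechet_derivative f (at x)"
    using assms by (rule linear_frechet_derivative)
  have "frechet_derivative f (at x) (\<Sum>b\<in>Basis. (v \<bullet> b) *\<^sub>R b) = (\<Sum>b\<in>Basis. (v \<bullet> b) * partial_deriv b f x)"
    by (simp add: sum scale partial_deriv_def)
  then show ?thesis by (simp add: euclidean_representation)
qed

lemma differentiable_continuous: "(\<And>x. (f::'a::euclidean_space \<Rightarrow> real) differentiable (at x)) \<Longrightarrow> continuous_on UNIV f"
  by (simp add: continuous_at_imp_continuous_on differentiable_imp_continuous_within)

text \<open>Derivatives of a concrete function rarely stay that function, so induction needs a
  family. Once a family is closed under first partial derivatives, induction on the order treats all
  its members at once.\<close>

lemma Ck_coinduct:
  fixes f :: "'a::euclidean_space \<Rightarrow> real"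
  assumes step: "\<And>f. f \<in> S \<Longrightarrow> (\<forall>x. f differentiable (at x)) \<and> (\<forall>e\<in>Basis. partial_deriv e f \<in> S)"
    and "f \<in> S"
  shows "Ck k f"
  using \<open>f \<in> S\<close>
proof (induction k arbitrary: f)
  case 0
  then show ?case using step[OF 0] by (auto intro: differentiable_continuous)
next
  case (Suc k)
  then show ?case using step[OF Suc.prems] by auto
qed

text \<open>Not contained in the recursion, which mentions continuity only at order 0;
  differentiability supplies it at the bottom of the induction.\<close>

lemma Ck_Suc_imp_Ck: "Ck (Suc k) f \<Longrightarrow> Ck k f"
  by (induction k arbitrary: f) (auto intro: differentiable_continuous)

lemma Ck_const: "Ck k (\<lambda>x. c)"
proof (induction k arbitrary: c)
  case (Suc k)
  have "partial_deriv e (\<lambda>x::'a. c) = (\<lambda>x. 0)" for e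
    by (rule ext, subst partial_deriv_eq[OF has_derivative_const]) simp
  with Suc show ?case by simp
qed simp

lemma partial_deriv_add:
  "f differentiable (at x) \<Longrightarrow> g differentiable (at x) \<Longrightarrow>
    partial_deriv e (\<lambda>x. f x + g x) x = partial_deriv e f x + partial_deriv e g x"
  by (subst partial_deriv_eq[OF has_derivative_add[OF frechet_has frechet_has]])
     (auto simp: partial_deriv_def)

lemma partial_deriv_mult:
  "f differentiable (at x) \<Longrightarrow> g differentiable (at x) \<Longrightarrow>
    partial_deriv e (\<lambda>x. f x * g x) x = f x * partial_deriv e g x + partial_deriv e f x * g x"
  by (subst partial_deriv_eq[OF has_derivative_mult[OF frechet_has frechet_has]])
     (auto simp: partial_deriv_def)

lemma Ck_add: "Ck k f \<Longrightarrow> Ck k g \<Longrightarrow> Ck k (\<lambda>x. f x + g x)"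
proof (induction k arbitrary: f g)
  case (Suc k)
  then have "partial_deriv e (\<lambda>x. f x + g x) = (\<lambda>x. partial_deriv e f x + partial_deriv e g x)" for e
    by (auto simp: partial_deriv_add)
  with Suc show ?case by (auto intro!: derivative_intros)
qed (auto intro!: continuous_intros)

lemma Ck_mult: "Ck k f \<Longrightarrow> Ck k g \<Longrightarrow> Ck k (\<lambda>x. f x * g x)"
proof (induction k arbitrary: f g)
  case (Suc k)
  then have eq: "partial_deriv e (\<lambda>x. f x * g x) = (\<lambda>x. f x * partial_deriv e g x + partial_deriv e f x * g x)" for e
    by (auto simp: partial_deriv_mult)
  have "Ck k f" "Ck k g" using Suc.prems by (auto intro: Ck_Suc_imp_Ck simp del: Ck.simps)
  with Suc show ?case by (auto intro!: derivative_intros Ck_add simp: eq)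
qed (auto intro!: continuous_intros)

definition smooth :: "('a::euclidean_space \<Rightarrow> real) \<Rightarrow> bool" where
  "smooth f \<longleftrightarrow> (\<forall>k. Ck k f)"

lemma smooth_Ck: "smooth f \<Longrightarrow> Ck k f"
  by (simp add: smooth_def)

lemma smooth_differentiable: "smooth f \<Longrightarrow> f differentiable (at x)"
  using smooth_Ck[of f "Suc 0"] by simp

lemma smooth_partial_deriv: "smooth f \<Longrightarrow> e \<in> Basis \<Longrightarrow> smooth (partial_deriv e f)"
  unfolding smooth_def using Ck.simps(2) by blast

lemma smooth_continuous_on: "smooth f \<Longrightarrow> continuous_on S f"
  by (rule continuous_on_subset[OF differentiable_continuous[OF smooth_differentiable]]) auto

lemma smooth_continuous_at: "smooth f \<Longrightarrow> isCont f x"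
  using smooth_continuous_on[of f UNIV] by (simp add: continuous_on_eq_continuous_at)

lemma smooth_borel: "smooth f \<Longrightarrow> f \<in> borel_measurable borel"
  by (intro borel_measurable_continuous_onI smooth_continuous_on)

lemma smooth_const: "smooth (\<lambda>x. c)"
  by (simp add: smooth_def Ck_const)

lemma smooth_add: "smooth f \<Longrightarrow> smooth g \<Longrightarrow> smooth (\<lambda>x. f x + g x)"
  by (simp add: smooth_def Ck_add)

lemma smooth_mult: "smooth f \<Longrightarrow> smooth g \<Longrightarrow> smooth (\<lambda>x. f x * g x)"
  by (simp add: smooth_def Ck_mult)

lemma smooth_minus: "smooth f \<Longrightarrow> smooth (\<lambda>x. - f x)"
  using smooth_mult[OF smooth_const[of "-1"], of f] by simp

lemma smooth_diff: "smooth f \<Longrightarrow> smooth g \<Longrightarrow> smooth (\<lambda>x. f x - g x)"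
  using smooth_add[OF _ smooth_minus, of f g] by simp

lemma smooth_sum: "(\<And>i. i \<in> I \<Longrightarrow> smooth (f i)) \<Longrightarrow> smooth (\<lambda>x. \<Sum>i\<in>I. f i x)"
  by (induction I rule: infinite_finite_induct) (auto intro: smooth_add smooth_const)

text \<open>The direction \<open>A e\<close> is in general no basis vector, while \<open>Ck\<close>
  knows only derivatives along \<open>Basis\<close>; hence the expansion of the chain rule into
  basis directions.\<close>

lemma partial_deriv_affine:
  fixes f :: "'b::euclidean_space \<Rightarrow> real" and A :: "'a::euclidean_space \<Rightarrow> 'b"
  assumes "bounded_linear A" "f differentiable (at (A x + c))"
  shows "((\<lambda>x. f (A x + c)) has_derivative (\<lambda>v. frechet_derivative f (at (A x + c)) (A v))) (at x)"
    and "partial_deriv e (\<lambda>x. f (A x + c)) x = (\<Sum>b\<in>Basis. (A e \<bullet> b) * partial_deriv b f (A x + c))"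
proof -
  have "((\<lambda>x. A x + c) has_derivative A) (at x)"
    by (auto intro!: derivative_eq_intros bounded_linear_imp_has_derivative[OF assms(1)])
  from has_derivative_compose[OF this frechet_has[OF assms(2)]]
  show 1: "((\<lambda>x. f (A x + c)) has_derivative (\<lambda>v. frechet_derivative f (at (A x + c)) (A v))) (at x)" .
  show "partial_deriv e (\<lambda>x. f (A x + c)) x = (\<Sum>b\<in>Basis. (A e \<bullet> b) * partial_deriv b f (A x + c))"
    unfolding partial_deriv_eq[OF 1] frechet_derivative_eq_sum_partial_deriv[OF assms(2)] ..
qed

lemma Ck_sum: "(\<And>i. i \<in> I \<Longrightarrow> Ck k (f i)) \<Longrightarrow> Ck k (\<lambda>x. \<Sum>i\<in>I. f i x)"
  by (induction I rule: infinite_finite_induct) (auto intro: Ck_add Ck_const)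

lemma Ck_affine:
  fixes f :: "'b::euclidean_space \<Rightarrow> real" and A :: "'a::euclidean_space \<Rightarrow> 'b"
  assumes A: "bounded_linear A"
  shows "Ck k f \<Longrightarrow> Ck k (\<lambda>x. f (A x + c))"
proof (induction k arbitrary: f)
  case 0
  have "continuous_on UNIV (\<lambda>x. A x + c)"
    by (intro continuous_intros linear_continuous_on A)
  with 0 show ?case by (auto intro: continuous_on_compose2[of UNIV f])
next
  case (Suc k)
  then have d: "f differentiable (at x)" for x by auto
  have eq: "partial_deriv e (\<lambda>x. f (A x + c)) = (\<lambda>x. \<Sum>b\<in>Basis. (A e \<bullet> b) * partial_deriv b f (A x + c))" for e
    by (rule ext) (rule partial_deriv_affine(2)[OF A d])
  show ?case
    using Suc partial_deriv_affine(1)[OF A d, of c]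
    by (auto simp: eq differentiable_def intro!: Ck_sum Ck_mult Ck_const)
qed

lemma smooth_affine:
  fixes f :: "'b::euclidean_space \<Rightarrow> real" and A :: "'a::euclidean_space \<Rightarrow> 'b"
  shows "bounded_linear A \<Longrightarrow> smooth f \<Longrightarrow> smooth (\<lambda>x. f (A x + c))"
  by (simp add: smooth_def Ck_affine)

lemma deriv_has_real: 
  fixes g :: "real \<Rightarrow> real"
  shows "g differentiable (at x) \<Longrightarrow> (g has_real_derivative partial_deriv 1 g x) (at x)"
proof -
  assume g: "g differentiable (at x)"
  then obtain d where "(g has_real_derivative d) (at x)" by (auto simp: real_differentiable_def)
  with partial_deriv_real[OF this, of 1] show ?thesis by simp
qed

lemma partial_deriv_compose:
  fixes h :: "'a::euclidean_space \<Rightarrow> real" and g :: "real \<Rightarrow> real"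
  assumes "h differentiable (at x)" "g differentiable (at (h x))"
  shows "(\<lambda>x. g (h x)) differentiable (at x)"
    and "partial_deriv e (\<lambda>x. g (h x)) x = partial_deriv 1 g (h x) * partial_deriv e h x"
proof -
  have "((\<lambda>x. g (h x)) has_derivative (\<lambda>v. partial_deriv 1 g (h x) * frechet_derivative h (at x) v)) (at x)"
    using has_derivative_compose[OF frechet_has[OF assms(1)] deriv_has_real[OF assms(2), unfolded has_field_derivative_def]]
    by simp
  from partial_deriv_eq[OF this] this show "partial_deriv e (\<lambda>x. g (h x)) x = partial_deriv 1 g (h x) * partial_deriv e h x"
    and "(\<lambda>x. g (h x)) differentiable (at x)"
    by (auto simp: partial_deriv_def differentiable_def)
qed

lemma Ck_compose:
  fixes h :: "'a::euclidean_space \<Rightarrow> real"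
  shows "Ck k g \<Longrightarrow> Ck k h \<Longrightarrow> Ck k (\<lambda>x. g (h x))"
proof (induction k arbitrary: g)
  case 0
  then show ?case by (auto intro: continuous_on_compose2[of UNIV g])
next
  case (Suc k)
  have "Ck k h" using Suc.prems(2) by (rule Ck_Suc_imp_Ck)
  moreover have "partial_deriv e (\<lambda>x. g (h x)) = (\<lambda>x. partial_deriv 1 g (h x) * partial_deriv e h x)" for e
    using Suc.prems by (intro ext partial_deriv_compose(2)[where h=h and g=g]) simp_all
  moreover have "(\<lambda>x. g (h x)) differentiable (at x)" for x
    using Suc.prems by (intro partial_deriv_compose(1)[where h=h and g=g]) simp_all
  ultimately show ?case using Suc by (auto intro!: Ck_mult)
qed

lemma smooth_compose: "smooth g \<Longrightarrow> smooth h \<Longrightarrow> smooth (\<lambda>x. g (h x))"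
  by (simp add: smooth_def Ck_compose)

section \<open>Smoothness on the real line and the elementary smooth functions\<close>

lemma smooth_real_coinduct:
  fixes f :: "real \<Rightarrow> real"
  assumes "\<And>f. f \<in> S \<Longrightarrow> \<exists>f'\<in>S. \<forall>x. (f has_real_derivative f' x) (at x)" and "f \<in> S"
  shows "smooth f"
  unfolding smooth_def
proof (intro allI Ck_coinduct[OF _ \<open>f \<in> S\<close>])
  fix f assume "f \<in> S"
  then obtain f' where f': "f' \<in> S" "\<And>x. (f has_real_derivative f' x) (at x)" using assms(1) by metis
  then have "partial_deriv 1 f = f'" by (auto simp: partial_deriv_real[OF f'(2)])
  with f' show "(\<forall>x. f differentiable (at x)) \<and> (\<forall>e\<in>Basis. partial_deriv e f \<in> S)"
    by (auto simp: real_differentiable_def)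
qed

lemma smooth_antideriv:
  fixes f :: "real \<Rightarrow> real"
  assumes "\<And>x. (f has_real_derivative f' x) (at x)" "smooth f'"
  shows "smooth f"
  unfolding smooth_def
proof
  fix k
  have p: "partial_deriv 1 f = f'" by (auto simp: partial_deriv_real[OF assms(1)])
  have "Ck (Suc k) f" using assms p by (auto simp: real_differentiable_def smooth_def)
  then show "Ck k f" by (rule Ck_Suc_imp_Ck)
qed

lemma smooth_ident: "smooth (\<lambda>x::real. x)"
  by (rule smooth_antideriv[of _ "\<lambda>x. 1"]) (auto intro!: derivative_eq_intros smooth_const)

lemma smooth_exp: "smooth (exp :: real \<Rightarrow> real)"
  by (rule smooth_real_coinduct[of "{exp}"]) (auto intro!: derivative_eq_intros)

lemma smooth_inner: "smooth (\<lambda>x. x \<bullet> (b::'a::euclidean_space))"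
  using smooth_affine[OF bounded_linear_inner_left smooth_ident, of b 0] by simp

lemma smooth_norm_sq: "smooth (\<lambda>x::'a::euclidean_space. (norm x)\<^sup>2)"
proof -
  have "smooth (\<lambda>x::'a. \<Sum>b\<in>Basis. (x \<bullet> b) * (x \<bullet> b))"
    by (intro smooth_sum smooth_mult smooth_inner)
  then show ?thesis
    by (simp add: power2_norm_eq_inner euclidean_inner[of x x for x])
qed

section \<open>Test functions\<close>

lemma test_functions_iff: "f \<in> test_functions \<longleftrightarrow> smooth f \<and> compact (closure {x. f x \<noteq> 0})"
  by (simp add: test_functions_def smooth_def)

lemma test_smooth: "f \<in> test_functions \<Longrightarrow> smooth f"
  by (simp add: test_functions_iff)

lemma test_functionsI:
  assumes "smooth f" "compact K" "\<And>x. x \<notin> K \<Longrightarrow> f x = 0"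
  shows "f \<in> test_functions"
proof -
  have "closure {x. f x \<noteq> 0} \<subseteq> K"
    using assms(2,3) by (intro closure_minimal) (auto simp: compact_imp_closed)
  then have "compact (closure {x. f x \<noteq> 0})"
    using assms(2) by (metis closed_closure compact_Int_closed inf.absorb_iff2)
  with assms(1) show ?thesis by (simp add: test_functions_iff)
qed

lemma test_functionsE:
  assumes "f \<in> test_functions"
  obtains K where "compact K" "\<And>x. x \<notin> K \<Longrightarrow> f x = 0"
proof (rule that)
  show "compact (closure {x. f x \<noteq> 0})" using assms by (simp add: test_functions_iff)
  show "f x = 0" if "x \<notin> closure {x. f x \<noteq> 0}" for x
    using that closure_subset[of "{x. f x \<noteq> 0}"] by blast
qed

lemma test_mult:
  assumes "smooth f" "g \<in> test_functions"
  shows "(\<lambda>x. f x * g x) \<in> test_functions"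
proof -
  obtain K where K: "compact K" "\<And>x. x \<notin> K \<Longrightarrow> g x = 0" using assms by (metis test_functionsE)
  then show ?thesis using assms by (intro test_functionsI[OF _ K(1)] smooth_mult) (auto simp: test_smooth)
qed

lemma test_scale: "g \<in> test_functions \<Longrightarrow> (\<lambda>x. c * g x) \<in> test_functions"
  by (intro test_mult smooth_const)

lemma test_add:
  assumes "f \<in> test_functions" "g \<in> test_functions" 
  shows "(\<lambda>x. f x + g x) \<in> test_functions"
proof -
  obtain K L where "compact K" "compact L" "\<And>x. x \<notin> K \<Longrightarrow> f x = 0" "\<And>x. x \<notin> L \<Longrightarrow> g x = 0"
    using assms by (metis test_functionsE)
  then show ?thesis using assms
    by (intro test_functionsI[of _ "K \<union> L"] smooth_add) (auto simp: test_smooth)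
qed

lemma test_diff: "f \<in> test_functions \<Longrightarrow> g \<in> test_functions \<Longrightarrow> (\<lambda>x. f x - g x) \<in> test_functions"
  using test_add[of f "\<lambda>x. (-1) * g x"] test_scale[of g "-1"] by simp

lemma test_zero: "(\<lambda>x. 0) \<in> test_functions"
  by (rule test_functionsI[of _ "{}"]) (auto intro: smooth_const)

lemma test_sum: "(\<And>i. i \<in> I \<Longrightarrow> f i \<in> test_functions) \<Longrightarrow> (\<lambda>x. \<Sum>i\<in>I. f i x) \<in> test_functions"
  by (induction I rule: infinite_finite_induct) (auto intro: test_add test_zero)

lemma test_partial_deriv:
  assumes "f \<in> test_functions" "e \<in> Basis"
  shows "partial_deriv e f \<in> test_functions"
proof -
  obtain K where K: "compact K" "\<And>x. x \<notin> K \<Longrightarrow> f x = 0" using assms(1) by (metis test_functionsE)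
  have "partial_deriv e f x = 0" if "x \<notin> K" for x
  proof -
    have "open (- K)" using K(1) by (simp add: compact_imp_closed open_Compl)
    then have "(f has_derivative (\<lambda>_. 0)) (at x)"
      using K(2) that by (intro has_derivative_transform_within_open[where f="\<lambda>_. 0" and g=f and s="-K"]) auto
    then show ?thesis by (simp add: partial_deriv_eq)
  qed
  with K show ?thesis using assms by (intro test_functionsI[OF smooth_partial_deriv]) (auto simp: test_smooth)
qed

lemma test_laplacian: "f \<in> test_functions \<Longrightarrow> laplacian f \<in> test_functions"
  unfolding laplacian_def[abs_def] by (intro test_sum test_partial_deriv)

lemma test_bounded:
  fixes f :: "'a::euclidean_space \<Rightarrow> real"
  assumes "f \<in> test_functions"
  obtains B where "B \<ge> 0" "\<And>x. \<bar>f x\<bar> \<le> B"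
proof -
  obtain K where K: "compact K" "\<And>x. x \<notin> K \<Longrightarrow> f x = 0" using assms by (metis test_functionsE)
  have "bounded (f ` K)"
    using K(1) assms by (intro compact_imp_bounded compact_continuous_image smooth_continuous_on test_smooth)
  then obtain B where "\<And>x. x \<in> K \<Longrightarrow> \<bar>f x\<bar> \<le> B" unfolding bounded_iff by auto
  then have "\<bar>f x\<bar> \<le> max 0 B" for x using K(2)[of x] by (cases "x \<in> K") (auto simp: le_max_iff_disj)
  then show ?thesis using that[of "max 0 B"] by auto
qed

lemma test_borel: "f \<in> test_functions \<Longrightarrow> f \<in> borel_measurable borel"
  by (intro smooth_borel test_smooth)

lemma test_integrable:
  fixes f :: "'a::euclidean_space \<Rightarrow> real"
  assumes "f \<in> test_functions"
  shows "integrable lborel f"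
proof -
  obtain K where K: "compact K" "\<And>x. x \<notin> K \<Longrightarrow> f x = 0" using assms by (metis test_functionsE)
  have "integrable lborel (\<lambda>x. indicator K x *\<^sub>R f x)"
    using K(1) assms by (intro borel_integrable_compact smooth_continuous_on test_smooth)
  moreover have "(\<lambda>x. indicator K x *\<^sub>R f x) = f" using K(2) by (fastforce simp: indicator_def fun_eq_iff)
  ultimately show ?thesis by simp
qed

text \<open>The support stays compact because \<open>A\<close> is invertible. An involution is its
  own inverse, which covers the two cases that occur, translations and reflections.\<close>

lemma test_affine:
  fixes A :: "'a::euclidean_space \<Rightarrow> 'a"
  assumes "f \<in> test_functions" "bounded_linear A" "\<And>x. A (A x) = x"
  shows "(\<lambda>x. f (A x + c)) \<in> test_functions"
proof -
  obtain K where K: "compact K" "\<And>x. x \<notin> K \<Longrightarrow> f x = 0" using assms by (metis test_functionsE)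
  have "compact ((\<lambda>y. A (y - c)) ` K)"
    using K(1) assms(2) 
    by (intro compact_continuous_image bounded_linear.continuous_on[OF assms(2)] continuous_intros)
  moreover have "f (A x + c) = 0" if "x \<notin> (\<lambda>y. A (y - c)) ` K" for x
  proof (rule K(2))
    have "x = A ((A x + c) - c)" using assms(3) by simp
    with that show "A x + c \<notin> K" by blast
  qed
  ultimately show ?thesis using assms by (intro test_functionsI[OF smooth_affine]) (auto simp: test_smooth)
qed

lemma test_reflect: "f \<in> test_functions \<Longrightarrow> (\<lambda>y. f (x - y)) \<in> test_functions"
  using test_affine[of f "\<lambda>y. - y" x] by (auto simp: bounded_linear_minus bounded_linear_ident)

section \<open>Bump functions\<close>

lemma poly_exp_minus_tendsto_0: "((\<lambda>x::real. poly P x * exp (- x)) \<longlongrightarrow> 0) at_top"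
proof -
  have "((\<lambda>x::real. \<Sum>i\<le>degree P. coeff P i * (x ^ i / exp x)) \<longlongrightarrow> (\<Sum>i\<le>degree P. coeff P i * 0)) at_top"
    by (intro tendsto_sum tendsto_mult tendsto_const tendsto_power_div_exp_0)
  then show ?thesis
    by (simp add: poly_altdef exp_minus sum_distrib_right divide_simps sum_divide_distrib)
qed

text \<open>Only the case of the constant polynomial 1 is wanted, but its derivatives leave it. With
  arbitrary polynomials in 1/x the family is closed under differentiation: P is replaced by X^2 (P -
  P').\<close>

definition flat_fun :: "real poly \<Rightarrow> real \<Rightarrow> real" where
  "flat_fun P x = (if x > 0 then poly P (1 / x) * exp (- (1 / x)) else 0)"

lemma flat_fun_has_derivative:
  "(flat_fun P has_real_derivative flat_fun ([:0, 0, 1:] * (P - pderiv P)) x) (at x)"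
proof -
  consider "x > 0" | "x < 0" | "x = 0" by linarith
  then show ?thesis
  proof cases
    case 1
    have "((\<lambda>x. poly P (1 / x) * exp (- (1 / x))) has_real_derivative
        flat_fun ([:0, 0, 1:] * (P - pderiv P)) x) (at x)"
      using 1 by (auto intro!: derivative_eq_intros simp: flat_fun_def power2_eq_square field_simps)
    then show ?thesis
      by (rule has_field_derivative_transform_within_open[of _ _ _ "{0<..}"]) (use 1 in \<open>auto simp: flat_fun_def\<close>)
  next
    case 2
    then have "((\<lambda>_. 0) has_real_derivative flat_fun ([:0, 0, 1:] * (P - pderiv P)) x) (at x)"
      by (simp add: flat_fun_def)
    then show ?thesis
      by (rule has_field_derivative_transform_within_open[of _ _ _ "{..<0}"])
         (use 2 in \<open>auto simp: flat_fun_def\<close>)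
  next
    case 3
    \<comment> \<open>The difference quotient at the origin is again a polynomial in 1/h, here X P,
      times exp(-1/h), and so vanishes as h decreases to 0.\<close>
    have "((\<lambda>h. poly ([:0, 1:] * P) (inverse h) * exp (- inverse h)) \<longlongrightarrow> 0) (at_right 0)"
      by (rule filterlim_compose[OF poly_exp_minus_tendsto_0 filterlim_inverse_at_top_right])
    then have r: "((\<lambda>h. flat_fun P h / h) \<longlongrightarrow> 0) (at_right 0)"
      by (rule Lim_transform_eventually)
         (auto simp: flat_fun_def eventually_at_filter inverse_eq_divide intro!: always_eventually)
    have l: "((\<lambda>h. flat_fun P h / h) \<longlongrightarrow> 0) (at_left 0)"
      by (rule Lim_transform_eventually[OF tendsto_const])
         (auto simp: flat_fun_def eventually_at_filter)
    have "((\<lambda>h. flat_fun P h / h) \<longlongrightarrow> 0) (at 0)"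
      using l r by (simp add: filterlim_split_at)
    then have "(flat_fun P has_real_derivative 0) (at 0)"
      by (simp add: has_field_derivative_iff flat_fun_def[of P 0])
    moreover have "flat_fun ([:0, 0, 1:] * (P - pderiv P)) 0 = 0" by (simp add: flat_fun_def)
    ultimately show ?thesis using 3 by simp
  qed
qed

lemma smooth_flat_fun: "smooth (flat_fun P)"
  by (rule smooth_real_coinduct[of "range flat_fun"])
     (use flat_fun_has_derivative in blast)+

definition bump :: "real \<Rightarrow> real" where
  "bump = flat_fun 1"

lemma bump_eq: "bump x = (if x > 0 then exp (- (1 / x)) else 0)"
  by (simp add: bump_def flat_fun_def)

lemma smooth_bump: "smooth bump"
  by (simp add: bump_def smooth_flat_fun)

lemma bump_pos: "x > 0 \<Longrightarrow> bump x > 0"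
  by (simp add: bump_eq)

lemma bump_bounds: "0 \<le> bump x" "bump x \<le> 1"
  by (auto simp: bump_eq)

text \<open>The factor \<open>exp 1\<close> normalises the value at the origin to 1. There is no
  plateau around it: the dilations converge to 1 pointwise, and that is all a dominated convergence
  argument asks for.\<close>

definition cutoff :: "'a::euclidean_space \<Rightarrow> real" where
  "cutoff x = exp 1 * bump (1 - (norm x)\<^sup>2)"

lemma cutoff_0: "cutoff 0 = 1"
  by (simp add: cutoff_def bump_eq flip: exp_add)

lemma cutoff_uminus: "cutoff (- x) = cutoff x"
  by (simp add: cutoff_def)

lemma cutoff_test: "(cutoff :: 'a::euclidean_space \<Rightarrow> real) \<in> test_functions"
proof (rule test_functionsI[of _ "cball 0 1"])
  show "smooth (cutoff :: 'a \<Rightarrow> real)"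
    unfolding cutoff_def[abs_def]
    by (intro smooth_mult smooth_const smooth_compose[OF smooth_bump] smooth_diff smooth_norm_sq)
  show "cutoff x = 0" if "x \<notin> cball 0 1" for x :: 'a
  proof -
    have "1 \<le> (norm x)\<^sup>2" using that by (intro one_le_power) simp
    then have "bump (1 - (norm x)\<^sup>2) = 0" unfolding bump_eq by (intro if_not_P) linarith
    then show ?thesis by (simp add: cutoff_def)
  qed
qed auto

definition cutoff_at :: "real \<Rightarrow> 'a::euclidean_space \<Rightarrow> real" where
  "cutoff_at R x = cutoff ((1 / R) *\<^sub>R x)"

lemma partial_deriv_scale:
  fixes f :: "'a::euclidean_space \<Rightarrow> real"
  assumes "smooth f" "e \<in> Basis"
  shows "partial_deriv e (\<lambda>x. f (c *\<^sub>R x)) = (\<lambda>x. c * partial_deriv e f (c *\<^sub>R x))"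
proof
  fix x :: 'a
  have "partial_deriv e (\<lambda>x. f (c *\<^sub>R x + 0)) x = (\<Sum>b\<in>Basis. ((c *\<^sub>R e) \<bullet> b) * partial_deriv b f (c *\<^sub>R x + 0))"
    by (intro partial_deriv_affine(2) bounded_linear_scaleR_right smooth_differentiable assms)
  also have "\<dots> = (\<Sum>b\<in>Basis. if b = e then c * partial_deriv e f (c *\<^sub>R x) else 0)"
    using assms(2) by (intro sum.cong) (auto simp: inner_Basis)
  finally show "partial_deriv e (\<lambda>x. f (c *\<^sub>R x)) x = c * partial_deriv e f (c *\<^sub>R x)"
    using assms(2) by simp
qed

lemma partial_deriv_cmult:
  "f differentiable (at x) \<Longrightarrow> partial_deriv e (\<lambda>x. c * f x) x = c * partial_deriv e f x"
  by (subst partial_deriv_mult) (auto simp: partial_deriv_eq[OF has_derivative_const])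

text \<open>Every derivative that falls on the dilated cut-off costs a factor 1/R, which is what
  makes the truncation errors disappear.\<close>

lemma cutoff_at_derivs:
  assumes "e \<in> Basis"
  shows "partial_deriv e (cutoff_at R) = (\<lambda>x::'a::euclidean_space. 1 / R * partial_deriv e cutoff ((1 / R) *\<^sub>R x))"
    and "partial_deriv e (partial_deriv e (cutoff_at R)) =
         (\<lambda>x::'a. 1 / R\<^sup>2 * partial_deriv e (partial_deriv e cutoff) ((1 / R) *\<^sub>R x))"
proof -
  have sm: "smooth (cutoff :: 'a \<Rightarrow> real)" by (intro test_smooth cutoff_test)
  show 1: "partial_deriv e (cutoff_at R) = (\<lambda>x::'a. 1 / R * partial_deriv e cutoff ((1 / R) *\<^sub>R x))"
    using partial_deriv_scale[OF sm assms, of "1/R"] by (simp add: cutoff_at_def[abs_def])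
  have sm': "smooth (partial_deriv e (cutoff :: 'a \<Rightarrow> real))" by (intro smooth_partial_deriv sm assms)
  have sm2: "smooth (\<lambda>x. partial_deriv e cutoff ((1 / R) *\<^sub>R x + 0))"
    by (rule smooth_affine[OF bounded_linear_scaleR_right sm'])
  show "partial_deriv e (partial_deriv e (cutoff_at R)) =
         (\<lambda>x::'a. 1 / R\<^sup>2 * partial_deriv e (partial_deriv e cutoff) ((1 / R) *\<^sub>R x))"
  proof
    fix x :: 'a
    have "partial_deriv e (partial_deriv e (cutoff_at R)) x =
        1 / R * partial_deriv e (\<lambda>x. partial_deriv e cutoff ((1 / R) *\<^sub>R x)) x"
      unfolding 1 using smooth_differentiable[OF sm2, of x] by (intro partial_deriv_cmult) simp
    also have "\<dots> = 1 / R\<^sup>2 * partial_deriv e (partial_deriv e cutoff) ((1 / R) *\<^sub>R x)"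
      by (simp add: partial_deriv_scale[OF sm' assms] power2_eq_square)
    finally show "partial_deriv e (partial_deriv e (cutoff_at R)) x = 
      1 / R\<^sup>2 * partial_deriv e (partial_deriv e cutoff) ((1 / R) *\<^sub>R x)" .
  qed
qed

lemma cutoff_at_test: 
  assumes "R > 0" 
  shows "(cutoff_at R :: 'a::euclidean_space \<Rightarrow> real) \<in> test_functions"
proof (rule test_functionsI[of _ "cball 0 R"])
  have "smooth (\<lambda>x::'a. cutoff ((1 / R) *\<^sub>R x + 0))"
    by (rule smooth_affine[OF bounded_linear_scaleR_right test_smooth[OF cutoff_test]])
  then show "smooth (cutoff_at R :: 'a \<Rightarrow> real)" by (simp add: cutoff_at_def[abs_def])
  show "cutoff_at R x = 0" if "x \<notin> cball 0 R" for x :: 'a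
  proof -
    have "1 \<le> (norm ((1 / R) *\<^sub>R x))\<^sup>2" using that assms by (intro one_le_power) simp
    then have "bump (1 - (norm ((1 / R) *\<^sub>R x))\<^sup>2) = 0" unfolding bump_eq by (intro if_not_P) linarith
    then show ?thesis by (simp add: cutoff_at_def cutoff_def)
  qed
qed auto

section \<open>Integrals depending on a parameter\<close>

lemma integral_parameter_derivative:
  fixes F :: "real \<times> 'a::euclidean_space \<Rightarrow> real"
  assumes F: "smooth F"
  shows "(\<lambda>x. integral {a..b} (\<lambda>s. F (s, x))) differentiable (at x)"
    and "e \<in> Basis \<Longrightarrow> partial_deriv e (\<lambda>x. integral {a..b} (\<lambda>s. F (s, x))) =
           (\<lambda>x. integral {a..b} (\<lambda>s. partial_deriv (0, e) F (s, x)))"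
proof -
  \<comment> \<open>The Leibniz rule asks for the derivative as a jointly continuous family of
    bounded linear maps. Assembling it from the partial derivatives reduces its continuity to
    theirs.\<close>
  define fx where "fx x s = (\<Sum>c\<in>Basis. partial_deriv (0, c) F (s, x) *\<^sub>R blinfun_inner_left c)" for x :: 'a and s
  have B: "(0, c) \<in> Basis" if "c \<in> Basis" for c :: 'a using that by (simp add: Basis_prod_def)
  have c1: "continuous_on S (\<lambda>p. partial_deriv (0, c) F (snd p, fst p))" if "c \<in> Basis" for c :: 'a and S
    by (rule continuous_on_compose2[OF smooth_continuous_on[OF smooth_partial_deriv[OF F B[OF that]], of UNIV]])
       (auto intro!: continuous_intros)
  have c2: "continuous_on S (\<lambda>s. partial_deriv (0, c) F (s, x))" if "c \<in> Basis" for c :: 'a and S x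
    by (rule continuous_on_compose2[OF smooth_continuous_on[OF smooth_partial_deriv[OF F B[OF that]], of UNIV]])
       (auto intro!: continuous_intros)
  have c3: "continuous_on S (\<lambda>s. F (s, x))" for S x
    by (rule continuous_on_compose2[OF smooth_continuous_on[OF F, of UNIV]])
       (auto intro!: continuous_intros)
  have d: "((\<lambda>x. F (s, x)) has_derivative blinfun_apply (fx x s)) (at x)" for s x
  proof -
    have "((\<lambda>x. (s, x)) has_derivative (\<lambda>v. (0, v))) (at x)"
      by (auto intro!: derivative_eq_intros)
    from has_derivative_compose[OF this frechet_has[OF smooth_differentiable[OF F]]]
    have "((\<lambda>x. F (s, x)) has_derivative (\<lambda>v. frechet_derivative F (at (s, x)) (0, v))) (at x)" .
    moreover have "frechet_derivative F (at (s, x)) (0, v) = blinfun_apply (fx x s) v" for v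
    proof -
      interpret linear "frechet_derivative F (at (s, x))"
        by (intro linear_frechet_derivative smooth_differentiable F)
      have "(0::real, v) = (\<Sum>c\<in>Basis. (v \<bullet> c) *\<^sub>R (0, c))"
        by (rule prod_eqI) (simp_all add: fst_sum snd_sum euclidean_representation)
      then have "frechet_derivative F (at (s, x)) (0, v) = (\<Sum>c\<in>Basis. (v \<bullet> c) * frechet_derivative F (at (s, x)) (0, c))"
        by (simp add: sum scale del: scaleR_Pair)
      then show ?thesis
        by (simp add: fx_def blinfun.sum_left blinfun.scaleR_left partial_deriv_def mult.commute)
    qed
    ultimately show ?thesis by simp
  qed
  have L: "((\<lambda>x. integral (cbox a b) (\<lambda>s. F (s, x))) has_derivative integral (cbox a b) (fx x)) (at x within UNIV)" for x
  proof (rule leibniz_rule)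
    show "(\<lambda>s. F (s, x)) integrable_on cbox a b" for x by (intro integrable_continuous c3)
    show "continuous_on (UNIV \<times> cbox a b) (\<lambda>(x, s). fx x s)"
      by (auto intro!: continuous_intros c1 simp: fx_def case_prod_unfold)
  qed (auto intro: d)
  then show "(\<lambda>x. integral {a..b} (\<lambda>s. F (s, x))) differentiable (at x)"
    by (auto simp: differentiable_def)
  show "partial_deriv e (\<lambda>x. integral {a..b} (\<lambda>s. F (s, x))) =
           (\<lambda>x. integral {a..b} (\<lambda>s. partial_deriv (0, e) F (s, x)))" if e: "e \<in> Basis"
  proof
    fix x
    have "partial_deriv e (\<lambda>x. integral {a..b} (\<lambda>s. F (s, x))) x = blinfun_apply (integral (cbox a b) (fx x)) e"
      using partial_deriv_eq[OF L[simplified]] by (simp add: cbox_interval)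
    also have "\<dots> = integral (cbox a b) (\<lambda>s. blinfun_apply (fx x s) e)"
      by (intro blinfun_apply_integral integrable_continuous) (auto simp: fx_def intro!: continuous_intros c2)
    also have "(\<lambda>s. blinfun_apply (fx x s) e) = (\<lambda>s. \<Sum>c\<in>Basis. if c = e then partial_deriv (0, e) F (s, x) else 0)"
      by (auto simp: fx_def fun_eq_iff blinfun.sum_left blinfun.scaleR_left inner_Basis e if_distrib cong: if_cong)
    also have "\<dots> = (\<lambda>s. partial_deriv (0, e) F (s, x))" using e by simp
    finally show "partial_deriv e (\<lambda>x. integral {a..b} (\<lambda>s. F (s, x))) x = integral {a..b} (\<lambda>s. partial_deriv (0, e) F (s, x))"
      by (simp add: cbox_interval)
  qed
qed

text \<open>Differentiating under the integral sign gives a parameter integral of another smooth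
  integrand, so the family of all of them is closed under partial derivatives.\<close>

lemma smooth_integral_parameter:
  fixes F :: "real \<times> 'a::euclidean_space \<Rightarrow> real"
  assumes "smooth F"
  shows "smooth (\<lambda>x. integral {a..b} (\<lambda>s. F (s, x)))"
  unfolding smooth_def
proof (intro allI Ck_coinduct[where S="(\<lambda>F x. integral {a..b} (\<lambda>s. F (s, x))) ` {F. smooth F}"])
  fix k and f :: "'a \<Rightarrow> real"
  assume "f \<in> (\<lambda>F x. integral {a..b} (\<lambda>s. F (s, x))) ` {F. smooth F}"
  then obtain F where F: "smooth F" "f = (\<lambda>x. integral {a..b} (\<lambda>s. F (s, x)))" by auto
  have "smooth (partial_deriv (0, e) F)" if "e \<in> Basis" for e
    using that by (intro smooth_partial_deriv F) (simp add: Basis_prod_def)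
  then show "(\<forall>x. f differentiable (at x)) \<and> 
    (\<forall>e\<in>Basis. partial_deriv e f \<in> (\<lambda>F x. integral {a..b} (\<lambda>s. F (s, x))) ` {F. smooth F})"
    using integral_parameter_derivative[OF F(1), where a=a and b=b] unfolding F(2) by auto
qed (use assms in auto)

section \<open>Heat kernels\<close>

lemma gauss_integrable_real: "c > 0 \<Longrightarrow> integrable lborel (\<lambda>x::real. exp (- (c * x\<^sup>2)))"
proof -
  assume c: "c > 0"
  \<comment> \<open>The standard deviation at which the centred normal density has exponent -c
    x^2.\<close>
  define s where "s = 1 / sqrt (2 * c)"
  have s: "2 * s\<^sup>2 = 1 / c" "s > 0" using c by (simp_all add: s_def power_divide)
  have "integrable lborel (\<lambda>x. sqrt (2 * pi * s\<^sup>2) * normal_density 0 s x)" 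
    using s by (intro integrable_mult_right integrable_normal_density)
  moreover have "sqrt (2 * pi * s\<^sup>2) * normal_density 0 s x = exp (- (c * x\<^sup>2))" for x
    using s c by (simp add: normal_density_def)
  ultimately show ?thesis by simp
qed

text \<open>The Gaussian is the product of its one-dimensional factors in the coordinates, so its
  integral is a product of finite ones.\<close>

lemma gauss_integrable:
  assumes c: "c > 0"
  shows "integrable lborel (\<lambda>x::'a::euclidean_space. exp (- (c * (norm x)\<^sup>2)))"
proof (rule integrableI_bounded)
  have eq: "exp (- (c * (norm x)\<^sup>2)) = (\<Prod>b\<in>Basis. exp (- (c * (x \<bullet> b)\<^sup>2)))" for x :: 'a
    unfolding power2_norm_eq_inner euclidean_inner[of x x]
    by (simp add: exp_sum[symmetric] sum_distrib_left sum_negf power2_eq_square)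
  have "(\<integral>\<^sup>+x. ennreal (norm (exp (- (c * (norm (x::'a))\<^sup>2)))) \<partial>lborel) =
      (\<integral>\<^sup>+x. (\<Prod>b\<in>Basis. ennreal (exp (- (c * ((x::'a) \<bullet> b)\<^sup>2)))) \<partial>lborel)"
    by (simp add: eq prod_ennreal abs_prod)
  also have "\<dots> = (\<Prod>b\<in>(Basis::'a set). (\<integral>\<^sup>+x. ennreal (exp (- (c * x\<^sup>2))) \<partial>lborel))"
    by (subst nn_integral_lborel_prod) auto
  also have "\<dots> = (\<Prod>b\<in>(Basis::'a set). ennreal (LINT x|lborel. exp (- (c * x\<^sup>2))))"
    using gauss_integrable_real[OF c] by (simp add: nn_integral_eq_integral)
  also have "\<dots> < \<infinity>" by (simp add: power_less_top_ennreal)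
  finally show "(\<integral>\<^sup>+x. ennreal (norm (exp (- (c * (norm (x::'a))\<^sup>2)))) \<partial>lborel) < \<infinity>" .
qed simp

section \<open>Affine changes of variables\<close>

lemma nn_integral_lborel_affine:
  fixes f :: "'a::euclidean_space \<Rightarrow> ennreal"
  assumes [measurable]: "f \<in> borel_measurable borel" and c: "c \<noteq> 0"
  shows "(\<integral>\<^sup>+x. f x \<partial>lborel) = ennreal (\<bar>c\<bar> ^ DIM('a)) * (\<integral>\<^sup>+x. f (t + c *\<^sub>R x) \<partial>lborel)"
  by (subst lborel_affine[OF c, of t])
     (simp add: nn_integral_density nn_integral_distr nn_integral_cmult)

lemma integrable_lborel_affine_iff:
  fixes f :: "'a::euclidean_space \<Rightarrow> real"
  assumes [measurable]: "f \<in> borel_measurable borel" and c: "c \<noteq> 0"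
  shows "integrable lborel (\<lambda>x. f (t + c *\<^sub>R x)) \<longleftrightarrow> integrable lborel f"
  unfolding integrable_iff_bounded
  by (subst (2) nn_integral_lborel_affine[OF _ c, of _ t])
     (use c in \<open>auto simp: ennreal_mult_less_top ennreal_mult_eq_top_iff less_top\<close>)

lemma integral_lborel_affine:
  fixes f :: "'a::euclidean_space \<Rightarrow> real"
  assumes [measurable]: "f \<in> borel_measurable borel" and c: "c \<noteq> 0"
  shows "(LINT x|lborel. f x) = \<bar>c\<bar> ^ DIM('a) * (LINT x|lborel. f (t + c *\<^sub>R x))"
  by (subst lborel_affine[OF c, of t])
     (simp add: integral_density integral_distr)

lemma integral_lborel_reflect:
  fixes f :: "'a::euclidean_space \<Rightarrow> real"
  assumes [measurable]: "f \<in> borel_measurable borel"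
  shows "(LINT x|lborel. f (t - x)) = (LINT x|lborel. f x)"
  using integral_lborel_affine[OF assms, of "-1" t] by simp

lemma integral_lborel_translate:
  fixes f :: "'a::euclidean_space \<Rightarrow> real"
  assumes [measurable]: "f \<in> borel_measurable borel"
  shows "(LINT x|lborel. f (t + x)) = (LINT x|lborel. f x)"
  using integral_lborel_affine[OF assms, of "1" t] by simp

text \<open>Normalisation by the mass itself. Its explicit value, a power of 4 pi, never
  enters.\<close>

definition gauss_const :: "'a::euclidean_space itself \<Rightarrow> real" where
  "gauss_const _ = 1 / (LINT y::'a|lborel. exp (- (1 / 4 * (norm y)\<^sup>2)))"

text \<open>The heat kernel at time \<open>exp \<sigma>\<close>: in logarithmic time it is smooth on the whole space-time.\<close>

definition heat :: "real \<Rightarrow> 'a::euclidean_space \<Rightarrow> real" where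
  "heat \<sigma> x = gauss_const TYPE('a) * exp (- (real DIM('a) * \<sigma> / 2) - (norm x)\<^sup>2 * exp (- \<sigma>) / 4)"

lemma gauss_mass_pos: "(LINT y::'a::euclidean_space|lborel. exp (- (1 / 4 * (norm y)\<^sup>2))) > 0"
proof -
  have i: "integrable lborel (\<lambda>y::'a. exp (- (1 / 4 * (norm y)\<^sup>2)))" by (rule gauss_integrable) simp
  have "(LINT y::'a|lborel. exp (- (1 / 4 * (norm y)\<^sup>2))) \<noteq> 0"
  proof
    assume "(LINT y::'a|lborel. exp (- (1 / 4 * (norm y)\<^sup>2))) = 0"
    then have "AE y::'a in lborel. exp (- (1 / 4 * (norm y)\<^sup>2)) = 0"
      by (subst (asm) integral_nonneg_eq_0_iff_AE[OF i]) auto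
    then have "AE y::'a in lborel. False" by simp
    then show False by (simp add: AE_iff_null null_sets_def)
  qed
  moreover have "(LINT y::'a|lborel. exp (- (1 / 4 * (norm y)\<^sup>2))) \<ge> 0"
    by (rule Bochner_Integration.integral_nonneg) simp
  ultimately show ?thesis by linarith
qed

lemma gauss_const_pos: "gauss_const TYPE('a::euclidean_space) > 0"
  using gauss_mass_pos[where 'a='a] by (simp add: gauss_const_def)

lemma heat_pos: "heat \<sigma> (x::'a::euclidean_space) > 0"
  unfolding heat_def by (intro mult_pos_pos gauss_const_pos) auto

lemma heat_borel [measurable]: "heat \<sigma> \<in> borel_measurable borel"
  unfolding heat_def[abs_def] by measurable

text \<open>Self-similarity of the heat kernel: the kernel at time exp \<sigma> is the one at time 1
  spread by the factor exp(\<sigma>/2). Its mass and its concentration for \<sigma> tending to minus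
  infinity both follow from the case \<sigma> = 0.\<close>

lemma heat_scale: 
  "exp (real DIM('a) * \<sigma> / 2) * heat \<sigma> (exp (\<sigma> / 2) *\<^sub>R x) = heat 0 (x::'a::euclidean_space)"
proof -
  have "(exp (\<sigma> / 2))\<^sup>2 * exp (- \<sigma>) = 1" by (simp add: power2_eq_square flip: exp_add)
  then have "(norm (exp (\<sigma> / 2) *\<^sub>R x))\<^sup>2 * exp (- \<sigma>) = (norm x)\<^sup>2"
    by (simp add: power_mult_distrib mult.commute mult.left_commute)
  then have "heat \<sigma> (exp (\<sigma> / 2) *\<^sub>R x) = gauss_const TYPE('a) * exp (- (real DIM('a) * \<sigma> / 2) - (norm x)\<^sup>2 / 4)"
    unfolding heat_def by simp
  then show ?thesis by (simp add: heat_def mult.left_commute flip: exp_add)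
qed

lemma integrable_heat: "integrable lborel (heat \<sigma> :: 'a::euclidean_space \<Rightarrow> real)"
proof -
  have "integrable lborel (\<lambda>x::'a. gauss_const TYPE('a) * exp (- (real DIM('a) * \<sigma> / 2)) *
      exp (- (exp (- \<sigma>) / 4 * (norm x)\<^sup>2)))"
    by (intro integrable_mult_right gauss_integrable) simp
  then show ?thesis unfolding heat_def[abs_def] by (simp add: mult.commute mult.assoc flip: exp_add)
qed

lemma integral_heat_scale:
  assumes [measurable]: "F \<in> borel_measurable borel"
  shows "(LINT x|lborel. heat \<sigma> x * F x) = (LINT x::'a::euclidean_space|lborel. heat 0 x * F (exp (\<sigma> / 2) *\<^sub>R x))"
proof -
  have "exp (real DIM('a) * \<sigma> / 2) = \<bar>exp (\<sigma> / 2)\<bar> ^ DIM('a)" by (simp flip: exp_of_nat_mult)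
  then have "(LINT x::'a|lborel. heat \<sigma> x * F x) = 
     exp (real DIM('a) * \<sigma> / 2) * (LINT x::'a|lborel. heat \<sigma> (exp (\<sigma> / 2) *\<^sub>R x) * F (exp (\<sigma> / 2) *\<^sub>R x))"
    by (subst integral_lborel_affine[of _ "exp (\<sigma>/2)" 0]) simp_all
  then show ?thesis by (simp add: heat_scale mult.assoc flip: integral_mult_right_zero)
     (simp add: heat_scale mult.assoc[symmetric])
qed

lemma integral_heat: "(LINT x::'a::euclidean_space|lborel. heat \<sigma> x) = 1"
proof -
  have "(LINT x::'a|lborel. heat \<sigma> x) = (LINT x::'a|lborel. heat 0 x)"
    using integral_heat_scale[of "\<lambda>_. 1" \<sigma>] by simp
  also have "\<dots> = 1" using gauss_mass_pos[where 'a='a] by (simp add: heat_def[abs_def] gauss_const_def)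
  finally show ?thesis .
qed

text \<open>Integrand of the formula that writes the resolvent of the Laplacian as the integral of
  exp(-t) times the heat flow, with t = exp s: the last summand in the exponent is the Jacobian, and
  the shift by exp \<sigma> gives the starting time weight one.\<close>

definition potential_density :: "real \<Rightarrow> real \<times> 'a::euclidean_space \<Rightarrow> real" where
  "potential_density \<sigma> z = exp (exp \<sigma> - exp (fst z) + fst z) * heat (fst z) (snd z)"

lemma smooth_potential_density: "smooth (potential_density \<sigma> :: real \<times> 'a::euclidean_space \<Rightarrow> real)"
proof -
  have f: "smooth (fst :: real \<times> 'a \<Rightarrow> real)"
    using smooth_affine[OF bounded_linear_fst smooth_ident, of 0] by simp
  have n: "smooth (\<lambda>z::real \<times> 'a. (norm (snd z))\<^sup>2)"
    using smooth_affine[OF bounded_linear_snd smooth_norm_sq, of 0] by simp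
  note e = smooth_compose[OF smooth_exp]
  show ?thesis
    unfolding potential_density_def[abs_def] heat_def divide_inverse
    by (intro smooth_mult e smooth_diff smooth_add smooth_minus smooth_const f n)
qed

lemma partial_deriv_snd:
  fixes F :: "real \<times> 'a::euclidean_space \<Rightarrow> real"
  assumes "smooth F"
  shows "partial_deriv (0, e) F (s, x) = partial_deriv e (\<lambda>x. F (s, x)) x"
proof -
  have "((\<lambda>x. (s, x)) has_derivative (\<lambda>v. (0, v))) (at x)"
    by (auto intro!: derivative_eq_intros)
  from has_derivative_compose[OF this frechet_has[OF smooth_differentiable[OF assms]]]
  show ?thesis by (subst partial_deriv_eq) (auto simp: partial_deriv_def)
qed

lemma potential_density_derivs:
  fixes x :: "'a::euclidean_space"
  assumes "e \<in> Basis"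
  shows "partial_deriv (0, e) (potential_density \<sigma>) (s, x) = potential_density \<sigma> (s, x) * (- ((x \<bullet> e) * exp (- s) / 2))"
    and "partial_deriv (0, e) (partial_deriv (0, e) (potential_density \<sigma>)) (s, x) = 
          potential_density \<sigma> (s, x) * ((x \<bullet> e)\<^sup>2 * exp (- 2 * s) / 4 - exp (- s) / 2)"
proof -
  define P where "P = (potential_density \<sigma> :: real \<times> 'a \<Rightarrow> real)"
  have sm: "smooth P" unfolding P_def by (rule smooth_potential_density)
  have B: "(0, e) \<in> Basis" using assms by (simp add: Basis_prod_def)
  have d: "((\<lambda>x. P (s, x)) has_derivative (\<lambda>v. P (s, x) * (- ((x \<bullet> v) * exp (- s) / 2)))) (at x)" for x
    unfolding P_def potential_density_def heat_def power2_norm_eq_inner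
    by (auto intro!: derivative_eq_intros simp: fun_eq_iff inner_commute algebra_simps add_divide_distrib)
  have 1: "partial_deriv (0, e) P (s, x) = P (s, x) * (- ((x \<bullet> e) * exp (- s) / 2))" for x
    unfolding partial_deriv_snd[OF sm] partial_deriv_eq[OF d] ..
  have d2: "((\<lambda>x. P (s, x) * (- ((x \<bullet> e) * exp (- s) / 2))) has_derivative
     (\<lambda>v. P (s, x) * (- ((v \<bullet> e) * exp (- s) / 2)) + 
           P (s, x) * (- ((x \<bullet> v) * exp (- s) / 2)) * (- ((x \<bullet> e) * exp (- s) / 2)))) (at x)"
    by (rule has_derivative_mult[OF d]) (auto intro!: derivative_eq_intros)
  have "partial_deriv (0, e) (partial_deriv (0, e) P) (s, x) = 
      partial_deriv e (\<lambda>x. P (s, x) * (- ((x \<bullet> e) * exp (- s) / 2))) x"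
    unfolding partial_deriv_snd[OF smooth_partial_deriv[OF sm B]] 1 ..
  also have "\<dots> = P (s, x) * ((x \<bullet> e)\<^sup>2 * exp (- 2 * s) / 4 - exp (- s) / 2)"
  proof -
    have "exp (- 2 * s) = exp (- s) * exp (- s)" by (simp flip: exp_add)
    then show ?thesis
      unfolding partial_deriv_eq[OF d2] using assms by (simp add: power2_eq_square algebra_simps)
  qed
  finally show "partial_deriv (0, e) (partial_deriv (0, e) (potential_density \<sigma>)) (s, x) = 
          potential_density \<sigma> (s, x) * ((x \<bullet> e)\<^sup>2 * exp (- 2 * s) / 4 - exp (- s) / 2)"
    by (simp add: P_def)
  show "partial_deriv (0, e) (potential_density \<sigma>) (s, x) = potential_density \<sigma> (s, x) * (- ((x \<bullet> e) * exp (- s) / 2))"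
    using 1 by (simp add: P_def)
qed

text \<open>A truncation of the Bessel potential: the heat flow is integrated between the times \<open>exp \<sigma>\<close> and \<open>exp M\<close>.\<close>

definition potential :: "real \<Rightarrow> real \<Rightarrow> 'a::euclidean_space \<Rightarrow> real" where
  "potential \<sigma> M x = integral {\<sigma>..M} (\<lambda>s. potential_density \<sigma> (s, x))"

lemma smooth_potential: "smooth (potential \<sigma> M)"
  unfolding potential_def[abs_def] by (rule smooth_integral_parameter[OF smooth_potential_density])

lemma potential_uminus: "potential \<sigma> M (- x) = potential \<sigma> M x"
  by (simp add: potential_def potential_density_def heat_def)

lemma continuous_on_slice: "smooth F \<Longrightarrow> continuous_on S (\<lambda>s. F (s, x))"
  by (rule continuous_on_compose2[OF smooth_continuous_on[of F UNIV]])
     (auto intro!: continuous_intros)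

text \<open>By the heat equation, 1 - \<Delta> applied to the integrand is minus the derivative in s
  of exp(exp \<sigma> - exp s) times the heat kernel. The integral collapses to its boundary values:
  the heat kernel at the lower end and an exponentially small multiple at the upper end.\<close>

lemma potential_resolvent:
  fixes x :: "'a::euclidean_space"
  assumes "\<sigma> \<le> M"
  shows "potential \<sigma> M x - laplacian (potential \<sigma> M) x = heat \<sigma> x - exp (exp \<sigma> - exp M) * heat M x"
proof -
  define P where "P = (potential_density \<sigma> :: real \<times> 'a \<Rightarrow> real)"
  have sm: "smooth P" unfolding P_def by (rule smooth_potential_density)
  have B: "(0, e) \<in> Basis" if "e \<in> Basis" for e :: 'a using that by (simp add: Basis_prod_def)
  have sm2: "smooth (partial_deriv (0, e) (partial_deriv (0, e) P))" if "e \<in> Basis" for e :: 'a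
    using that by (intro smooth_partial_deriv sm B)
  have pd: "partial_deriv e (partial_deriv e (potential \<sigma> M)) x = 
     integral {\<sigma>..M} (\<lambda>s. partial_deriv (0, e) (partial_deriv (0, e) P) (s, x))" if e: "e \<in> Basis" for e
    using integral_parameter_derivative(2)[OF sm e] 
       integral_parameter_derivative(2)[OF smooth_partial_deriv[OF sm B[OF e]] e]
    by (simp add: potential_def[abs_def] P_def)
  have "potential \<sigma> M x - laplacian (potential \<sigma> M) x =
     integral {\<sigma>..M} (\<lambda>s. P (s, x) - (\<Sum>e\<in>Basis. partial_deriv (0, e) (partial_deriv (0, e) P) (s, x)))"
    unfolding laplacian_def
    by (subst integral_diff)
       (auto simp: potential_def P_def[symmetric] pd integral_sum
         intro!: integrable_continuous_interval continuous_on_slice smooth_sum sm sm2 integral_sum[symmetric])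
  also have "\<dots> = heat \<sigma> x - exp (exp \<sigma> - exp M) * heat M x"
  proof (rule integral_unique)
    define g where "g s = exp (exp \<sigma> - exp s) * heat s x" for s
    have "(g has_vector_derivative
        - (P (s, x) - (\<Sum>e\<in>Basis. partial_deriv (0, e) (partial_deriv (0, e) P) (s, x)))) (at s within {\<sigma>..M})" for s
    proof -
      have "(\<Sum>e\<in>Basis. partial_deriv (0, e) (partial_deriv (0, e) P) (s, x)) = 
         (\<Sum>e\<in>Basis. P (s, x) * ((x \<bullet> e)\<^sup>2 * exp (- 2 * s) / 4 - exp (- s) / 2))"
        unfolding P_def by (intro sum.cong potential_density_derivs) auto
      also have "\<dots> = P (s, x) * ((norm x)\<^sup>2 * exp (- 2 * s) / 4 - real DIM('a) * exp (- s) / 2)"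
        unfolding power2_norm_eq_inner euclidean_inner[of x x]
        by (simp add: power2_eq_square sum_subtractf sum_distrib_right sum_divide_distrib flip: sum_distrib_left)
      finally have s: "(\<Sum>e\<in>Basis. partial_deriv (0, e) (partial_deriv (0, e) P) (s, x)) = 
          P (s, x) * ((norm x)\<^sup>2 * exp (- 2 * s) / 4 - real DIM('a) * exp (- s) / 2)" .
      have g: "P (s, x) = g s * exp s" by (simp add: P_def potential_density_def g_def exp_add)
      have e: "exp s * exp (- 2 * s) = exp (- s)" "exp s * exp (- s) = 1" by (simp_all flip: exp_add)
      have "- (P (s, x) - (\<Sum>e\<in>Basis. partial_deriv (0, e) (partial_deriv (0, e) P) (s, x))) =
         g s * (- exp s + (norm x)\<^sup>2 * (exp s * exp (- 2 * s)) / 4 - real DIM('a) * (exp s * exp (- s)) / 2)"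
        unfolding s g by (simp add: algebra_simps)
      also have "\<dots> = g s * (- exp s + (norm x)\<^sup>2 * exp (- s) / 4 - real DIM('a) / 2)" unfolding e by simp
      finally have v: "- (P (s, x) - (\<Sum>e\<in>Basis. partial_deriv (0, e) (partial_deriv (0, e) P) (s, x))) =
         g s * (- exp s + (norm x)\<^sup>2 * exp (- s) / 4 - real DIM('a) / 2)" .
      have "(g has_real_derivative g s * (- exp s + (norm x)\<^sup>2 * exp (- s) / 4 - real DIM('a) / 2)) (at s within {\<sigma>..M})"
        unfolding g_def heat_def
        by (auto intro!: derivative_eq_intros simp: algebra_simps add_divide_distrib)
      then show ?thesis unfolding v by (simp add: has_real_derivative_iff_has_vector_derivative)
    qed
    then have "((\<lambda>s. - (P (s, x) - (\<Sum>e\<in>Basis. partial_deriv (0, e) (partial_deriv (0, e) P) (s, x))))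
        has_integral (g M - g \<sigma>)) {\<sigma>..M}"
      using assms by (intro fundamental_theorem_of_calculus) auto
    from has_integral_neg[OF this]
    show "((\<lambda>s. P (s, x) - (\<Sum>e\<in>Basis. partial_deriv (0, e) (partial_deriv (0, e) P) (s, x)))
        has_integral (heat \<sigma> x - exp (exp \<sigma> - exp M) * heat M x)) {\<sigma>..M}"
      by (simp add: g_def)
  qed
  finally show ?thesis .
qed

lemma gauss_integral_bound:
  fixes f :: "real \<Rightarrow> 'a::euclidean_space \<Rightarrow> real"
  assumes c: "c > 0" and ab: "a \<le> b"
    and cont: "\<And>x. continuous_on {a..b} (\<lambda>s. f s x)" and [measurable]: "(\<lambda>x. integral {a..b} (\<lambda>s. f s x)) \<in> borel_measurable borel"
    and bd: "\<And>s x. s \<in> {a..b} \<Longrightarrow> \<bar>f s x\<bar> \<le> C * exp (- (c * (norm x)\<^sup>2))"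
  shows "integrable lborel (\<lambda>x. integral {a..b} (\<lambda>s. f s x))"
proof (rule Bochner_Integration.integrable_bound)
  show "integrable lborel (\<lambda>x::'a. (b - a) * C * exp (- (c * (norm x)\<^sup>2)))"
    by (intro integrable_mult_right gauss_integrable c)
  have "norm (integral {a..b} (\<lambda>s. f s x)) \<le> C * exp (- (c * (norm x)\<^sup>2)) * (b - a)" for x
    using bd by (intro integral_bound ab cont) auto
  then show "AE x in lborel. norm (integral {a..b} (\<lambda>s. f s x)) \<le> norm ((b - a) * C * exp (- (c * (norm x)\<^sup>2)))"
    by (intro always_eventually allI) (smt (verit) mult.commute mult.left_commute mult.assoc real_norm_def)
qed simp

lemma potential_density_bound:
  obtains C where "C \<ge> 0" "\<And>s x. s \<in> {\<sigma>..M} \<Longrightarrow>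
    \<bar>potential_density \<sigma> (s, x::'a::euclidean_space)\<bar> \<le> C * exp (- (exp (- M) / 4 * (norm x)\<^sup>2))"
proof -
  \<comment> \<open>All factors depending on time alone, bounded on the compact interval. The
    remaining Gaussian is widest at the last time, which explains the exponent with exp(-M).\<close>
  define h where "h s = exp (exp \<sigma> - exp s + s) * exp (- (real DIM('a) * s / 2)) * gauss_const TYPE('a)" for s
  have "continuous_on {\<sigma>..M} h" unfolding h_def by (auto intro!: continuous_intros)
  then have "bounded (h ` {\<sigma>..M})" by (intro compact_imp_bounded compact_continuous_image) auto
  then obtain C where C: "\<And>s. s \<in> {\<sigma>..M} \<Longrightarrow> \<bar>h s\<bar> \<le> C" unfolding bounded_iff by (metis imageI real_norm_def)
  have "\<bar>potential_density \<sigma> (s, x::'a)\<bar> \<le> max 0 C * exp (- (exp (- M) / 4 * (norm x)\<^sup>2))"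
    if s: "s \<in> {\<sigma>..M}" for s x
  proof -
    have "potential_density \<sigma> (s, x) = h s * exp (- (exp (- s) / 4 * (norm x)\<^sup>2))"
    proof -
      have "exp (- (real DIM('a) * s / 2) - (norm x)\<^sup>2 * exp (- s) / 4) =
          exp (- (real DIM('a) * s / 2)) * exp (- (exp (- s) / 4 * (norm x)\<^sup>2))"
        by (simp add: mult.commute flip: exp_add)
      then show ?thesis by (simp add: potential_density_def heat_def h_def)
    qed
    then have "\<bar>potential_density \<sigma> (s, x::'a)\<bar> = \<bar>h s\<bar> * exp (- (exp (- s) / 4 * (norm x)\<^sup>2))"
      by (simp add: abs_mult)
    also have "\<dots> \<le> max 0 C * exp (- (exp (- M) / 4 * (norm x)\<^sup>2))"
      using C[OF s] s by (intro mult_mono) (auto intro!: mult_right_mono)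
    finally show ?thesis .
  qed
  then show ?thesis using that[of "max 0 C"] by auto
qed

lemma potential_integrable:
  assumes "\<sigma> \<le> M"
  shows "integrable lborel (potential \<sigma> M :: 'a::euclidean_space \<Rightarrow> real)"
    and "e \<in> Basis \<Longrightarrow> integrable lborel (partial_deriv e (potential \<sigma> M :: 'a \<Rightarrow> real))"
proof -
  define c where "c = exp (- M) / 4"
  have c: "c > 0" by (simp add: c_def)
  obtain C where C: "C \<ge> 0" "\<And>s x. s \<in> {\<sigma>..M} \<Longrightarrow>
    \<bar>potential_density \<sigma> (s, x::'a)\<bar> \<le> C * exp (- (c * (norm x)\<^sup>2))"
    using potential_density_bound[where 'a='a] unfolding c_def by metis
  show "integrable lborel (potential \<sigma> M :: 'a \<Rightarrow> real)"
    using smooth_borel[OF smooth_potential[of \<sigma> M]] C unfolding potential_def[abs_def]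
    by (intro gauss_integral_bound[OF c assms] continuous_on_slice smooth_potential_density) auto
  assume e: "e \<in> Basis"
  have B: "(0, e) \<in> Basis" using e by (simp add: Basis_prod_def)
  have eq: "partial_deriv e (potential \<sigma> M) = (\<lambda>x. integral {\<sigma>..M} (\<lambda>s. partial_deriv (0, e) (potential_density \<sigma>) (s, x)))"
    using integral_parameter_derivative(2)[OF smooth_potential_density e] by (simp add: potential_def[abs_def])
  \<comment> \<open>A derivative brings down one factor \<open>norm x\<close>, paid for with half of
    the Gaussian exponent: norm x is at most 1 + (norm x)^2, and this \<open>K\<close> bounds the
    latter by K (1 + c/2 (norm x)^2), hence by K times an exponential.\<close>
  define K where "K = max 1 (2 / c)"
  have K: "norm x * exp (- (c * (norm x)\<^sup>2)) \<le> K * exp (- (c / 2 * (norm x)\<^sup>2))" for x :: 'a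
  proof -
    have "norm x \<le> 1 + (norm x)\<^sup>2" using sum_squares_ge_zero[of "norm x - 1 / 2" 0] by (simp add: power2_eq_square algebra_simps)
    also have "\<dots> \<le> K * (1 + c / 2 * (norm x)\<^sup>2)"
    proof -
      have "1 \<le> K" "1 \<le> K * (c / 2)" using c by (auto simp: K_def max_def field_simps)
      from add_mono[OF this(1) mult_right_mono[OF this(2), of "(norm x)\<^sup>2"]]
      show ?thesis by (simp add: algebra_simps)
    qed
    also have "\<dots> \<le> K * exp (c / 2 * (norm x)\<^sup>2)"
      by (intro mult_left_mono exp_ge_add_one_self) (auto simp: K_def)
    finally have "norm x * exp (- (c * (norm x)\<^sup>2)) \<le> K * exp (c / 2 * (norm x)\<^sup>2) * exp (- (c * (norm x)\<^sup>2))"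
      by (intro mult_right_mono) auto
    also have "\<dots> = K * exp (- (c / 2 * (norm x)\<^sup>2))" by (simp add: mult.assoc flip: exp_add)
    finally show ?thesis .
  qed
  show "integrable lborel (partial_deriv e (potential \<sigma> M :: 'a \<Rightarrow> real))"
    unfolding eq
  proof (rule gauss_integral_bound[where c="c / 2" and C="C * (exp (- \<sigma>) / 2) * K"])
    show "(\<lambda>x. integral {\<sigma>..M} (\<lambda>s. partial_deriv (0, e) (potential_density \<sigma>) (s, x))) \<in> borel_measurable borel"
      unfolding eq[symmetric] by (intro smooth_borel smooth_partial_deriv smooth_potential e)
    show "continuous_on {\<sigma>..M} (\<lambda>s. partial_deriv (0, e) (potential_density \<sigma>) (s, x))" for x
      by (intro continuous_on_slice smooth_partial_deriv smooth_potential_density B)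
    fix s x assume s: "s \<in> {\<sigma>..M}"
    have "\<bar>partial_deriv (0, e) (potential_density \<sigma>) (s, x)\<bar> = \<bar>potential_density \<sigma> (s, x)\<bar> * (\<bar>x \<bullet> e\<bar> * (exp (- s) / 2))"
      unfolding potential_density_derivs(1)[OF e] by (simp add: abs_mult)
    also have "\<dots> \<le> (C * exp (- (c * (norm x)\<^sup>2))) * (norm x * (exp (- \<sigma>) / 2))"
      using C s Basis_le_norm[OF e, of x] by (intro mult_mono C(2)) auto
    also have "\<dots> = C * (exp (- \<sigma>) / 2) * (norm x * exp (- (c * (norm x)\<^sup>2)))" by simp
    also have "\<dots> \<le> C * (exp (- \<sigma>) / 2) * (K * exp (- (c / 2 * (norm x)\<^sup>2)))"
      using C by (intro mult_left_mono K) auto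
    finally show "\<bar>partial_deriv (0, e) (potential_density \<sigma>) (s, x)\<bar> \<le> C * (exp (- \<sigma>) / 2) * K * exp (- (c / 2 * (norm x)\<^sup>2))"
      by (simp add: mult.assoc)
  qed (use c assms in auto)
qed

lemma laplacian_mult:
  assumes "smooth f" "smooth g"
  shows "laplacian (\<lambda>x. f x * g x) x =
    f x * laplacian g x + 2 * (\<Sum>e\<in>Basis. partial_deriv e f x * partial_deriv e g x) + laplacian f x * g x"
proof -
  have "partial_deriv e (partial_deriv e (\<lambda>x. f x * g x)) x =
     f x * partial_deriv e (partial_deriv e g) x + 2 * (partial_deriv e f x * partial_deriv e g x) +
     partial_deriv e (partial_deriv e f) x * g x" if e: "e \<in> Basis" for e
  proof -
    note d = smooth_differentiable assms smooth_partial_deriv[OF _ e]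
    have 1: "partial_deriv e (\<lambda>x. f x * g x) = (\<lambda>x. f x * partial_deriv e g x + partial_deriv e f x * g x)"
      by (intro ext partial_deriv_mult d)
    show ?thesis unfolding 1
      by (simp add: partial_deriv_add partial_deriv_mult d smooth_mult)
  qed
  then show ?thesis
    by (simp add: laplacian_def sum.distrib sum_distrib_left sum_distrib_right)
qed

text \<open>The truncated potential already has heat kernel minus a small multiple of another one as
  its image under 1 - \<Delta>. Only compact support is missing, and a wide cut-off supplies it with
  an L1 error that tends to 0. Evenness passes from both factors to the product.\<close>

lemma exists_kernel:
  fixes \<epsilon> :: real
  assumes \<epsilon>: "\<epsilon> > 0"
  shows "\<exists>k\<in>test_functions. (\<forall>x. k (- x) = k x) \<and>
    (LINT x::'a::euclidean_space|lborel. \<bar>k x - laplacian k x - heat \<sigma> x\<bar>) \<le> \<epsilon>"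
proof -
  \<comment> \<open>The final time exp M: the first entry makes the time interval nonempty, the
    second brings the coefficient of the boundary term below half of \<epsilon>.\<close>
  define Y where "Y = max (exp \<sigma>) (exp \<sigma> - ln (\<epsilon> / 2))"
  define M where "M = ln Y"
  have Y: "Y > 0" by (simp add: Y_def less_max_iff_disj)
  have M: "\<sigma> \<le> M" "exp M = Y" using Y by (simp_all add: M_def Y_def ln_ge_iff)
  have "exp (exp \<sigma> - exp M) \<le> exp (ln (\<epsilon> / 2))" unfolding M(2) by (simp add: Y_def)
  then have cM: "exp (exp \<sigma> - exp M) \<le> \<epsilon> / 2" using \<epsilon> by simp
  define \<kappa> where "\<kappa> = (potential \<sigma> M :: 'a \<Rightarrow> real)"
  define A where "A x = \<kappa> x - laplacian \<kappa> x" for x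
  have A: "A x = heat \<sigma> x - exp (exp \<sigma> - exp M) * heat M x" for x
    unfolding A_def \<kappa>_def by (rule potential_resolvent[OF M(1)])
  have iA: "integrable lborel A"
    unfolding A by (intro Bochner_Integration.integrable_diff integrable_mult_right integrable_heat)
  have sm: "smooth \<kappa>" unfolding \<kappa>_def by (rule smooth_potential)
  define \<eta> where "\<eta> n = (cutoff_at (real (Suc n)) :: 'a \<Rightarrow> real)" for n
  have \<eta>: "\<eta> n \<in> test_functions" for n unfolding \<eta>_def by (rule cutoff_at_test) simp
  \<comment> \<open>The error of the cut-off in the product rule: the missing part of the main term,
    the mixed gradient term and the term with the Laplacian of the cut-off.\<close>
  define E where "E n x = (\<eta> n x - 1) * A x - 2 * (\<Sum>e\<in>Basis. partial_deriv e (\<eta> n) x * partial_deriv e \<kappa> x) -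
      laplacian (\<eta> n) x * \<kappa> x" for n x
  have k: "\<eta> n x * \<kappa> x - laplacian (\<lambda>x. \<eta> n x * \<kappa> x) x - heat \<sigma> x = E n x - exp (exp \<sigma> - exp M) * heat M x" for n x
    unfolding laplacian_mult[OF test_smooth[OF \<eta>] sm] E_def using A[of x]
    by (simp add: A_def algebra_simps)
  obtain B0 where B0: "B0 \<ge> 0" "\<And>x::'a. \<bar>cutoff x\<bar> \<le> B0" using test_bounded[OF cutoff_test] by metis
  have "\<exists>B\<ge>0. \<forall>x. \<bar>partial_deriv e (cutoff :: 'a \<Rightarrow> real) x\<bar> \<le> B" if "e \<in> Basis" for e
    using test_bounded[OF test_partial_deriv[OF cutoff_test that]] by metis
  then obtain B1 where B1: "\<And>e. e \<in> Basis \<Longrightarrow> B1 e \<ge> 0" "\<And>e x. e \<in> Basis \<Longrightarrow> \<bar>partial_deriv e (cutoff :: 'a \<Rightarrow> real) x\<bar> \<le> B1 e" by metis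
  obtain B2 where B2: "B2 \<ge> 0" "\<And>x::'a. \<bar>laplacian cutoff x\<bar> \<le> B2" using test_bounded[OF test_laplacian[OF cutoff_test]] by metis
  have c1: "partial_deriv e (\<eta> n) x = 1 / real (Suc n) * partial_deriv e cutoff ((1 / real (Suc n)) *\<^sub>R x)" 
    if "e \<in> Basis" for e n x
    unfolding \<eta>_def cutoff_at_derivs(1)[OF that] ..
  have c2: "laplacian (\<eta> n) x = 1 / real (Suc n) ^ 2 * laplacian cutoff ((1 / real (Suc n)) *\<^sub>R x)" for n x
    unfolding laplacian_def sum_distrib_left \<eta>_def by (intro sum.cong) (auto simp: cutoff_at_derivs(2))
  \<comment> \<open>An integrable majorant of all \<open>E n\<close>: the derivatives of the dilated
    cut-offs are bounded uniformly in n because the dilation factor is at most 1.\<close>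
  define w where "w x = (B0 + 1) * \<bar>A x\<bar> + 2 * (\<Sum>e\<in>Basis. B1 e * \<bar>partial_deriv e \<kappa> x\<bar>) + B2 * \<bar>\<kappa> x\<bar>" for x
  have iw: "integrable lborel w"
    unfolding w_def using iA potential_integrable[OF M(1)]
    by (intro Bochner_Integration.integrable_add integrable_mult_right Bochner_Integration.integrable_sum integrable_abs) 
       (auto simp: \<kappa>_def)
  have le1: "1 / real (Suc n) \<le> 1" "1 / real (Suc n) ^ 2 \<le> 1" for n by (simp_all add: divide_simps)
  have bd1: "\<bar>partial_deriv e (\<eta> n) x\<bar> \<le> 1 / real (Suc n) * B1 e" if "e \<in> Basis" for e n x
    unfolding c1[OF that] abs_mult using B1(2)[OF that] by (intro mult_mono) auto
  have bd1': "\<bar>partial_deriv e (\<eta> n) x\<bar> \<le> B1 e" if "e \<in> Basis" for e n x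
    using bd1[OF that, of n x] mult_right_mono[OF le1(1)[of n] B1(1)[OF that]] by linarith
  have bd2: "\<bar>laplacian (\<eta> n) x\<bar> \<le> 1 / real (Suc n) ^ 2 * B2" for n x
    unfolding c2 abs_mult using B2(2) by (intro mult_mono) auto
  have bd2': "\<bar>laplacian (\<eta> n) x\<bar> \<le> B2" for n x
    using bd2[of n x] mult_right_mono[OF le1(2)[of n] B2(1)] by linarith
  have bd0: "\<bar>\<eta> n x\<bar> \<le> B0" for n x unfolding \<eta>_def cutoff_at_def by (rule B0)
  have bE: "\<bar>E n x\<bar> \<le> w x" for n x
  proof -
    have "\<bar>\<eta> n x - 1\<bar> \<le> B0 + 1" using bd0[of n x] by linarith
    then have 1: "\<bar>(\<eta> n x - 1) * A x\<bar> \<le> (B0 + 1) * \<bar>A x\<bar>"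
      unfolding abs_mult by (intro mult_right_mono) auto
    have 2: "\<bar>\<Sum>e\<in>Basis. partial_deriv e (\<eta> n) x * partial_deriv e \<kappa> x\<bar> \<le> (\<Sum>e\<in>Basis. B1 e * \<bar>partial_deriv e \<kappa> x\<bar>)"
      by (rule sum_abs[THEN order_trans], intro sum_mono) (auto simp: abs_mult intro!: mult_right_mono bd1')
    have 3: "\<bar>laplacian (\<eta> n) x * \<kappa> x\<bar> \<le> B2 * \<bar>\<kappa> x\<bar>"
      unfolding abs_mult by (intro mult_right_mono bd2') auto
    show ?thesis using 1 2 3 unfolding E_def w_def by linarith
  qed
  have lim0: "(\<lambda>n. 1 / real (Suc n)) \<longlonglongrightarrow> 0" using lim_inverse_n'[THEN LIMSEQ_Suc] by simp
  have lim0': "(\<lambda>n. 1 / real (Suc n) ^ 2) \<longlonglongrightarrow> 0"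
    using tendsto_mult[OF lim0 lim0] by (simp add: power2_eq_square)
  have limE: "(\<lambda>n. E n x) \<longlonglongrightarrow> 0" for x
  proof -
    have "(\<lambda>n. (1 / real (Suc n)) *\<^sub>R x) \<longlonglongrightarrow> 0 *\<^sub>R x" by (intro tendsto_scaleR tendsto_const lim0)
    from isCont_tendsto_compose[OF smooth_continuous_at[OF test_smooth[OF cutoff_test]] this]
    have "(\<lambda>n. cutoff ((1 / real (Suc n)) *\<^sub>R x)) \<longlonglongrightarrow> cutoff (0::'a)" by simp
    then have 1: "(\<lambda>n. \<eta> n x) \<longlonglongrightarrow> 1" by (simp add: cutoff_0 \<eta>_def cutoff_at_def)
    have 2: "(\<lambda>n. partial_deriv e (\<eta> n) x) \<longlonglongrightarrow> 0" if "e \<in> Basis" for e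
      by (rule Lim_null_comparison[OF _ tendsto_mult_left_zero[OF lim0, of "B1 e"]])
         (use bd1[OF that] in \<open>auto intro!: always_eventually\<close>)
    have 3: "(\<lambda>n. laplacian (\<eta> n) x) \<longlonglongrightarrow> 0"
      by (rule Lim_null_comparison[OF _ tendsto_mult_left_zero[OF lim0', of "B2"]])
         (use bd2 in \<open>auto intro!: always_eventually\<close>)
    have "(\<lambda>n. E n x) \<longlonglongrightarrow> (1 - 1) * A x - 2 * (\<Sum>e\<in>Basis. 0 * partial_deriv e \<kappa> x) - 0 * \<kappa> x"
      unfolding E_def by (intro tendsto_intros 1 2 3)
    then show ?thesis by simp
  qed
  have [measurable]: "\<eta> n \<in> borel_measurable borel" "laplacian (\<eta> n) \<in> borel_measurable borel" for n
    using \<eta> by (auto intro: test_borel test_laplacian)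
  have [measurable]: "partial_deriv e (\<eta> n) \<in> borel_measurable borel" "partial_deriv e \<kappa> \<in> borel_measurable borel" 
    if "e \<in> Basis" for e n
    using that \<eta> sm by (auto intro: test_borel test_partial_deriv smooth_borel smooth_partial_deriv)
  have [measurable]: "\<kappa> \<in> borel_measurable borel" "A \<in> borel_measurable borel"
    using sm iA by (auto intro: smooth_borel)
  have mE [measurable]: "E n \<in> borel_measurable borel" for n unfolding E_def[abs_def] by measurable
  have "(\<lambda>n. LINT x|lborel. \<bar>E n x\<bar>) \<longlonglongrightarrow> (LINT x::'a|lborel. 0)"
    by (rule integral_dominated_convergence[where w=w])
       (use iw bE limE in \<open>auto intro!: tendsto_rabs_zero\<close>)
  then have "(\<lambda>n. LINT x|lborel. \<bar>E n x\<bar>) \<longlonglongrightarrow> 0" by simp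
  from order_tendstoD(2)[OF this, of "\<epsilon> / 2"] \<epsilon> obtain n where n: "(LINT x|lborel. \<bar>E n x\<bar>) < \<epsilon> / 2"
    by (auto simp: eventually_sequentially)
  have iE: "integrable lborel (\<lambda>x. \<bar>E n x\<bar>)"
    by (rule Bochner_Integration.integrable_bound[OF iw]) (auto intro!: AE_I2 order_trans[OF bE abs_ge_self])
  have "(LINT x|lborel. \<bar>\<eta> n x * \<kappa> x - laplacian (\<lambda>x. \<eta> n x * \<kappa> x) x - heat \<sigma> x\<bar>) \<le>
     (LINT x|lborel. \<bar>E n x\<bar> + exp (exp \<sigma> - exp M) * heat M x)"
    unfolding k
  proof (rule integral_mono)
    show "integrable lborel (\<lambda>x. \<bar>E n x - exp (exp \<sigma> - exp M) * heat M x\<bar>)"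
      using iE by (intro integrable_abs Bochner_Integration.integrable_diff integrable_mult_right integrable_heat)
        (simp add: integrable_abs_iff)
    show "integrable lborel (\<lambda>x. \<bar>E n x\<bar> + exp (exp \<sigma> - exp M) * heat M x)"
      by (intro Bochner_Integration.integrable_add integrable_mult_right integrable_heat iE)
    show "\<bar>E n x - exp (exp \<sigma> - exp M) * heat M x\<bar> \<le> \<bar>E n x\<bar> + exp (exp \<sigma> - exp M) * heat M x" for x
    proof -
      have "0 \<le> exp (exp \<sigma> - exp M) * heat M x" using heat_pos[of M x] by simp
      then show ?thesis by linarith
    qed
  qed
  also have "\<dots> = (LINT x|lborel. \<bar>E n x\<bar>) + exp (exp \<sigma> - exp M)"
    by (subst Bochner_Integration.integral_add) (auto intro!: iE integrable_mult_right integrable_heat simp: integral_heat)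
  also have "\<dots> \<le> \<epsilon>" using n cM by linarith
  finally have "(LINT x|lborel. \<bar>\<eta> n x * \<kappa> x - laplacian (\<lambda>x. \<eta> n x * \<kappa> x) x - heat \<sigma> x\<bar>) \<le> \<epsilon>" .
  moreover have "\<eta> n (- x) * \<kappa> (- x) = \<eta> n x * \<kappa> x" for x
    by (simp add: \<kappa>_def potential_uminus \<eta>_def cutoff_at_def cutoff_uminus)
  moreover have "(\<lambda>x. \<eta> n x * \<kappa> x) \<in> test_functions"
    using test_mult[OF sm \<eta>, of n] by (simp add: mult.commute)
  ultimately show ?thesis by (intro bexI[of _ "\<lambda>x. \<eta> n x * \<kappa> x"]) auto
qed

section \<open>Square integrable functions\<close>

definition square_integrable :: "'m measure \<Rightarrow> ('m \<Rightarrow> real) \<Rightarrow> bool" where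
  "square_integrable M f \<longleftrightarrow> f \<in> borel_measurable M \<and> integrable M (\<lambda>x. (f x)\<^sup>2)"

definition l2norm :: "'m measure \<Rightarrow> ('m \<Rightarrow> real) \<Rightarrow> real" where
  "l2norm M f = sqrt (LINT x|M. (f x)\<^sup>2)"

lemma square_integrableD:
  assumes "square_integrable M f"
  shows "f \<in> borel_measurable M" "integrable M (\<lambda>x. (f x)\<^sup>2)"
  using assms by (auto simp: square_integrable_def)

lemma l2norm_nonneg: "0 \<le> l2norm M f"
  by (simp add: l2norm_def)

lemma l2norm_sq: "(l2norm M f)\<^sup>2 = (LINT x|M. (f x)\<^sup>2)"
  by (simp add: l2norm_def)

lemma square_integrable_bound:
  assumes f: "square_integrable M f" and g: "g \<in> borel_measurable M" and le: "AE x in M. \<bar>g x\<bar> \<le> C * \<bar>f x\<bar>"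
  shows "square_integrable M g"
proof -
  have "integrable M (\<lambda>x. (g x)\<^sup>2)"
  proof (rule Bochner_Integration.integrable_bound)
  show "integrable M (\<lambda>x. C\<^sup>2 * (f x)\<^sup>2)" using f by (auto dest: square_integrableD)
  show "AE x in M. norm ((g x)\<^sup>2) \<le> norm (C\<^sup>2 * (f x)\<^sup>2)"
    using le
  proof eventually_elim
    case (elim x)
    then have "\<bar>g x\<bar>\<^sup>2 \<le> (C * \<bar>f x\<bar>)\<^sup>2" by (intro power_mono) auto
    then show ?case by (simp add: power_mult_distrib)
  qed
  qed (use g in measurable)
  then show ?thesis using g by (simp add: square_integrable_def)
qed

lemma square_integrable_mult_integrable:
  assumes "square_integrable M f" "square_integrable M g"
  shows "integrable M (\<lambda>x. f x * g x)"
proof (rule Bochner_Integration.integrable_bound)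
  show "integrable M (\<lambda>x. (f x)\<^sup>2 + (g x)\<^sup>2)" using assms by (auto dest: square_integrableD)
  have "\<bar>a * b\<bar> \<le> a\<^sup>2 + b\<^sup>2" for a b :: real
    using sum_squares_bound[of "\<bar>a\<bar>" "\<bar>b\<bar>"] mult_nonneg_nonneg[of "\<bar>a\<bar>" "\<bar>b\<bar>"]
    unfolding abs_mult power2_abs by linarith
  then show "AE x in M. norm (f x * g x) \<le> norm ((f x)\<^sup>2 + (g x)\<^sup>2)"
    by (intro AE_I2) simp
  show "(\<lambda>x. f x * g x) \<in> borel_measurable M"
    using assms by (auto dest!: square_integrableD(1))
qed

lemma square_integrable_add:
  assumes "square_integrable M f" "square_integrable M g"
  shows "square_integrable M (\<lambda>x. f x + g x)"
proof -
  have "integrable M (\<lambda>x. (f x)\<^sup>2 + (g x)\<^sup>2 + 2 * (f x * g x))"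
    using assms square_integrable_mult_integrable[OF assms]
    by (intro Bochner_Integration.integrable_add integrable_mult_right) (simp_all add: square_integrable_def)
  then show ?thesis
    using assms unfolding square_integrable_def power2_sum by (auto simp: mult.assoc)
qed

lemma square_integrable_cmult: "square_integrable M f \<Longrightarrow> square_integrable M (\<lambda>x. c * f x)"
  unfolding square_integrable_def by (auto simp: power_mult_distrib)

lemma square_integrable_diff:
  "square_integrable M f \<Longrightarrow> square_integrable M g \<Longrightarrow> square_integrable M (\<lambda>x. f x - g x)"
  using square_integrable_add[OF _ square_integrable_cmult[of M g "-1"], of f] by simp

lemma square_integrable_sum:
  "(\<And>i. i \<in> I \<Longrightarrow> square_integrable M (f i)) \<Longrightarrow> square_integrable M (\<lambda>x. \<Sum>i\<in>I. f i x)"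
  by (induction I rule: infinite_finite_induct) (auto intro: square_integrable_add simp: square_integrable_def[of M "\<lambda>_. 0"])

lemma l2_Cauchy_Schwarz:
  assumes f: "square_integrable M f" and g: "square_integrable M g"
  shows "\<bar>LINT x|M. f x * g x\<bar> \<le> l2norm M f * l2norm M g"
proof -
  define a b c where "a = (LINT x|M. (f x)\<^sup>2)" and "b = (LINT x|M. f x * g x)" and "c = (LINT x|M. (g x)\<^sup>2)"
  note i = square_integrableD(2)[OF f] square_integrableD(2)[OF g] square_integrable_mult_integrable[OF f g]
  have q: "0 \<le> a * t\<^sup>2 + 2 * b * t + c" for t
  proof -
    have "0 \<le> (LINT x|M. (t * f x + g x)\<^sup>2)" by simp
    also have "\<dots> = (LINT x|M. t\<^sup>2 * (f x)\<^sup>2 + (2 * t) * (f x * g x) + (g x)\<^sup>2)"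
      by (simp add: power2_sum power_mult_distrib algebra_simps)
    also have "\<dots> = t\<^sup>2 * a + (2 * t) * b + c"
      using i by (simp add: a_def b_def c_def)
    finally show ?thesis by (simp add: algebra_simps)
  qed
  have ac: "a \<ge> 0" "c \<ge> 0" by (simp_all add: a_def c_def)
  have "b\<^sup>2 \<le> a * c"
  proof (cases "a = 0")
    case True
    have "b = 0"
    proof (rule ccontr)
      assume "b \<noteq> 0"
      \<comment> \<open>With a = 0 the quadratic form is affine in t; at this point it takes the
        value -1.\<close>
      then show False using q[of "- (c + 1) / (2 * b)"] True by simp
    qed
    then show ?thesis using True by simp
  next
    case False
    then have "a > 0" using ac by simp
    \<comment> \<open>The minimum of the parabola, multiplied by a to clear the denominator.\<close>
    have "0 \<le> a * (a * (- b / a)\<^sup>2 + 2 * b * (- b / a) + c)" using q[of "- b / a"] ac by (intro mult_nonneg_nonneg)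
    also have "\<dots> = a * c - b\<^sup>2" using False by (simp add: field_simps power2_eq_square)
    finally show ?thesis by simp
  qed
  then have "\<bar>b\<bar> \<le> sqrt (a * c)" by (simp add: real_le_rsqrt abs_le_square_iff real_sqrt_abs[symmetric] del: real_sqrt_abs)
  then show ?thesis by (simp add: a_def b_def c_def l2norm_def real_sqrt_mult)
qed

lemma l2norm_add:
  assumes f: "square_integrable M f" and g: "square_integrable M g"
  shows "l2norm M (\<lambda>x. f x + g x) \<le> l2norm M f + l2norm M g"
proof (rule power2_le_imp_le)
  note i = square_integrableD(2)[OF f] square_integrableD(2)[OF g] square_integrable_mult_integrable[OF f g]
  have "(l2norm M (\<lambda>x. f x + g x))\<^sup>2 = (LINT x|M. (f x)\<^sup>2 + (g x)\<^sup>2 + 2 * (f x * g x))"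
    unfolding l2norm_sq by (simp add: power2_sum mult.assoc)
  also have "\<dots> = (l2norm M f)\<^sup>2 + (l2norm M g)\<^sup>2 + 2 * (LINT x|M. f x * g x)"
    unfolding l2norm_sq using i by simp
  also have "\<dots> \<le> (l2norm M f + l2norm M g)\<^sup>2"
    using l2_Cauchy_Schwarz[OF f g] by (simp add: power2_sum)
  finally show "(l2norm M (\<lambda>x. f x + g x))\<^sup>2 \<le> (l2norm M f + l2norm M g)\<^sup>2" .
qed (simp add: l2norm_nonneg)

lemma l2norm_cmult: "l2norm M (\<lambda>x. c * f x) = \<bar>c\<bar> * l2norm M f"
  by (simp add: l2norm_def power_mult_distrib real_sqrt_mult)

lemma l2norm_cong_AE: 
  assumes "f \<in> borel_measurable M" "g \<in> borel_measurable M" "AE x in M. f x = g x"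
  shows "l2norm M f = l2norm M g"
proof -
  have "(LINT x|M. (f x)\<^sup>2) = (LINT x|M. (g x)\<^sup>2)"
    using assms by (intro integral_cong_AE) auto
  then show ?thesis by (simp add: l2norm_def)
qed

lemma l2_inner_tendsto:
  assumes f: "\<And>n. square_integrable M (f n)" "square_integrable M f'" "(\<lambda>n. l2norm M (\<lambda>x. f n x - f' x)) \<longlonglongrightarrow> 0"
    and g: "\<And>n. square_integrable M (g n)" "square_integrable M g'" "(\<lambda>n. l2norm M (\<lambda>x. g n x - g' x)) \<longlonglongrightarrow> 0"
  shows "(\<lambda>n. LINT x|M. f n x * g n x) \<longlonglongrightarrow> (LINT x|M. f' x * g' x)"
proof (rule LIM_zero_cancel, rule Lim_null_comparison[OF always_eventually], rule allI)
  fix n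
  note d = square_integrable_diff[OF f(1)[of n] f(2)] square_integrable_diff[OF g(1)[of n] g(2)]
  have "(LINT x|M. f n x * g n x) - (LINT x|M. f' x * g' x) =
    (LINT x|M. (f n x - f' x) * (g n x - g' x)) + (LINT x|M. (f n x - f' x) * g' x) + (LINT x|M. f' x * (g n x - g' x))"
    using square_integrable_mult_integrable[OF d] square_integrable_mult_integrable[OF d(1) g(2)] 
      square_integrable_mult_integrable[OF f(2) d(2)] square_integrable_mult_integrable[OF f(1)[of n] g(1)[of n]]
      square_integrable_mult_integrable[OF f(2) g(2)]
    by (simp flip: Bochner_Integration.integral_add Bochner_Integration.integral_diff) (simp add: algebra_simps)
  then show "norm ((LINT x|M. f n x * g n x) - (LINT x|M. f' x * g' x)) \<le> 
     l2norm M (\<lambda>x. f n x - f' x) * l2norm M (\<lambda>x. g n x - g' x) + l2norm M (\<lambda>x. f n x - f' x) * l2norm M g' +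
     l2norm M f' * l2norm M (\<lambda>x. g n x - g' x)"
    using l2_Cauchy_Schwarz[OF d] l2_Cauchy_Schwarz[OF d(1) g(2)] l2_Cauchy_Schwarz[OF f(2) d(2)] by simp
next
  have "(\<lambda>n. l2norm M (\<lambda>x. f n x - f' x) * l2norm M (\<lambda>x. g n x - g' x) + l2norm M (\<lambda>x. f n x - f' x) * l2norm M g' +
     l2norm M f' * l2norm M (\<lambda>x. g n x - g' x)) \<longlonglongrightarrow> 0 * 0 + 0 * l2norm M g' + l2norm M f' * 0"
    by (intro tendsto_intros f g)
  then show "(\<lambda>n. l2norm M (\<lambda>x. f n x - f' x) * l2norm M (\<lambda>x. g n x - g' x) + l2norm M (\<lambda>x. f n x - f' x) * l2norm M g' +
     l2norm M f' * l2norm M (\<lambda>x. g n x - g' x)) \<longlonglongrightarrow> 0" by simp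
qed

section \<open>Averages of square integrable functions\<close>

lemma borel_measurable_lborel_pair:
  "f \<in> borel_measurable borel \<Longrightarrow> f \<in> borel_measurable (lborel \<Otimes>\<^sub>M lborel :: ('a::euclidean_space \<times> 'b::euclidean_space) measure)"
  by (simp add: lborel_prod)

lemma borel_measurable_compose_continuous:
  fixes f :: "'b::topological_space \<Rightarrow> real" and g :: "'a::topological_space \<Rightarrow> 'b"
  shows "f \<in> borel_measurable borel \<Longrightarrow> continuous_on UNIV g \<Longrightarrow> (\<lambda>x. f (g x)) \<in> borel_measurable borel"
  by (rule measurable_compose[OF borel_measurable_continuous_onI])

lemma borel_integral_param:
  fixes f :: "'a::euclidean_space \<times> 'b::euclidean_space \<Rightarrow> real"
  assumes "f \<in> borel_measurable borel"
  shows "(\<lambda>x. LINT y|lborel. f (x, y)) \<in> borel_measurable borel"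
    and "(\<lambda>y. LINT x|lborel. f (x, y)) \<in> borel_measurable borel"
proof -
  have 1: "case_prod (\<lambda>x y. f (x, y)) \<in> borel_measurable (borel \<Otimes>\<^sub>M lborel)"
  proof -
    have "sets (borel \<Otimes>\<^sub>M lborel) = sets (borel :: ('a \<times> 'b) measure)"
      by (simp add: borel_prod[symmetric] cong: sets_pair_measure_cong)
    then show ?thesis using assms by (simp cong: measurable_cong_sets)
  qed
  show "(\<lambda>x. LINT y|lborel. f (x, y)) \<in> borel_measurable borel"
    by (rule lborel.borel_measurable_lebesgue_integral[OF 1])
  have 2: "case_prod (\<lambda>y x. f (x, y)) \<in> borel_measurable (borel \<Otimes>\<^sub>M lborel)"
  proof -
    have "sets (borel \<Otimes>\<^sub>M lborel) = sets (borel :: ('b \<times> 'a) measure)"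
      by (simp add: borel_prod[symmetric] cong: sets_pair_measure_cong)
    moreover have "(\<lambda>z::'b \<times> 'a. f (snd z, fst z)) \<in> borel_measurable borel"
      by (intro borel_measurable_compose_continuous[OF assms] continuous_intros)
    ultimately show ?thesis by (simp add: case_prod_unfold cong: measurable_cong_sets)
  qed
  show "(\<lambda>y. LINT x|lborel. f (x, y)) \<in> borel_measurable borel"
    by (rule lborel.borel_measurable_lebesgue_integral[OF 2])
qed

text \<open>Cauchy-Schwarz in y after splitting k into sqrt |k| and its signed counterpart, followed
  by Fubini. The integrand is left general because it is used both for the translates of a function
  and for the differences between a function and its translates.\<close>

lemma kernel_average:
  fixes k :: "'a::euclidean_space \<Rightarrow> real" and \<Phi> :: "'a \<times> 'b::euclidean_space \<Rightarrow> real"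
  assumes k: "integrable lborel k" and \<Phi> [measurable]: "\<Phi> \<in> borel_measurable borel"
    and I: "integrable (lborel \<Otimes>\<^sub>M lborel) (\<lambda>(y, p). \<bar>k y\<bar> * (\<Phi> (y, p))\<^sup>2)"
  shows "AE p in lborel. integrable lborel (\<lambda>y. k y * \<Phi> (y, p))"
    and "square_integrable lborel (\<lambda>p. LINT y|lborel. k y * \<Phi> (y, p))"
    and "(LINT p|lborel. (LINT y|lborel. k y * \<Phi> (y, p))\<^sup>2) \<le>
         (LINT y|lborel. \<bar>k y\<bar>) * (LINT y|lborel. \<bar>k y\<bar> * (LINT p|lborel. (\<Phi> (y, p))\<^sup>2))"
proof -
  have mk [measurable]: "k \<in> borel_measurable borel" using k by auto
  have mP: "(\<lambda>y. \<Phi> (y, p)) \<in> borel_measurable borel" for p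
    by (intro borel_measurable_compose_continuous[OF \<Phi>] continuous_intros)
  define S where "S p = (LINT y|lborel. \<bar>k y\<bar> * (\<Phi> (y, p))\<^sup>2)" for p
  have iS: "integrable lborel S" unfolding S_def by (rule lborel_pair.integrable_snd[OF I])
  have mG: "(\<lambda>p. LINT y|lborel. k y * \<Phi> (y, p)) \<in> borel_measurable borel"
  proof -
    have "(\<lambda>z. k (fst z) * \<Phi> z) \<in> borel_measurable borel"
      by (intro borel_measurable_times \<Phi> borel_measurable_compose_continuous[OF mk] continuous_intros)
    from borel_integral_param(2)[OF this] show ?thesis by simp
  qed
  have *: "integrable lborel (\<lambda>y. k y * \<Phi> (y, p)) \<and> (LINT y|lborel. k y * \<Phi> (y, p))\<^sup>2 \<le> (LINT y|lborel. \<bar>k y\<bar>) * S p"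
    if p: "integrable lborel (\<lambda>y. \<bar>k y\<bar> * (\<Phi> (y, p))\<^sup>2)" for p
  proof -
    define f g where "f y = sqrt \<bar>k y\<bar>" and "g y = sgn (k y) * sqrt \<bar>k y\<bar> * \<Phi> (y, p)" for y
    have f2: "(f y)\<^sup>2 = \<bar>k y\<bar>" for y by (simp add: f_def)
    have g2: "(g y)\<^sup>2 = \<bar>k y\<bar> * (\<Phi> (y, p))\<^sup>2" for y
      by (cases "k y = 0") (simp_all add: g_def power_mult_distrib sgn_if)
    have fg: "f y * g y = k y * \<Phi> (y, p)" for y
    proof -
      have "f y * g y = (sqrt \<bar>k y\<bar> * sqrt \<bar>k y\<bar>) * sgn (k y) * \<Phi> (y, p)"
        by (simp only: f_def g_def ac_simps)
      also have "\<dots> = k y * \<Phi> (y, p)" by (simp add: abs_mult_sgn)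
      finally show ?thesis .
    qed
    have f: "square_integrable lborel f" unfolding square_integrable_def f2 using k by (simp add: f_def[abs_def])
    have g: "square_integrable lborel g" unfolding square_integrable_def g2 using p mP[of p]
      by (simp add: g_def[abs_def])
    have "\<bar>LINT y|lborel. f y * g y\<bar>\<^sup>2 \<le> (l2norm lborel f * l2norm lborel g)\<^sup>2"
      by (intro power_mono l2_Cauchy_Schwarz f g) auto
    then show ?thesis using square_integrable_mult_integrable[OF f g]
      unfolding fg power_mult_distrib l2norm_sq f2 g2 by (simp add: S_def)
  qed
  have AE: "AE p in lborel. integrable lborel (\<lambda>y. \<bar>k y\<bar> * (\<Phi> (y, p))\<^sup>2)"
    by (rule lborel_pair.AE_integrable_snd[OF I])
  show "AE p in lborel. integrable lborel (\<lambda>y. k y * \<Phi> (y, p))"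
    using AE by eventually_elim (use * in blast)
  have le: "AE p in lborel. (LINT y|lborel. k y * \<Phi> (y, p))\<^sup>2 \<le> (LINT y|lborel. \<bar>k y\<bar>) * S p"
    using AE by eventually_elim (use * in blast)
  have i2: "integrable lborel (\<lambda>p. (LINT y|lborel. k y * \<Phi> (y, p))\<^sup>2)"
  proof (rule Bochner_Integration.integrable_bound)
    show "integrable lborel (\<lambda>p. (LINT y|lborel. \<bar>k y\<bar>) * S p)" using iS by simp
    show "AE p in lborel. norm ((LINT y|lborel. k y * \<Phi> (y, p))\<^sup>2) \<le> norm ((LINT y|lborel. \<bar>k y\<bar>) * S p)"
      using le by eventually_elim auto
  qed (use mG in measurable)
  then show "square_integrable lborel (\<lambda>p. LINT y|lborel. k y * \<Phi> (y, p))"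
    using mG by (simp add: square_integrable_def)
  have "(LINT p|lborel. (LINT y|lborel. k y * \<Phi> (y, p))\<^sup>2) \<le> (LINT p|lborel. (LINT y|lborel. \<bar>k y\<bar>) * S p)"
    using iS by (intro integral_mono_AE i2 le) simp
  also have "(LINT p|lborel. S p) = (LINT y|lborel. LINT p|lborel. \<bar>k y\<bar> * (\<Phi> (y, p))\<^sup>2)"
    unfolding S_def by (rule lborel_pair.Fubini_integral[OF I])
  ultimately show "(LINT p|lborel. (LINT y|lborel. k y * \<Phi> (y, p))\<^sup>2) \<le>
         (LINT y|lborel. \<bar>k y\<bar>) * (LINT y|lborel. \<bar>k y\<bar> * (LINT p|lborel. (\<Phi> (y, p))\<^sup>2))"
    by simp
qed

section \<open>Continuity of translations\<close>

lemma integrable_translate: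
  fixes f :: "'a::euclidean_space \<Rightarrow> real"
  shows "integrable lborel f \<Longrightarrow> integrable lborel (\<lambda>x. f (x - h))"
  using integrable_lborel_affine_iff[of f 1 "-h"] by simp

lemma integral_translate:
  fixes f :: "'a::euclidean_space \<Rightarrow> real"
  shows "f \<in> borel_measurable borel \<Longrightarrow> (LINT x|lborel. f (x - h)) = (LINT x|lborel. f x)"
  using integral_lborel_translate[of f "-h"] by simp

lemma borel_measurable_translate:
  fixes f :: "'a::euclidean_space \<Rightarrow> real"
  shows "f \<in> borel_measurable borel \<Longrightarrow> (\<lambda>x. f (x - h)) \<in> borel_measurable borel"
  by (erule borel_measurable_compose_continuous) (intro continuous_intros)

definition L1_translation_continuous :: "('a::euclidean_space \<Rightarrow> real) \<Rightarrow> bool" where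
  "L1_translation_continuous f \<longleftrightarrow>
     (\<forall>h. h \<longlonglongrightarrow> 0 \<longrightarrow> (\<lambda>n. LINT x|lborel. \<bar>f (x - h n) - f x\<bar>) \<longlonglongrightarrow> 0)"

text \<open>Continuity of translations survives L1 limits: the difference of the translates of f and
  g has the same integral as that of f and g, so only the middle one of three terms depends on the
  shift.\<close>

lemma L1_translation_approx:
  fixes f :: "'a::euclidean_space \<Rightarrow> real"
  assumes f: "integrable lborel f"
    and g: "\<And>\<epsilon>. \<epsilon> > 0 \<Longrightarrow> \<exists>g. integrable lborel g \<and> L1_translation_continuous g \<and> (LINT x|lborel. \<bar>g x - f x\<bar>) \<le> \<epsilon>"
  shows "L1_translation_continuous f"
  unfolding L1_translation_continuous_def
proof (intro allI impI LIMSEQ_I)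
  fix h :: "nat \<Rightarrow> 'a" and r :: real
  assume h: "h \<longlonglongrightarrow> 0" and r: "0 < r"
  from g[of "r / 4"] r obtain g where g: "integrable lborel g" "L1_translation_continuous g" 
    "(LINT x|lborel. \<bar>g x - f x\<bar>) \<le> r / 4" by auto
  from g(2) h have "(\<lambda>n. LINT x|lborel. \<bar>g (x - h n) - g x\<bar>) \<longlonglongrightarrow> 0"
    by (auto simp: L1_translation_continuous_def)
  from order_tendstoD(2)[OF this, of "r / 2"] r obtain N where 
    N: "\<And>n. n \<ge> N \<Longrightarrow> (LINT x|lborel. \<bar>g (x - h n) - g x\<bar>) < r / 2"
    by (auto simp: eventually_sequentially)
  have "norm ((LINT x|lborel. \<bar>f (x - h n) - f x\<bar>) - 0) < r" if "n \<ge> N" for n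
  proof -
    have i: "integrable lborel (\<lambda>x. \<bar>g x - f x\<bar>)" using f g(1) by auto
    note i' = integrable_translate[OF i, of "h n"]
    have i2: "integrable lborel (\<lambda>x. \<bar>g (x - h n) - g x\<bar>)"
      using integrable_translate[OF g(1)] g(1) by auto
    have "(LINT x|lborel. \<bar>f (x - h n) - f x\<bar>) \<le>
      (LINT x|lborel. \<bar>g (x - h n) - f (x - h n)\<bar> + \<bar>g (x - h n) - g x\<bar> + \<bar>g x - f x\<bar>)"
      using integrable_translate[OF f, of "h n"] f
      by (intro integral_mono Bochner_Integration.integrable_add i i' i2 integrable_abs Bochner_Integration.integrable_diff) auto
    also have "\<dots> = (LINT x|lborel. \<bar>g (x - h n) - f (x - h n)\<bar>) + (LINT x|lborel. \<bar>g (x - h n) - g x\<bar>) + (LINT x|lborel. \<bar>g x - f x\<bar>)"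
      using i i' i2 by simp
    also have "(LINT x|lborel. \<bar>g (x - h n) - f (x - h n)\<bar>) = (LINT x|lborel. \<bar>g x - f x\<bar>)"
      using i by (intro integral_translate) auto
    finally have "(LINT x|lborel. \<bar>f (x - h n) - f x\<bar>) < r" using N[OF that] g(3) by linarith
    moreover have "0 \<le> (LINT x|lborel. \<bar>f (x - h n) - f x\<bar>)" by simp
    ultimately show ?thesis by simp
  qed
  then show "\<exists>no. \<forall>n\<ge>no. norm ((LINT x|lborel. \<bar>f (x - h n) - f x\<bar>) - 0) < r" by blast
qed

text \<open>A point of an open set stays in it under small shifts, so the positive part of I(x) -
  I(x - h) tends to 0 with majorant I. Both indicators have the same integral; hence the negative
  part has the same integral as the positive part, and the L1 distance is twice the quantity
  controlled.\<close>

lemma L1_translation_open: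
  fixes U :: "'a::euclidean_space set"
  assumes U: "open U" "emeasure lborel U < \<infinity>"
  shows "L1_translation_continuous (indicator U)"
  unfolding L1_translation_continuous_def
proof (intro allI impI)
  fix h :: "nat \<Rightarrow> 'a"
  assume h: "h \<longlonglongrightarrow> 0"
  define I where "I = (indicator U :: 'a \<Rightarrow> real)"
  have [measurable]: "U \<in> sets borel" using U by auto
  have iI: "integrable lborel I" using U by (auto simp: I_def)
  note iIh = integrable_translate[OF iI]
  define P where "P n x = max 0 (I x - I (x - h n))" for n x
  have iP: "integrable lborel (P n)" for n
    unfolding P_def using iI iIh by (intro integrable_max) auto
  have "(\<lambda>n. LINT x|lborel. P n x) \<longlonglongrightarrow> (LINT x::'a|lborel. 0)"
  proof (rule integral_dominated_convergence[where w=I])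
    show "P n \<in> borel_measurable lborel" for n using iP by auto
    show "AE x in lborel. (\<lambda>n. P n x) \<longlonglongrightarrow> 0"
    proof (intro AE_I2)
      fix x :: 'a
      show "(\<lambda>n. P n x) \<longlonglongrightarrow> 0"
      proof (cases "x \<in> U")
        case True
        have "(\<lambda>n. x - h n) \<longlonglongrightarrow> x - 0" by (intro tendsto_intros h)
        then have "eventually (\<lambda>n. x - h n \<in> U) sequentially"
          using True U(1) by (auto dest: topological_tendstoD)
        then show ?thesis
          by (intro tendsto_eventually) (auto elim!: eventually_mono simp: P_def I_def)
      next
        case False
        then show ?thesis by (simp add: P_def I_def)
      qed
    qed
    show "AE x in lborel. norm (P n x) \<le> I x" for n
      by (intro AE_I2) (auto simp: P_def I_def indicator_def)
  qed (use iI in auto)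
  then have "(\<lambda>n. 2 * (LINT x|lborel. P n x)) \<longlonglongrightarrow> 0" by (auto intro: tendsto_mult_right_zero)
  moreover have "(LINT x|lborel. \<bar>I (x - h n) - I x\<bar>) = 2 * (LINT x|lborel. P n x)" for n
  proof -
    have "(LINT x|lborel. \<bar>I (x - h n) - I x\<bar>) = (LINT x|lborel. 2 * P n x + (I (x - h n) - I x))"
      by (intro Bochner_Integration.integral_cong) (auto simp: P_def max_def)
    also have "\<dots> = 2 * (LINT x|lborel. P n x) + ((LINT x|lborel. I (x - h n)) - (LINT x|lborel. I x))"
      using iP iI iIh by simp
    also have "(LINT x|lborel. I (x - h n)) = (LINT x|lborel. I x)"
      using iI by (intro integral_translate) auto
    finally show ?thesis by simp
  qed
  ultimately show "(\<lambda>n. LINT x|lborel. \<bar>indicator U (x - h n) - indicator U x :: real\<bar>) \<longlonglongrightarrow> 0"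
    by (simp add: I_def)
qed

lemma L1_translation_cmult: "L1_translation_continuous f \<Longrightarrow> L1_translation_continuous (\<lambda>x. f x * c)"
proof -
  have "\<bar>f a * c - f b * c\<bar> = \<bar>f a - f b\<bar> * \<bar>c\<bar>" for a b
    by (simp add: abs_mult[symmetric] algebra_simps)
  then show "L1_translation_continuous f \<Longrightarrow> L1_translation_continuous (\<lambda>x. f x * c)"
    by (auto simp: L1_translation_continuous_def intro!: tendsto_mult_left_zero)
qed

text \<open>Outer regularity approximates a set of finite measure by open sets from outside; linear
  combinations and L1 limits of simple functions do the rest.\<close>

lemma L1_translation:
  fixes f :: "'a::euclidean_space \<Rightarrow> real"
  assumes "integrable lborel f"
  shows "L1_translation_continuous f"
  using assms
proof (induction rule: integrable_induct)
  case (base A c)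
  have [measurable]: "A \<in> sets borel" using base by simp
  have "L1_translation_continuous (indicator A)"
  proof (rule L1_translation_approx)
    show "integrable lborel (indicator A :: 'a \<Rightarrow> real)" using base by simp
    fix \<epsilon> :: real assume \<epsilon>: "\<epsilon> > 0"
    obtain U where U: "open U" "A \<subseteq> U" "emeasure lborel (U - A) < \<epsilon>"
      using outer_regular_lborel[of A \<epsilon>] \<epsilon> by auto
    have [measurable]: "U \<in> sets borel" using U by auto
    have fin: "emeasure lborel (U - A) < \<infinity>" by (rule order_less_trans[OF U(3)]) simp
    have "emeasure lborel U = emeasure lborel A + emeasure lborel (U - A)"
      using U(2) by (subst plus_emeasure) (auto intro: arg_cong)
    then have fU: "emeasure lborel U < \<infinity>" using fin base by (simp add: less_top[symmetric])
    have "(LINT x|lborel. \<bar>indicator U x - indicator A x :: real\<bar>) = (LINT x|lborel. indicator (U - A) x)"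
      using U(2) by (intro Bochner_Integration.integral_cong) (auto simp: indicator_def)
    also have "\<dots> = measure lborel (U - A)" by simp
    also have "\<dots> \<le> \<epsilon>" using U(3) fin \<epsilon> by (simp add: measure_def enn2real_leI order_less_imp_le)
    finally show "\<exists>g. integrable lborel g \<and> L1_translation_continuous g \<and> (LINT x|lborel. \<bar>g x - indicator A x\<bar>) \<le> \<epsilon>"
      using fU U by (intro exI[of _ "indicator U"]) (auto intro: L1_translation_open)
  qed
  from L1_translation_cmult[OF this, of c] show ?case by simp
next
  case (add f g)
  show ?case
    unfolding L1_translation_continuous_def
  proof (intro allI impI)
    fix h :: "nat \<Rightarrow> 'a" assume h: "h \<longlonglongrightarrow> 0"
    have lim: "(\<lambda>n. (LINT x|lborel. \<bar>f (x - h n) - f x\<bar>) + (LINT x|lborel. \<bar>g (x - h n) - g x\<bar>)) \<longlonglongrightarrow> 0 + 0"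
      using add h by (intro tendsto_add) (auto simp: L1_translation_continuous_def)
    have le: "(LINT x|lborel. \<bar>f (x - h n) + g (x - h n) - (f x + g x)\<bar>) \<le> 
      (LINT x|lborel. \<bar>f (x - h n) - f x\<bar>) + (LINT x|lborel. \<bar>g (x - h n) - g x\<bar>)" for n
    proof -
      note i = integrable_translate[OF add.hyps(1), of "h n"] integrable_translate[OF add.hyps(2), of "h n"] add.hyps
      have "(LINT x|lborel. \<bar>f (x - h n) + g (x - h n) - (f x + g x)\<bar>) \<le> 
        (LINT x|lborel. \<bar>f (x - h n) - f x\<bar> + \<bar>g (x - h n) - g x\<bar>)"
        using i by (intro integral_mono integrable_abs Bochner_Integration.integrable_diff Bochner_Integration.integrable_add) auto
      also have "\<dots> = (LINT x|lborel. \<bar>f (x - h n) - f x\<bar>) + (LINT x|lborel. \<bar>g (x - h n) - g x\<bar>)"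
        using i by (intro Bochner_Integration.integral_add) auto
      finally show ?thesis .
    qed
    show "(\<lambda>n. LINT x|lborel. \<bar>f (x - h n) + g (x - h n) - (f x + g x)\<bar>) \<longlonglongrightarrow> 0"
      by (rule Lim_null_comparison[OF _ lim[simplified]], rule always_eventually, rule allI) (simp add: le)
  qed
next
  case (lim f s)
  show ?case
  proof (rule L1_translation_approx[OF lim.hyps(4)])
    fix \<epsilon> :: real assume \<epsilon>: "\<epsilon> > 0"
    have "(\<lambda>i. LINT x|lborel. \<bar>s i x - f x\<bar>) \<longlonglongrightarrow> (LINT x::'a|lborel. 0)"
    proof (rule integral_dominated_convergence[where w="\<lambda>x. 3 * \<bar>f x\<bar>"])
      show "AE x in lborel. (\<lambda>i. \<bar>s i x - f x\<bar>) \<longlonglongrightarrow> 0"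
        using lim.hyps(2) by (intro AE_I2 tendsto_rabs_zero LIM_zero) simp
      show "AE x in lborel. norm \<bar>s i x - f x\<bar> \<le> 3 * \<bar>f x\<bar>" for i
      proof (intro AE_I2)
        fix x :: 'a
        have "\<bar>s i x\<bar> \<le> 2 * \<bar>f x\<bar>" using lim.hyps(3)[of x i] by simp
        then show "norm \<bar>s i x - f x\<bar> \<le> 3 * \<bar>f x\<bar>" by simp
      qed
    qed (use lim.hyps(1,4) in auto)
    then have "(\<lambda>i. LINT x|lborel. \<bar>s i x - f x\<bar>) \<longlonglongrightarrow> 0" by simp
    from order_tendstoD(2)[OF this \<epsilon>] obtain i where "(LINT x|lborel. \<bar>s i x - f x\<bar>) < \<epsilon>"
      by (auto simp: eventually_sequentially)
    then show "\<exists>g. integrable lborel g \<and> L1_translation_continuous g \<and> (LINT x|lborel. \<bar>g x - f x\<bar>) \<le> \<epsilon>"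
      using lim.hyps(1)[of i] lim.IH[of i] by (intro exI[of _ "s i"]) auto
  qed
qed

lemma square_integrable_translate:
  fixes u :: "'a::euclidean_space \<Rightarrow> real"
  assumes "square_integrable lborel u"
  shows "square_integrable lborel (\<lambda>x. u (x - h))"
    and "l2norm lborel (\<lambda>x. u (x - h)) = l2norm lborel u"
  using assms integrable_translate[of "\<lambda>x. (u x)\<^sup>2" h] integral_translate[of "\<lambda>x. (u x)\<^sup>2" h]
    borel_measurable_translate[of u h]
  by (auto simp: square_integrable_def l2norm_def)

text \<open>Large values are removed to make v bounded, small ones to make it integrable: where |u|
  is at least 1/n, |u| is at most n u^2. This v transfers L1 continuity of translations to
  L2.\<close>

lemma l2_truncation_approx:
  fixes u :: "'a::euclidean_space \<Rightarrow> real"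
  assumes u: "square_integrable lborel u" and \<epsilon>: "\<epsilon> > 0"
  obtains v B where "integrable lborel v" "square_integrable lborel v" "\<And>x. \<bar>v x\<bar> \<le> B" "B \<ge> 0"
    "l2norm lborel (\<lambda>x. v x - u x) < \<epsilon>"
proof -
  have [measurable]: "u \<in> borel_measurable borel" using square_integrableD(1)[OF u] by simp
  define v where "v n x = (if 1 / real (Suc n) \<le> \<bar>u x\<bar> \<and> \<bar>u x\<bar> \<le> real (Suc n) then u x else 0)" for n x
  have mv [measurable]: "v n \<in> borel_measurable borel" for n unfolding v_def[abs_def] by measurable
  have bd: "\<bar>v n x\<bar> \<le> \<bar>u x\<bar>" for n x by (simp add: v_def)
  have sv: "square_integrable lborel (v n)" for n
    by (rule square_integrable_bound[OF u, of _ 1]) (use bd in auto)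
  have iv: "integrable lborel (v n)" for n
  proof (rule Bochner_Integration.integrable_bound)
    show "integrable lborel (\<lambda>x. real (Suc n) * (u x)\<^sup>2)" using square_integrableD(2)[OF u] by simp
    have "\<bar>v n x\<bar> \<le> real (Suc n) * (u x)\<^sup>2" for x
    proof (cases "1 / real (Suc n) \<le> \<bar>u x\<bar>")
      case True
      then have "1 \<le> real (Suc n) * \<bar>u x\<bar>" by (simp add: field_simps)
      from mult_right_mono[OF this, of "\<bar>u x\<bar>"] have "\<bar>u x\<bar> \<le> real (Suc n) * (u x)\<^sup>2"
        by (simp add: power2_eq_square mult.assoc)
      then show ?thesis using bd[of n x] by linarith
    qed (simp add: v_def)
    then show "AE x in lborel. norm (v n x) \<le> norm (real (Suc n) * (u x)\<^sup>2)" by (intro AE_I2) simp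
  qed simp
  have "(\<lambda>n. LINT x|lborel. (v n x - u x)\<^sup>2) \<longlonglongrightarrow> (LINT x::'a|lborel. 0)"
  proof (rule integral_dominated_convergence[where w="\<lambda>x. (u x)\<^sup>2"])
    show "AE x in lborel. (\<lambda>n. (v n x - u x)\<^sup>2) \<longlonglongrightarrow> 0"
    proof (intro AE_I2 tendsto_eventually)
      fix x :: 'a
      show "\<forall>\<^sub>F n in sequentially. (v n x - u x)\<^sup>2 = 0"
      proof (cases "u x = 0")
        case False
        obtain N1 where N1: "\<bar>u x\<bar> \<le> real N1" using real_arch_simple by blast
        obtain N2 where N2: "1 / \<bar>u x\<bar> \<le> real N2" using real_arch_simple by blast
        have "v n x = u x" if "n \<ge> max N1 N2" for n
        proof -
          have "\<bar>u x\<bar> \<le> real (Suc n)" using N1 that by simp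
          moreover have "1 / \<bar>u x\<bar> \<le> real (Suc n)" using N2 that by simp
          then have "1 / real (Suc n) \<le> \<bar>u x\<bar>" using False by (simp add: field_simps)
          ultimately show ?thesis by (simp add: v_def)
        qed
        then show ?thesis unfolding eventually_sequentially by (intro exI[of _ "max N1 N2"]) simp
      qed (simp add: v_def)
    qed
    show "AE x in lborel. norm ((v n x - u x)\<^sup>2) \<le> (u x)\<^sup>2" for n
      by (intro AE_I2) (simp add: v_def)
  qed (use u in \<open>auto dest: square_integrableD\<close>)
  then have "(\<lambda>n. sqrt (LINT x|lborel. (v n x - u x)\<^sup>2)) \<longlonglongrightarrow> sqrt 0" by (intro tendsto_real_sqrt) simp
  then have "(\<lambda>n. l2norm lborel (\<lambda>x. v n x - u x)) \<longlonglongrightarrow> 0" by (simp add: l2norm_def)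
  from order_tendstoD(2)[OF this \<epsilon>] obtain n where "l2norm lborel (\<lambda>x. v n x - u x) < \<epsilon>"
    by (auto simp: eventually_sequentially)
  moreover have "\<bar>v n x\<bar> \<le> real (Suc n)" for x by (simp add: v_def)
  ultimately show ?thesis using that[of "v n" "real (Suc n)"] iv sv by auto
qed

text \<open>For a bounded integrable v the square of a difference of translates is at most 2 B times
  its absolute value, so the L1 statement applies. A general u costs two errors, which are equal by
  translation invariance.\<close>

lemma l2_translation:
  fixes u :: "'a::euclidean_space \<Rightarrow> real"
  assumes u: "square_integrable lborel u" and h: "h \<longlonglongrightarrow> 0"
  shows "(\<lambda>n. LINT x|lborel. (u (x - h n) - u x)\<^sup>2) \<longlonglongrightarrow> 0"
proof -
  have "(\<lambda>n. l2norm lborel (\<lambda>x. u (x - h n) - u x)) \<longlonglongrightarrow> 0"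
  proof (rule LIMSEQ_I)
    fix r :: real assume r: "0 < r"
    obtain v B where v: "integrable lborel v" "square_integrable lborel v" "\<And>x. \<bar>v x\<bar> \<le> B" "B \<ge> 0"
      "l2norm lborel (\<lambda>x. v x - u x) < r / 3"
      using l2_truncation_approx[OF u, of "r / 3"] r by auto
    have "(\<lambda>n. sqrt (2 * B * (LINT x|lborel. \<bar>v (x - h n) - v x\<bar>))) \<longlonglongrightarrow> sqrt (2 * B * 0)"
      using L1_translation[OF v(1)] h
      by (intro tendsto_real_sqrt tendsto_mult tendsto_const) (auto simp: L1_translation_continuous_def)
    from order_tendstoD(2)[OF this, of "r / 3"] r obtain N where 
      N: "\<And>n. n \<ge> N \<Longrightarrow> sqrt (2 * B * (LINT x|lborel. \<bar>v (x - h n) - v x\<bar>)) < r / 3"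
      by (auto simp: eventually_sequentially)
    have "norm (l2norm lborel (\<lambda>x. u (x - h n) - u x) - 0) < r" if "n \<ge> N" for n
    proof -
      note vh = square_integrable_translate(1)[OF v(2), of "h n"]
      note d = square_integrable_diff[OF vh v(2)]
      note e = square_integrable_diff[OF v(2) u]
      note eh = square_integrable_translate(1)[OF e, of "h n"]
      have "(LINT x|lborel. (v (x - h n) - v x)\<^sup>2) \<le> (LINT x|lborel. 2 * B * \<bar>v (x - h n) - v x\<bar>)"
      proof (rule integral_mono)
        show "integrable lborel (\<lambda>x. (v (x - h n) - v x)\<^sup>2)" by (rule square_integrableD(2)[OF d])
        show "integrable lborel (\<lambda>x. 2 * B * \<bar>v (x - h n) - v x\<bar>)"
          using v(1) integrable_translate[OF v(1)] by auto
        fix x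
        have "\<bar>v (x - h n) - v x\<bar> \<le> 2 * B" using v(3)[of x] v(3)[of "x - h n"] by linarith
        from mult_right_mono[OF this, of "\<bar>v (x - h n) - v x\<bar>"]
        show "(v (x - h n) - v x)\<^sup>2 \<le> 2 * B * \<bar>v (x - h n) - v x\<bar>"
          by (simp add: power2_eq_square)
      qed
      then have "l2norm lborel (\<lambda>x. v (x - h n) - v x) \<le> sqrt (2 * B * (LINT x|lborel. \<bar>v (x - h n) - v x\<bar>))"
        by (simp add: l2norm_def)
      then have 1: "l2norm lborel (\<lambda>x. v (x - h n) - v x) < r / 3" using N[OF that] by linarith
      have 2: "l2norm lborel (\<lambda>x. v (x - h n) - u (x - h n)) < r / 3"
        using square_integrable_translate(2)[OF e, of "h n"] v(5) by simp
      have "l2norm lborel (\<lambda>x. u (x - h n) - u x) = 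
        l2norm lborel (\<lambda>x. (-1) * (v (x - h n) - u (x - h n)) + ((v (x - h n) - v x) + (v x - u x)))"
        by (simp add: algebra_simps)
      also have "\<dots> \<le> l2norm lborel (\<lambda>x. (-1) * (v (x - h n) - u (x - h n))) + 
          l2norm lborel (\<lambda>x. (v (x - h n) - v x) + (v x - u x))"
        by (intro l2norm_add square_integrable_add square_integrable_cmult eh d e)
      also have "\<dots> \<le> l2norm lborel (\<lambda>x. (-1) * (v (x - h n) - u (x - h n))) + 
          (l2norm lborel (\<lambda>x. v (x - h n) - v x) + l2norm lborel (\<lambda>x. v x - u x))"
        by (intro add_left_mono l2norm_add d e)
      also have "\<dots> < r"
        unfolding l2norm_cmult using 1 2 v(5) by simp
      finally show ?thesis by (simp add: l2norm_nonneg)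
    qed
    then show "\<exists>no. \<forall>n\<ge>no. norm (l2norm lborel (\<lambda>x. u (x - h n) - u x) - 0) < r" by blast
  qed
  from tendsto_power[OF this, of 2] show ?thesis by (simp add: l2norm_sq)
qed

lemma integrable_times_bounded:
  fixes k :: "'a::euclidean_space \<Rightarrow> real"
  assumes k: "integrable lborel k" and F: "F \<in> borel_measurable borel" and bd: "\<And>y. \<bar>F y\<bar> \<le> B"
  shows "integrable lborel (\<lambda>y. k y * F y)"
proof (rule Bochner_Integration.integrable_bound)
  show "integrable lborel (\<lambda>y. B * k y)" using k by simp
  have "\<bar>k y * F y\<bar> \<le> \<bar>B * k y\<bar>" for y
    using mult_left_mono[OF bd[of y], of "\<bar>k y\<bar>"] bd[of y] by (simp add: abs_mult mult.commute)
  then show "AE y in lborel. norm (k y * F y) \<le> norm (B * k y)" by simp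
qed (use k F in auto)

lemma average_pair_integrable:
  fixes k :: "'a::euclidean_space \<Rightarrow> real" and \<Phi> :: "'a \<times> 'b::euclidean_space \<Rightarrow> real"
  assumes k: "integrable lborel k" and \<Phi>: "\<Phi> \<in> borel_measurable borel"
    and sq: "\<And>y. square_integrable lborel (\<lambda>p. \<Phi> (y, p))" and bd: "\<And>y. (LINT p|lborel. (\<Phi> (y, p))\<^sup>2) \<le> B"
  shows "integrable (lborel \<Otimes>\<^sub>M lborel) (\<lambda>(y, p). \<bar>k y\<bar> * (\<Phi> (y, p))\<^sup>2)"
proof -
  have mk: "k \<in> borel_measurable borel" using k by auto
  have m1: "(\<lambda>z::'a \<times> 'b. k (fst z)) \<in> borel_measurable borel"
    by (intro borel_measurable_compose_continuous[OF mk] continuous_intros)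
  have m: "(\<lambda>z. \<bar>k (fst z)\<bar> * (\<Phi> z)\<^sup>2) \<in> borel_measurable borel"
    using m1 \<Phi> by measurable
  have mO: "(\<lambda>y. LINT p|lborel. (\<Phi> (y, p))\<^sup>2) \<in> borel_measurable borel"
    by (rule borel_integral_param(1)) (use \<Phi> in measurable)
  have "integrable lborel (\<lambda>y. \<bar>k y\<bar> * (LINT p|lborel. (\<Phi> (y, p))\<^sup>2))"
    by (rule integrable_times_bounded[OF _ mO, of _ B]) (use k bd in auto)
  then have "integrable (lborel \<Otimes>\<^sub>M lborel) (\<lambda>z. \<bar>k (fst z)\<bar> * (\<Phi> z)\<^sup>2)"
    using sq by (intro lborel_pair.Fubini_integrable borel_measurable_lborel_pair m AE_I2)
       (auto simp: abs_mult dest: square_integrableD)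
  then show ?thesis by (simp add: case_prod_unfold)
qed

text \<open>Cauchy-Schwarz on each slice with the uniform bound \<open>B\<close> gives the absolute
  integrability that Fubini needs.\<close>

lemma average_inner:
  fixes k :: "'a::euclidean_space \<Rightarrow> real" and \<Phi> :: "'a \<times> 'b::euclidean_space \<Rightarrow> real"
  assumes k: "integrable lborel k" and \<Phi>: "\<Phi> \<in> borel_measurable borel"
    and sq: "\<And>y. square_integrable lborel (\<lambda>p. \<Phi> (y, p))" and bd: "\<And>y. (LINT p|lborel. (\<Phi> (y, p))\<^sup>2) \<le> B"
    and w: "square_integrable lborel w"
  shows "(LINT p|lborel. (LINT y|lborel. k y * \<Phi> (y, p)) * w p) = (LINT y|lborel. k y * (LINT p|lborel. \<Phi> (y, p) * w p))"
proof -
  have mk: "k \<in> borel_measurable borel" and mw: "w \<in> borel_measurable borel" using k square_integrableD[OF w] by auto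
  have m1: "(\<lambda>z::'a \<times> 'b. k (fst z)) \<in> borel_measurable borel" "(\<lambda>z::'a \<times> 'b. w (snd z)) \<in> borel_measurable borel"
    by (intro borel_measurable_compose_continuous[OF mk] borel_measurable_compose_continuous[OF mw] continuous_intros)+
  have m: "(\<lambda>z. k (fst z) * (\<Phi> z * w (snd z))) \<in> borel_measurable borel"
    using m1 \<Phi> by measurable
  have le: "(LINT p|lborel. \<bar>\<Phi> (y, p) * w p\<bar>) \<le> sqrt B * l2norm lborel w" for y
  proof -
    have a: "square_integrable lborel (\<lambda>p. \<bar>\<Phi> (y, p)\<bar>)" "square_integrable lborel (\<lambda>p. \<bar>w p\<bar>)"
      using sq[of y] w by (auto simp: square_integrable_def)
    have "(LINT p|lborel. \<bar>\<Phi> (y, p)\<bar> * \<bar>w p\<bar>) \<le> l2norm lborel (\<lambda>p. \<bar>\<Phi> (y, p)\<bar>) * l2norm lborel (\<lambda>p. \<bar>w p\<bar>)"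
      using l2_Cauchy_Schwarz[OF a] by simp
    also have "\<dots> = l2norm lborel (\<lambda>p. \<Phi> (y, p)) * l2norm lborel w" by (simp add: l2norm_def)
    also have "\<dots> \<le> sqrt B * l2norm lborel w"
      using bd[of y] by (intro mult_right_mono l2norm_nonneg) (simp add: l2norm_def)
    finally show ?thesis by (simp add: abs_mult)
  qed
  have mO: "(\<lambda>y. LINT p|lborel. \<bar>\<Phi> (y, p) * w p\<bar>) \<in> borel_measurable borel"
    using borel_integral_param(1)[of "\<lambda>z. \<bar>\<Phi> z * w (snd z)\<bar>"] m1 \<Phi> by simp
  have "integrable lborel (\<lambda>y. \<bar>k y\<bar> * (LINT p|lborel. \<bar>\<Phi> (y, p) * w p\<bar>))"
    by (rule integrable_times_bounded[OF _ mO, of _ "sqrt B * l2norm lborel w"]) (use k le in auto)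
  then have "integrable (lborel \<Otimes>\<^sub>M lborel) (\<lambda>z. k (fst z) * (\<Phi> z * w (snd z)))"
    using square_integrable_mult_integrable[OF sq w]
    by (intro lborel_pair.Fubini_integrable borel_measurable_lborel_pair m AE_I2) (auto simp: abs_mult)
  then have "integrable (lborel \<Otimes>\<^sub>M lborel) (case_prod (\<lambda>y p. k y * (\<Phi> (y, p) * w p)))"
    by (simp add: case_prod_unfold)
  from lborel_pair.Fubini_integral[OF this]
  have "(LINT p|lborel. LINT y|lborel. k y * (\<Phi> (y, p) * w p)) = (LINT y|lborel. k y * (LINT p|lborel. \<Phi> (y, p) * w p))"
    by simp
  moreover have "(LINT y|lborel. k y * (\<Phi> (y, p) * w p)) = (LINT y|lborel. k y * \<Phi> (y, p)) * w p" for p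
    by (simp flip: mult.assoc)
  ultimately show ?thesis by simp
qed

section \<open>Convolution in the space variable\<close>

text \<open>Space-time points are kept as pairs and shifted by (0, y), so a function on space-time
  is convolved with all its time slices at once and the translation results for the whole product
  space apply.\<close>

definition xconv :: "('a::euclidean_space \<Rightarrow> real) \<Rightarrow> (real \<times> 'a \<Rightarrow> real) \<Rightarrow> real \<times> 'a \<Rightarrow> real" where
  "xconv k u p = (LINT y|lborel. k y * u (p - (0, y)))"

lemma shift_borel:
  fixes u :: "real \<times> 'a::euclidean_space \<Rightarrow> real"
  shows "u \<in> borel_measurable borel \<Longrightarrow> (\<lambda>z::'a \<times> (real \<times> 'a). u (snd z - (0, fst z))) \<in> borel_measurable borel"
  by (erule borel_measurable_compose_continuous) (intro continuous_intros)

context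
  fixes k :: "'a::euclidean_space \<Rightarrow> real" and u :: "real \<times> 'a \<Rightarrow> real"
  assumes k: "integrable lborel k" and u: "square_integrable lborel u"
begin

lemma shift_average:
  "(\<lambda>z::'a \<times> (real \<times> 'a). u (snd z - (0, fst z))) \<in> borel_measurable borel"
  "square_integrable lborel (\<lambda>p. u (p - (0, y)))"
  "(LINT p|lborel. (u (p - (0, y)))\<^sup>2) \<le> (l2norm lborel u)\<^sup>2"
proof -
  show "(\<lambda>z::'a \<times> (real \<times> 'a). u (snd z - (0, fst z))) \<in> borel_measurable borel"
    using square_integrableD(1)[OF u] by (intro shift_borel) simp
  show "square_integrable lborel (\<lambda>p. u (p - (0, y)))" by (rule square_integrable_translate(1)[OF u])
  show "(LINT p|lborel. (u (p - (0, y)))\<^sup>2) \<le> (l2norm lborel u)\<^sup>2"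
    using square_integrable_translate(2)[OF u, of "(0, y)"] by (simp add: l2norm_def)
qed

lemma shift_pair_integrable:
  "integrable (lborel \<Otimes>\<^sub>M lborel) (\<lambda>(y, p). \<bar>k y\<bar> * (u (p - (0, y)))\<^sup>2)"
  using average_pair_integrable[OF k shift_average(1) _ _, of "(l2norm lborel u)\<^sup>2"] shift_average(2,3) by simp

lemma xconv_AE_integrable: "AE p in lborel. integrable lborel (\<lambda>y. k y * u (p - (0, y)))"
  using kernel_average(1)[OF k shift_average(1)] shift_pair_integrable by simp

lemma square_integrable_xconv: "square_integrable lborel (xconv k u)"
  using kernel_average(2)[OF k shift_average(1)] shift_pair_integrable by (simp add: xconv_def[abs_def])

lemma l2norm_xconv: "l2norm lborel (xconv k u) \<le> (LINT y|lborel. \<bar>k y\<bar>) * l2norm lborel u"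
proof (rule power2_le_imp_le)
  have "(l2norm lborel (xconv k u))\<^sup>2 \<le> (LINT y|lborel. \<bar>k y\<bar>) * (LINT y|lborel. \<bar>k y\<bar> * (LINT p|lborel. (u (p - (0, y)))\<^sup>2))"
    using kernel_average(3)[OF k shift_average(1)] shift_pair_integrable by (simp add: xconv_def l2norm_sq)
  also have "\<dots> = (LINT y|lborel. \<bar>k y\<bar>) * (LINT y|lborel. \<bar>k y\<bar> * (l2norm lborel u)\<^sup>2)"
    using square_integrable_translate(2)[OF u] by (simp flip: l2norm_sq)
  also have "\<dots> = ((LINT y|lborel. \<bar>k y\<bar>) * l2norm lborel u)\<^sup>2" by (simp add: power2_eq_square)
  finally show "(l2norm lborel (xconv k u))\<^sup>2 \<le> ((LINT y|lborel. \<bar>k y\<bar>) * l2norm lborel u)\<^sup>2" .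
qed (simp add: l2norm_nonneg)

lemma xconv_inner:
  assumes "square_integrable lborel w"
  shows "(LINT p|lborel. xconv k u p * w p) = (LINT y|lborel. k y * (LINT p|lborel. u (p - (0, y)) * w p))"
  using average_inner[OF k shift_average(1) _ _ assms, of "(l2norm lborel u)\<^sup>2"] shift_average(2,3)
  by (simp add: xconv_def)

end

text \<open>Pairings of two convolutions see the kernels only through this function. Symmetry and
  partial integration are thus checked on smooth kernels, with no regularity asked of the functions
  being convolved.\<close>

definition correlation :: "('a::euclidean_space \<Rightarrow> real) \<Rightarrow> ('a \<Rightarrow> real) \<Rightarrow> 'a \<Rightarrow> real" where
  "correlation k l m = (LINT y|lborel. k y * l (y - m))"

lemma borel_measurable_reflect:
  fixes f :: "'a::euclidean_space \<Rightarrow> real"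
  shows "f \<in> borel_measurable borel \<Longrightarrow> (\<lambda>x. f (m - x)) \<in> borel_measurable borel"
  by (erule borel_measurable_compose_continuous) (intro continuous_intros)

lemma xconv_inner_xconv:
  assumes k: "integrable lborel k" and l: "integrable lborel l"
    and u: "square_integrable lborel u" and v: "square_integrable lborel v"
  shows "(LINT p|lborel. xconv k u p * xconv l v p) =
    (LINT m|lborel. correlation k l m * (LINT p|lborel. u p * v (p + (0, m))))"
proof -
  define C where "C m = (LINT p|lborel. u p * v (p + (0, m)))" for m
  have mu [measurable]: "u \<in> borel_measurable borel" and mv [measurable]: "v \<in> borel_measurable borel"
    and mk [measurable]: "k \<in> borel_measurable borel" and ml [measurable]: "l \<in> borel_measurable borel"
    using square_integrableD(1)[OF u] square_integrableD(1)[OF v] k l by auto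
  have mC [measurable]: "C \<in> borel_measurable borel"
  proof -
    have "(\<lambda>z::_ \<times> (real \<times> _). u (snd z) * v (snd z + (0, fst z))) \<in> borel_measurable borel"
      by (intro borel_measurable_times borel_measurable_compose_continuous[OF mu]
          borel_measurable_compose_continuous[OF mv] continuous_intros)
    from borel_integral_param(1)[OF this] show ?thesis by (simp add: C_def[abs_def])
  qed
  have sh: "p - (0, - m) = p + (0, m)" "p - (0, y) + (0, y - y') = p - (0, y')" for p :: "real \<times> 'a" and m y y'
    by (auto intro: prod_eqI)
  have bC: "\<bar>C m\<bar> \<le> l2norm lborel u * l2norm lborel v" for m
    using l2_Cauchy_Schwarz[OF u square_integrable_translate(1)[OF v, of "(0, - m)"]]
      square_integrable_translate(2)[OF v, of "(0, - m)"] by (simp add: C_def sh)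
  \<comment> \<open>Only the relative shift of u and v matters by translation invariance; m = y - y'
    is that relative shift.\<close>
  have inner: "(LINT p|lborel. u (p - (0, y)) * xconv l v p) = (LINT m|lborel. l (y - m) * C m)" for y
  proof -
    have "(LINT p|lborel. u (p - (0, y)) * xconv l v p) = (LINT p|lborel. xconv l v p * u (p - (0, y)))"
      by (simp add: mult.commute)
    also have "\<dots> = (LINT y'|lborel. l y' * (LINT p|lborel. v (p - (0, y')) * u (p - (0, y))))"
      by (intro xconv_inner l v square_integrable_translate u)
    also have "\<dots> = (LINT y'|lborel. l y' * C (y - y'))"
    proof -
      have "(LINT p|lborel. v (p - (0, y')) * u (p - (0, y))) = C (y - y')" for y'
      proof -
        have "(\<lambda>p. u p * v (p + (0, y - y'))) \<in> borel_measurable borel"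
          using borel_measurable_translate[OF mv, of "(0, - (y - y'))"] unfolding sh by simp
        from integral_translate[OF this, of "(0, y)"] show ?thesis
          by (simp add: C_def sh mult.commute)
      qed
      then show ?thesis by simp
    qed
    also have "\<dots> = (LINT m|lborel. l (y - m) * C m)"
    proof -
      have "(\<lambda>y'. l y' * C (y - y')) \<in> borel_measurable borel"
        using borel_measurable_reflect[OF mC, of y] by simp
      from integral_lborel_reflect[OF this, of y] show ?thesis by simp
    qed
    finally show ?thesis .
  qed
  have il: "integrable lborel (\<lambda>m. l (y - m))" for y
    using integrable_lborel_affine_iff[of l "-1" y] l by simp
  have inl: "(LINT m|lborel. \<bar>l (y - m)\<bar>) = (LINT m|lborel. \<bar>l m\<bar>)" for y
    by (rule integral_lborel_reflect[of "\<lambda>m. \<bar>l m\<bar>"]) simp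
  have ilC: "integrable lborel (\<lambda>m. l (y - m) * C m)" for y
    by (rule integrable_times_bounded[OF il mC bC])
  have m: "(\<lambda>z. k (fst z) * (l (fst z - snd z) * C (snd z))) \<in> borel_measurable borel"
    by (intro borel_measurable_times borel_measurable_compose_continuous[OF mk]
          borel_measurable_compose_continuous[OF ml] borel_measurable_compose_continuous[OF mC] continuous_intros)
  have le: "(LINT m|lborel. \<bar>l (y - m) * C m\<bar>) \<le> (LINT m|lborel. \<bar>l m\<bar>) * (l2norm lborel u * l2norm lborel v)" for y
  proof -
    have "(LINT m|lborel. \<bar>l (y - m) * C m\<bar>) \<le> (LINT m|lborel. \<bar>l (y - m)\<bar> * (l2norm lborel u * l2norm lborel v))"
    proof (rule integral_mono)
      show "integrable lborel (\<lambda>m. \<bar>l (y - m) * C m\<bar>)" by (rule integrable_abs[OF ilC])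
      show "integrable lborel (\<lambda>m. \<bar>l (y - m)\<bar> * (l2norm lborel u * l2norm lborel v))" using il[of y] by auto
      show "\<bar>l (y - m) * C m\<bar> \<le> \<bar>l (y - m)\<bar> * (l2norm lborel u * l2norm lborel v)" for m
        unfolding abs_mult by (intro mult_left_mono bC) auto
    qed
    then show ?thesis by (simp add: inl)
  qed
  have mO: "(\<lambda>y. LINT m|lborel. \<bar>l (y - m) * C m\<bar>) \<in> borel_measurable borel"
  proof -
    have "(\<lambda>z. \<bar>l (fst z - snd z) * C (snd z)\<bar>) \<in> borel_measurable borel"
      by (intro borel_measurable_abs borel_measurable_times
          borel_measurable_compose_continuous[OF ml] borel_measurable_compose_continuous[OF mC] continuous_intros)
    from borel_integral_param(1)[OF this] show ?thesis by simp
  qed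
  have "integrable lborel (\<lambda>y. \<bar>k y\<bar> * (LINT m|lborel. \<bar>l (y - m) * C m\<bar>))"
    by (rule integrable_times_bounded[OF _ mO, of _ "(LINT m|lborel. \<bar>l m\<bar>) * (l2norm lborel u * l2norm lborel v)"])
       (use k le in auto)
  then have "integrable (lborel \<Otimes>\<^sub>M lborel) (\<lambda>z. k (fst z) * (l (fst z - snd z) * C (snd z)))"
    using ilC by (intro lborel_pair.Fubini_integrable borel_measurable_lborel_pair m AE_I2) (auto simp: abs_mult)
  then have I: "integrable (lborel \<Otimes>\<^sub>M lborel) (case_prod (\<lambda>y m. k y * (l (y - m) * C m)))"
    by (simp add: case_prod_unfold)
  have "(LINT p|lborel. xconv k u p * xconv l v p) = (LINT y|lborel. k y * (LINT p|lborel. u (p - (0, y)) * xconv l v p))"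
    by (intro xconv_inner k u square_integrable_xconv l v)
  also have "\<dots> = (LINT y|lborel. LINT m|lborel. k y * (l (y - m) * C m))"
    by (simp add: inner)
  also have "\<dots> = (LINT m|lborel. LINT y|lborel. k y * (l (y - m) * C m))"
    by (rule lborel_pair.Fubini_integral[OF I, symmetric])
  also have "\<dots> = (LINT m|lborel. correlation k l m * C m)"
    by (simp add: correlation_def flip: mult.assoc)
  finally show ?thesis by (simp add: C_def)
qed

section \<open>Symmetry and partial integration for pairings of convolutions\<close>

lemma integrable_reflect:
  fixes k :: "'a::euclidean_space \<Rightarrow> real"
  shows "integrable lborel k \<Longrightarrow> integrable lborel (\<lambda>y. k (- y))"
  using integrable_lborel_affine_iff[of k "-1" 0] by simp

text \<open>The substitution of m - y for y in the correlation exchanges the two kernels and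
  reflects both. For even kernels this is self-adjointness of convolution.\<close>

lemma xconv_swap:
  assumes k: "integrable lborel k" and l: "integrable lborel l"
    and u: "square_integrable lborel u" and v: "square_integrable lborel v"
  shows "(LINT p|lborel. xconv k u p * xconv l v p) = (LINT p|lborel. xconv (\<lambda>y. l (- y)) u p * xconv (\<lambda>y. k (- y)) v p)"
proof -
  have "correlation (\<lambda>y. l (- y)) (\<lambda>y. k (- y)) m = correlation k l m" for m
  proof -
    have "(\<lambda>y. k y * l (y - m)) \<in> borel_measurable borel"
      using k l by (intro borel_measurable_times borel_measurable_translate) auto
    from integral_lborel_reflect[OF this, of m] show ?thesis
      by (simp add: correlation_def mult.commute)
  qed
  then show ?thesis
    by (simp add: xconv_inner_xconv[OF k l u v] xconv_inner_xconv[OF integrable_reflect[OF l] integrable_reflect[OF k] u v])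
qed

text \<open>The integral of f(x + e) - f(x) is 0 by translation invariance. Along the segment from x
  to x + e it is also an average of integrals of translates of the partial derivative, all equal to
  the one in question. No boundary term has to be discussed.\<close>

lemma integral_partial_deriv_eq_0:
  fixes f :: "'a::euclidean_space \<Rightarrow> real"
  assumes f: "f \<in> test_functions" and e: "e \<in> Basis"
  shows "(LINT x|lborel. partial_deriv e f x) = 0"
proof -
  note g = test_partial_deriv[OF f e]
  have mg: "partial_deriv e f \<in> borel_measurable borel" by (rule test_borel[OF g])
  have ig: "integrable lborel (partial_deriv e f)" by (rule test_integrable[OF g])
  have ig': "integrable lborel (\<lambda>x. partial_deriv e f (x + s *\<^sub>R e))" for s
    using integrable_translate[OF ig, of "- (s *\<^sub>R e)"] by simp
  have FTC: "(LINT s|lborel. indicator {0..1} s * partial_deriv e f (x + s *\<^sub>R e)) = f (x + e) - f x" for x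
  proof -
    have "(LINT s|lborel. indicator {0..1} s *\<^sub>R partial_deriv e f (x + s *\<^sub>R e)) = f (x + 1 *\<^sub>R e) - f (x + 0 *\<^sub>R e)"
    proof (rule integral_FTC_atLeastAtMost[where F="\<lambda>s. f (x + s *\<^sub>R e)"])
      fix s :: real
      have "((\<lambda>s. x + s *\<^sub>R e) has_derivative (\<lambda>r. r *\<^sub>R e)) (at s within {0..1})"
        by (auto intro!: derivative_eq_intros)
      from has_derivative_compose[OF this frechet_has[OF smooth_differentiable[OF test_smooth[OF f]]]]
      have "((\<lambda>s. f (x + s *\<^sub>R e)) has_derivative (\<lambda>r. r *\<^sub>R partial_deriv e f (x + s *\<^sub>R e))) (at s within {0..1})"
        using linear_scale[OF linear_frechet_derivative[OF smooth_differentiable[OF test_smooth[OF f]]]]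
        by (simp add: partial_deriv_def)
      then show "((\<lambda>s. f (x + s *\<^sub>R e)) has_vector_derivative partial_deriv e f (x + s *\<^sub>R e)) (at s within {0..1})"
        by (simp add: has_vector_derivative_def)
    next
      show "continuous_on {0..1} (\<lambda>s. partial_deriv e f (x + s *\<^sub>R e))"
        by (rule continuous_on_compose2[OF smooth_continuous_on[OF test_smooth[OF g], of UNIV]]) (auto intro!: continuous_intros)
    qed simp
    then show ?thesis by simp
  qed
  have m: "(\<lambda>z::real \<times> 'a. indicator {0..1} (fst z) * partial_deriv e f (snd z + fst z *\<^sub>R e)) \<in> borel_measurable borel"
    by (intro borel_measurable_times borel_measurable_compose_continuous[OF mg] continuous_intros
        borel_measurable_compose_continuous[of "indicator {0..1}" fst]) auto
  have "(LINT x|lborel. \<bar>partial_deriv e f (x + s *\<^sub>R e)\<bar>) = (LINT x|lborel. \<bar>partial_deriv e f x\<bar>)" for s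
    using integral_translate[of "\<lambda>x. \<bar>partial_deriv e f x\<bar>" "- (s *\<^sub>R e)"] mg by simp
  then have "integrable (lborel \<Otimes>\<^sub>M lborel) (\<lambda>z::real \<times> 'a. indicator {0..1} (fst z) * partial_deriv e f (snd z + fst z *\<^sub>R e))"
    using ig' by (intro lborel_pair.Fubini_integrable borel_measurable_lborel_pair m AE_I2) (auto simp: abs_mult)
  then have "integrable (lborel \<Otimes>\<^sub>M lborel) (case_prod (\<lambda>s x. indicator {0..1} s * partial_deriv e f (x + s *\<^sub>R e)))"
    by (simp add: case_prod_unfold)
  from lborel_pair.Fubini_integral[OF this]
  have "(LINT x|lborel. f (x + e) - f x) = (LINT s|lborel. indicator {0..1} s * (LINT x|lborel. partial_deriv e f (x + s *\<^sub>R e)))"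
    by (simp add: FTC)
  moreover have "(LINT x|lborel. partial_deriv e f (x + s *\<^sub>R e)) = (LINT x|lborel. partial_deriv e f x)" for s
    using integral_translate[OF mg, of "- (s *\<^sub>R e)"] by simp
  moreover have "(LINT x|lborel. f (x + e) - f x) = 0"
    using integral_translate[OF test_borel[OF f], of "- e"] integrable_translate[OF test_integrable[OF f], of "- e"] test_integrable[OF f]
    by simp
  ultimately show ?thesis by simp
qed

text \<open>Partial integration in the correlation of the kernels; u and v are never
  differentiated.\<close>

lemma xconv_partial_integration:
  assumes k: "k \<in> test_functions" and l: "l \<in> test_functions" and e: "e \<in> Basis"
    and u: "square_integrable lborel u" and v: "square_integrable lborel v"
  shows "(LINT p|lborel. xconv (partial_deriv e k) u p * xconv l v p) = 
    - (LINT p|lborel. xconv k u p * xconv (partial_deriv e l) v p)"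
proof -
  have "correlation (partial_deriv e k) l m = - correlation k (partial_deriv e l) m" for m
  proof -
    have lm: "(\<lambda>y. l (y - m)) \<in> test_functions"
      using test_affine[OF l, of "\<lambda>x. x" "- m"] by (simp add: bounded_linear_ident)
    have d: "f differentiable (at x)" if "f \<in> test_functions" for f :: "'a \<Rightarrow> real" and x
      using that by (intro smooth_differentiable test_smooth)
    have "partial_deriv e (\<lambda>y. l (y - m)) y = partial_deriv e l (y - m)" for y
      using partial_deriv_eq[OF partial_deriv_affine(1)[OF bounded_linear_ident, of l y "-m"], of e] d[OF l]
      by (simp add: partial_deriv_def)
    then have pd: "partial_deriv e (\<lambda>y. k y * l (y - m)) y = k y * partial_deriv e l (y - m) + partial_deriv e k y * l (y - m)" for y
      by (subst partial_deriv_mult) (auto intro: d k lm)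
    have t: "(\<lambda>y. partial_deriv e k y * l (y - m)) \<in> test_functions" "(\<lambda>y. k y * partial_deriv e l (y - m)) \<in> test_functions"
      using test_mult[OF test_smooth[OF test_partial_deriv[OF k e]] lm]
         test_mult[OF test_smooth[OF k], of "\<lambda>y. partial_deriv e l (y - m)"] 
         test_affine[OF test_partial_deriv[OF l e], of "\<lambda>x. x" "- m"] by (simp_all add: bounded_linear_ident)
    have "0 = (LINT y|lborel. partial_deriv e (\<lambda>y. k y * l (y - m)) y)"
      by (rule integral_partial_deriv_eq_0[symmetric, OF test_mult[OF test_smooth[OF k] lm] e])
    also have "\<dots> = (LINT y|lborel. k y * partial_deriv e l (y - m)) + (LINT y|lborel. partial_deriv e k y * l (y - m))"
      unfolding pd by (intro Bochner_Integration.integral_add test_integrable t)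
    finally show ?thesis by (simp add: correlation_def)
  qed
  then show ?thesis
    using k l e by (simp add: xconv_inner_xconv[OF test_integrable test_integrable u v] test_partial_deriv)
qed

section \<open>Linearity in the kernel and time weights\<close>

lemma xconv_diff_kernel:
  assumes "integrable lborel k" "integrable lborel l" "square_integrable lborel u"
  shows "AE p in lborel. xconv (\<lambda>x. k x - l x) u p = xconv k u p - xconv l u p"
  using xconv_AE_integrable[OF assms(1,3)] xconv_AE_integrable[OF assms(2,3)]
proof eventually_elim
  case (elim p)
  then show ?case by (simp add: xconv_def left_diff_distrib)
qed

lemma xconv_sum_kernel:
  assumes "finite I" "\<And>i. i \<in> I \<Longrightarrow> integrable lborel (k i)" "square_integrable lborel u"
  shows "AE p in lborel. xconv (\<lambda>x. \<Sum>i\<in>I. k i x) u p = (\<Sum>i\<in>I. xconv (k i) u p)"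
proof -
  have "AE p in lborel. \<forall>i\<in>I. integrable lborel (\<lambda>y. k i y * u (p - (0, y)))"
    using assms by (intro AE_finite_allI xconv_AE_integrable) auto
  then show ?thesis
  proof eventually_elim
    case (elim p)
    then show ?case by (simp add: xconv_def sum_distrib_right)
  qed
qed

text \<open>Convolution acts in space only, so a weight depending on time passes through it and may
  be attached to whichever factor of a pairing is convenient.\<close>

lemma xconv_time_multiplier: "xconv k (\<lambda>p. m (fst p) * u p) p = m (fst p) * xconv k u p"
proof -
  have "xconv k (\<lambda>p. m (fst p) * u p) p = (LINT y|lborel. m (fst p) * (k y * u (p - (0, y))))"
    unfolding xconv_def by (intro Bochner_Integration.integral_cong) auto
  then show ?thesis by (simp add: xconv_def)
qed

definition space_modulus :: "(real \<times> 'a::euclidean_space \<Rightarrow> real) \<Rightarrow> 'a \<Rightarrow> real" where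
  "space_modulus u y = (LINT p|lborel. (u (p - (0, y)) - u p)\<^sup>2)"

lemma space_modulus:
  assumes u: "square_integrable lborel u"
  shows "space_modulus u \<in> borel_measurable borel"
    and "0 \<le> space_modulus u y" "space_modulus u y \<le> 4 * (l2norm lborel u)\<^sup>2"
    and "square_integrable lborel (\<lambda>p. u (p - (0, y)) - u p)"
    and "h \<longlonglongrightarrow> 0 \<Longrightarrow> (\<lambda>n. space_modulus u (h n)) \<longlonglongrightarrow> 0"
    and "(\<lambda>z. u (snd z - (0, fst z)) - u (snd z)) \<in> borel_measurable borel"
proof -
  have mu: "u \<in> borel_measurable borel" using square_integrableD(1)[OF u] by simp
  show m: "(\<lambda>z. u (snd z - (0, fst z)) - u (snd z)) \<in> borel_measurable borel"
    by (intro borel_measurable_diff borel_measurable_compose_continuous[OF mu] continuous_intros)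
  then have "(\<lambda>z. (u (snd z - (0, fst z)) - u (snd z))\<^sup>2) \<in> borel_measurable borel" by measurable
  from borel_integral_param(1)[OF this] show "space_modulus u \<in> borel_measurable borel"
    by (simp add: space_modulus_def[abs_def])
  show "0 \<le> space_modulus u y" by (simp add: space_modulus_def)
  note t = square_integrable_translate[OF u, of "(0, y)"]
  show "square_integrable lborel (\<lambda>p. u (p - (0, y)) - u p)" by (rule square_integrable_diff[OF t(1) u])
  have "l2norm lborel (\<lambda>p. u (p - (0, y)) + (-1) * u p) \<le> l2norm lborel (\<lambda>p. u (p - (0, y))) + l2norm lborel (\<lambda>p. (-1) * u p)"
    by (intro l2norm_add t square_integrable_cmult u)
  also have "\<dots> = 2 * l2norm lborel u" unfolding t l2norm_cmult by simp
  finally have "(l2norm lborel (\<lambda>p. u (p - (0, y)) + (-1) * u p))\<^sup>2 \<le> (2 * l2norm lborel u)\<^sup>2"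
    by (intro power_mono l2norm_nonneg)
  then show "space_modulus u y \<le> 4 * (l2norm lborel u)\<^sup>2"
    by (simp add: l2norm_sq space_modulus_def power_mult_distrib)
  assume h: "h \<longlonglongrightarrow> 0"
  have "(\<lambda>n. (0::real, h n)) \<longlonglongrightarrow> (0, 0)" by (intro tendsto_intros h)
  from l2_translation[OF u this[folded zero_prod_def]]
  show "(\<lambda>n. space_modulus u (h n)) \<longlonglongrightarrow> 0" by (simp add: space_modulus_def)
qed

text \<open>The difference is the average with weight k of the increments of u, to which the
  Cauchy-Schwarz bound for averages applies. The mean of k is kept because it need not be 1.\<close>

lemma xconv_approx:
  assumes k: "integrable lborel k" and u: "square_integrable lborel u"
  shows "(l2norm lborel (\<lambda>p. xconv k u p - (LINT y|lborel. k y) * u p))\<^sup>2 \<le>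
     (LINT y|lborel. \<bar>k y\<bar>) * (LINT y|lborel. \<bar>k y\<bar> * space_modulus u y)"
proof -
  note sm = space_modulus[OF u]
  define \<Phi> where "\<Phi> z = u (snd z - (0, fst z)) - u (snd z)" for z :: "'a \<times> (real \<times> 'a)"
  have m\<Phi>: "\<Phi> \<in> borel_measurable borel" using sm(6) by (simp add: \<Phi>_def[abs_def])
  have I: "integrable (lborel \<Otimes>\<^sub>M lborel) (\<lambda>(y, p). \<bar>k y\<bar> * (\<Phi> (y, p))\<^sup>2)"
    using sm(3,4) by (intro average_pair_integrable[OF k m\<Phi>, of "4 * (l2norm lborel u)\<^sup>2"]) (auto simp: \<Phi>_def space_modulus_def)
  note ka = kernel_average[OF k m\<Phi> I]
  have "AE p in lborel. xconv k u p - (LINT y|lborel. k y) * u p = (LINT y|lborel. k y * \<Phi> (y, p))"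
    using xconv_AE_integrable[OF k u]
  proof eventually_elim
    case (elim p)
    have "integrable lborel (\<lambda>y. k y * u p)" using k by simp
    with elim show ?case by (simp add: xconv_def \<Phi>_def right_diff_distrib)
  qed
  then have "l2norm lborel (\<lambda>p. xconv k u p - (LINT y|lborel. k y) * u p) = l2norm lborel (\<lambda>p. LINT y|lborel. k y * \<Phi> (y, p))"
    using ka(2) square_integrable_xconv[OF k u] u
    by (intro l2norm_cong_AE) (auto dest!: square_integrableD(1))
  then show ?thesis using ka(3) by (simp add: l2norm_sq \<Phi>_def space_modulus_def)
qed

text \<open>Rescaling to the heat kernel at time 1 moves the concentration into the argument of the
  modulus, where the shifts shrink like exp(-n/2); the modulus is bounded, so dominated convergence
  applies.\<close>

lemma heat_space_modulus:
  assumes u: "square_integrable lborel (u :: real \<times> 'a::euclidean_space \<Rightarrow> real)"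
  shows "(\<lambda>n. LINT y|lborel. heat (- real n) y * space_modulus u y) \<longlonglongrightarrow> 0"
proof -
  note sm = space_modulus[OF u]
  note [measurable] = sm(1)
  have "(\<lambda>n. LINT y::'a|lborel. heat 0 y * space_modulus u (exp (- real n / 2) *\<^sub>R y)) \<longlonglongrightarrow> (LINT y::'a|lborel. 0)"
  proof (rule integral_dominated_convergence[where w="\<lambda>y. heat 0 y * (4 * (l2norm lborel u)\<^sup>2)"])
    show "integrable lborel (\<lambda>y::'a. heat 0 y * (4 * (l2norm lborel u)\<^sup>2))" by (simp add: integrable_heat)
    show "(\<lambda>y::'a. heat 0 y * space_modulus u (exp (- real n / 2) *\<^sub>R y)) \<in> borel_measurable lborel" for n
      by measurable
    show "AE y::'a in lborel. (\<lambda>n. heat 0 y * space_modulus u (exp (- real n / 2) *\<^sub>R y)) \<longlonglongrightarrow> 0"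
    proof (intro AE_I2 tendsto_mult_right_zero sm(5))
      fix y :: 'a
      have "(\<lambda>n. exp (- real n / 2)) \<longlonglongrightarrow> 0"
      proof -
        have "(\<lambda>n. exp (- 1 / 2 :: real) ^ n) \<longlonglongrightarrow> 0" by (intro LIMSEQ_realpow_zero) auto
        moreover have "exp (- 1 / 2 :: real) ^ n = exp (- real n / 2)" for n by (simp flip: exp_of_nat_mult)
        ultimately show ?thesis by simp
      qed
      from tendsto_scaleR[OF this tendsto_const[of y]]
      show "(\<lambda>n. exp (- real n / 2) *\<^sub>R y) \<longlonglongrightarrow> 0" by simp
    qed
    show "AE y::'a in lborel. norm (heat 0 y * space_modulus u (exp (- real n / 2) *\<^sub>R y)) \<le> heat 0 y * (4 * (l2norm lborel u)\<^sup>2)" for n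
    proof (intro AE_I2)
      fix y :: 'a
      show "norm (heat 0 y * space_modulus u (exp (- real n / 2) *\<^sub>R y)) \<le> heat 0 y * (4 * (l2norm lborel u)\<^sup>2)"
        using heat_pos[of 0 y] sm(2,3)[of "exp (- real n / 2) *\<^sub>R y"] by (simp add: abs_mult)
    qed
  qed simp
  then show ?thesis using integral_heat_scale[OF sm(1)] by simp
qed

text \<open>The heat kernels at times exp(-n) form an approximate identity, and a perturbation
  tending to 0 in L1 keeps this property. The bound 2 is the mass 1 of the heat kernel plus the
  error, at most 1.\<close>

lemma kernel_sequence:
  obtains k :: "nat \<Rightarrow> 'a::euclidean_space \<Rightarrow> real" where
    "\<And>n. k n \<in> test_functions" "\<And>n x. k n (- x) = k n x"
    "\<And>n. (LINT x|lborel. \<bar>k n x - laplacian (k n) x\<bar>) \<le> 2"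
    "\<And>u. square_integrable lborel u \<Longrightarrow>
       (\<lambda>n. l2norm lborel (\<lambda>p. xconv (\<lambda>x. k n x - laplacian (k n) x) u p - u p)) \<longlonglongrightarrow> 0"
proof -
  have "\<forall>n. \<exists>k\<in>test_functions. (\<forall>x. k (- x) = k x) \<and>
    (LINT x::'a|lborel. \<bar>k x - laplacian k x - heat (- real n) x\<bar>) \<le> 1 / real (Suc n)"
    by (intro allI exists_kernel) simp
  then obtain k where k: "\<And>n. k n \<in> test_functions" "\<And>n x. k n (- x) = k n x"
     "\<And>n. (LINT x::'a|lborel. \<bar>k n x - laplacian (k n) x - heat (- real n) x\<bar>) \<le> 1 / real (Suc n)"
    by metis
  define q where "q n x = k n x - laplacian (k n) x" for n x
  have qt: "q n \<in> test_functions" for n unfolding q_def[abs_def] by (intro test_diff test_laplacian k)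
  have iq: "integrable lborel (q n)" for n by (rule test_integrable[OF qt])
  have iqh: "integrable lborel (\<lambda>x. q n x - heat (- real n) x)" for n
    by (intro Bochner_Integration.integrable_diff iq integrable_heat)
  have k3: "(LINT x|lborel. \<bar>q n x - heat (- real n) x\<bar>) \<le> 1 / real (Suc n)" for n using k(3) by (simp add: q_def)
  have q2: "(LINT x|lborel. \<bar>q n x\<bar>) \<le> 2" for n
  proof -
    have "(LINT x|lborel. \<bar>q n x\<bar>) \<le> (LINT x|lborel. \<bar>q n x - heat (- real n) x\<bar> + heat (- real n) x)"
      using iq iqh[of n] 
    proof (intro integral_mono)
      show "\<bar>q n x\<bar> \<le> \<bar>q n x - heat (- real n) x\<bar> + heat (- real n) x" for x using heat_pos[of "- real n" x] by linarith
    qed (auto intro: integrable_heat)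
    also have "\<dots> = (LINT x|lborel. \<bar>q n x - heat (- real n) x\<bar>) + 1"
      using iqh[of n] by (subst Bochner_Integration.integral_add) (auto intro: integrable_heat simp: integral_heat)
    also have "\<dots> \<le> 2" using k3[of n] by (smt (verit) divide_le_eq_1 of_nat_Suc of_nat_0_le_iff)
    finally show ?thesis .
  qed
  have lim0: "(\<lambda>n. 1 / real (Suc n)) \<longlonglongrightarrow> 0" using lim_inverse_n'[THEN LIMSEQ_Suc] by simp
  have conv: "(\<lambda>n. l2norm lborel (\<lambda>p. xconv (q n) u p - u p)) \<longlonglongrightarrow> 0" if u: "square_integrable lborel u" for u
  proof -
    note sm = space_modulus[OF u]
    have le: "l2norm lborel (\<lambda>p. xconv (q n) u p - u p) \<le>
      sqrt (2 * ((LINT y|lborel. heat (- real n) y * space_modulus u y) + 1 / real (Suc n) * (4 * (l2norm lborel u)\<^sup>2))) +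
      1 / real (Suc n) * l2norm lborel u" for n
    proof -
      \<comment> \<open>The kernel is neither normalised nor known to be nonnegative. Its mean
        differs from 1 by at most the L1 error, and the resulting multiple of u is estimated
        separately.\<close>
      define I where "I = (LINT y|lborel. q n y)"
      have "\<bar>I - 1\<bar> = \<bar>LINT y|lborel. q n y - heat (- real n) y\<bar>"
        by (simp add: Bochner_Integration.integral_diff[OF iq integrable_heat] I_def integral_heat)
      also have "\<dots> \<le> (LINT y|lborel. \<bar>q n y - heat (- real n) y\<bar>)" by (rule integral_abs_bound)
      also have "\<dots> \<le> 1 / real (Suc n)" by (rule k3)
      finally have I: "\<bar>I - 1\<bar> \<le> 1 / real (Suc n)" .
      have ims: "integrable lborel (\<lambda>y. f y * space_modulus u y)" if "integrable lborel f" for f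
        by (rule integrable_times_bounded[OF that sm(1), of "4 * (l2norm lborel u)\<^sup>2"]) (use sm(2,3) in auto)
      have ia: "integrable lborel (\<lambda>y. \<bar>q n y - heat (- real n) y\<bar>)" using iqh by simp
      have "(LINT y|lborel. \<bar>q n y\<bar> * space_modulus u y) \<le>
        (LINT y|lborel. heat (- real n) y * space_modulus u y + \<bar>q n y - heat (- real n) y\<bar> * (4 * (l2norm lborel u)\<^sup>2))"
      proof (rule integral_mono)
        show "integrable lborel (\<lambda>y. \<bar>q n y\<bar> * space_modulus u y)" using iq[of n] by (intro ims) simp
        show "integrable lborel (\<lambda>y. heat (- real n) y * space_modulus u y + \<bar>q n y - heat (- real n) y\<bar> * (4 * (l2norm lborel u)\<^sup>2))"
          using ims[OF integrable_heat] ia by auto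
        fix y
        have "\<bar>q n y\<bar> * space_modulus u y \<le> (heat (- real n) y + \<bar>q n y - heat (- real n) y\<bar>) * space_modulus u y"
          using heat_pos[of "- real n" y] sm(2) by (intro mult_right_mono) auto
        also have "\<dots> \<le> heat (- real n) y * space_modulus u y + \<bar>q n y - heat (- real n) y\<bar> * (4 * (l2norm lborel u)\<^sup>2)"
          using mult_left_mono[OF sm(3)[of y], of "\<bar>q n y - heat (- real n) y\<bar>"] by (simp add: distrib_right)
        finally show "\<bar>q n y\<bar> * space_modulus u y \<le> heat (- real n) y * space_modulus u y + \<bar>q n y - heat (- real n) y\<bar> * (4 * (l2norm lborel u)\<^sup>2)" .
      qed
      also have "\<dots> = (LINT y|lborel. heat (- real n) y * space_modulus u y) + (LINT y|lborel. \<bar>q n y - heat (- real n) y\<bar>) * (4 * (l2norm lborel u)\<^sup>2)"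
        using ims[OF integrable_heat] ia by simp
      also have "\<dots> \<le> (LINT y|lborel. heat (- real n) y * space_modulus u y) + 1 / real (Suc n) * (4 * (l2norm lborel u)\<^sup>2)"
        by (intro add_left_mono mult_right_mono k3) simp
      finally have "(LINT y|lborel. \<bar>q n y\<bar> * space_modulus u y) \<le> 
        (LINT y|lborel. heat (- real n) y * space_modulus u y) + 1 / real (Suc n) * (4 * (l2norm lborel u)\<^sup>2)" .
      then have "(LINT y|lborel. \<bar>q n y\<bar>) * (LINT y|lborel. \<bar>q n y\<bar> * space_modulus u y) \<le> 
        2 * ((LINT y|lborel. heat (- real n) y * space_modulus u y) + 1 / real (Suc n) * (4 * (l2norm lborel u)\<^sup>2))"
        using sm(2) by (intro mult_mono q2) auto
      from order_trans[OF xconv_approx[OF iq u] this]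
      have 1: "l2norm lborel (\<lambda>p. xconv (q n) u p - I * u p) \<le> 
        sqrt (2 * ((LINT y|lborel. heat (- real n) y * space_modulus u y) + 1 / real (Suc n) * (4 * (l2norm lborel u)\<^sup>2)))"
        by (simp add: I_def real_le_rsqrt)
      have "l2norm lborel (\<lambda>p. (xconv (q n) u p - I * u p) + (I - 1) * u p) \<le> 
         l2norm lborel (\<lambda>p. xconv (q n) u p - I * u p) + l2norm lborel (\<lambda>p. (I - 1) * u p)"
        by (intro l2norm_add square_integrable_diff square_integrable_cmult square_integrable_xconv iq u)
      also have "l2norm lborel (\<lambda>p. (I - 1) * u p) \<le> 1 / real (Suc n) * l2norm lborel u"
        unfolding l2norm_cmult by (intro mult_right_mono I l2norm_nonneg)
      finally show ?thesis using 1 by (simp add: left_diff_distrib)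
    qed
    have "(\<lambda>n. sqrt (2 * ((LINT y|lborel. heat (- real n) y * space_modulus u y) + 1 / real (Suc n) * (4 * (l2norm lborel u)\<^sup>2))) +
      1 / real (Suc n) * l2norm lborel u) \<longlonglongrightarrow> sqrt (2 * (0 + 0 * (4 * (l2norm lborel u)\<^sup>2))) + 0 * l2norm lborel u"
      by (intro tendsto_intros heat_space_modulus u lim0)
    then have lim: "(\<lambda>n. sqrt (2 * ((LINT y|lborel. heat (- real n) y * space_modulus u y) + 1 / real (Suc n) * (4 * (l2norm lborel u)\<^sup>2))) +
      1 / real (Suc n) * l2norm lborel u) \<longlonglongrightarrow> 0" by simp
    show ?thesis
      by (rule Lim_null_comparison[OF _ lim], rule always_eventually, rule allI) (use le in \<open>simp add: l2norm_nonneg\<close>)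
  qed
  show ?thesis
  proof (rule that[of k])
    show "(LINT x|lborel. \<bar>k n x - laplacian (k n) x\<bar>) \<le> 2" for n using q2[of n] by (simp add: q_def)
    show "(\<lambda>n. l2norm lborel (\<lambda>p. xconv (\<lambda>x. k n x - laplacian (k n) x) u p - u p)) \<longlonglongrightarrow> 0"
      if "square_integrable lborel u" for u using conv[OF that] by (simp add: q_def[abs_def])
  qed (use k in auto)
qed

section \<open>Weak derivatives on an interval\<close>

text \<open>Integration starts at minus infinity. For functions that vanish off (0,T) this is the
  primitive with value 0 at time 0, so the initial condition is built in.\<close>

definition primitive :: "(real \<Rightarrow> real) \<Rightarrow> real \<Rightarrow> real" where
  "primitive F t = (LINT s|lborel. indicator {..t} s * F s)"

lemma integrable_pair_mult:
  fixes f :: "'a::euclidean_space \<Rightarrow> real" and g :: "'b::euclidean_space \<Rightarrow> real"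
  assumes f: "integrable lborel f" and g: "integrable lborel g"
  shows "integrable (lborel \<Otimes>\<^sub>M lborel) (\<lambda>(x, y). f x * g y)"
proof -
  have mf: "f \<in> borel_measurable borel" and mg: "g \<in> borel_measurable borel" using f g by auto
  have m: "(\<lambda>z. f (fst z) * g (snd z)) \<in> borel_measurable borel"
    by (intro borel_measurable_times borel_measurable_compose_continuous[OF mf] borel_measurable_compose_continuous[OF mg] continuous_intros)
  have "integrable (lborel \<Otimes>\<^sub>M lborel) (\<lambda>z. f (fst z) * g (snd z))"
    using f g by (intro lborel_pair.Fubini_integrable borel_measurable_lborel_pair m AE_I2) (auto simp: abs_mult)
  then show ?thesis by (simp add: case_prod_unfold)
qed

text \<open>One triangle contains the diagonal and the other does not, so that the two together
  partition a square without overlap.\<close>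

lemma integrable_triangle:
  fixes f g :: "real \<Rightarrow> real"
  assumes f: "integrable lborel f" and g: "integrable lborel g"
  shows "integrable (lborel \<Otimes>\<^sub>M lborel) (\<lambda>(s, t). indicator {..t} s * f s * g t)"
    and "integrable (lborel \<Otimes>\<^sub>M lborel) (\<lambda>(s, t). indicator {..<t} s * f s * g t)"
proof -
  have mf: "f \<in> borel_measurable borel" and mg: "g \<in> borel_measurable borel" using f g by auto
  have c: "closed {z::real \<times> real. fst z \<le> snd z}" "open {z::real \<times> real. fst z < snd z}"
    by (intro closed_Collect_le open_Collect_less continuous_intros)+
  have mi: "indicator {z::real \<times> real. fst z \<le> snd z} \<in> borel_measurable borel" 
      "indicator {z::real \<times> real. fst z < snd z} \<in> borel_measurable borel"
    using c by (intro borel_measurable_indicator borel_closed borel_open; simp)+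
  have ie: "indicator {z::real \<times> real. fst z \<le> snd z} z = (indicator {..snd z} (fst z) :: real)" 
      "indicator {z::real \<times> real. fst z < snd z} z = (indicator {..<snd z} (fst z) :: real)" for z
    by (auto simp: indicator_def)
  have m: "(\<lambda>z::real \<times> real. (indicator {..snd z} (fst z) :: real)) \<in> borel_measurable borel"
     "(\<lambda>z::real \<times> real. (indicator {..<snd z} (fst z) :: real)) \<in> borel_measurable borel"
    using mi unfolding ie[symmetric] by simp_all
  have mm: "(\<lambda>z::real \<times> real. f (fst z)) \<in> borel_measurable borel" "(\<lambda>z::real \<times> real. g (snd z)) \<in> borel_measurable borel"
    by (intro borel_measurable_compose_continuous[OF mf] borel_measurable_compose_continuous[OF mg] continuous_intros)+
  have fg: "integrable (lborel \<Otimes>\<^sub>M lborel) (\<lambda>z. f (fst z) * g (snd z))"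
    using integrable_pair_mult[OF f g] by (simp add: case_prod_unfold)
  have "integrable (lborel \<Otimes>\<^sub>M lborel) (\<lambda>z. indicator {..snd z} (fst z) * f (fst z) * g (snd z))"
    by (rule Bochner_Integration.integrable_bound[OF fg])
       (use m mm in \<open>auto intro!: borel_measurable_lborel_pair borel_measurable_times AE_I2 simp: indicator_def abs_mult\<close>)
  then show "integrable (lborel \<Otimes>\<^sub>M lborel) (\<lambda>(s, t). indicator {..t} s * f s * g t)"
    by (simp add: case_prod_unfold)
  have "integrable (lborel \<Otimes>\<^sub>M lborel) (\<lambda>z. indicator {..<snd z} (fst z) * f (fst z) * g (snd z))"
    by (rule Bochner_Integration.integrable_bound[OF fg])
       (use m mm in \<open>auto intro!: borel_measurable_lborel_pair borel_measurable_times AE_I2 simp: indicator_def abs_mult\<close>)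
  then show "integrable (lborel \<Otimes>\<^sub>M lborel) (\<lambda>(s, t). indicator {..<t} s * f s * g t)"
    by (simp add: case_prod_unfold)
qed

lemma primitive_borel:
  assumes F: "F \<in> borel_measurable borel"
  shows "primitive F \<in> borel_measurable borel"
proof -
  have "closed {z::real \<times> real. snd z \<le> fst z}" by (intro closed_Collect_le continuous_intros)
  then have "(indicator {z::real \<times> real. snd z \<le> fst z} :: _ \<Rightarrow> real) \<in> borel_measurable borel" 
    by (intro borel_measurable_indicator borel_closed)
  moreover have "indicator {z::real \<times> real. snd z \<le> fst z} = (\<lambda>z. indicator {..fst z} (snd z) :: real)"
    by (auto simp: indicator_def)
  ultimately have m: "(\<lambda>z::real \<times> real. indicator {..fst z} (snd z) :: real) \<in> borel_measurable borel" by simp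
  have "(\<lambda>z::real \<times> real. indicator {..fst z} (snd z) * F (snd z)) \<in> borel_measurable borel"
    by (intro borel_measurable_times m borel_measurable_compose_continuous[OF F] continuous_intros)
  from borel_integral_param(1)[OF this] show ?thesis by (simp add: primitive_def[abs_def])
qed

lemma integrable_indicator_mult:
  fixes F :: "'a::euclidean_space \<Rightarrow> real"
  shows "integrable lborel F \<Longrightarrow> A \<in> sets borel \<Longrightarrow> integrable lborel (\<lambda>s. indicator A s * F s)"
  using integrable_mult_indicator[of A lborel F] by simp

lemma primitive_bound:
  assumes F: "integrable lborel F"
  shows "\<bar>primitive F t\<bar> \<le> (LINT s|lborel. \<bar>F s\<bar>)"
proof -
  have "\<bar>primitive F t\<bar> \<le> (LINT s|lborel. \<bar>indicator {..t} s * F s\<bar>)"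
    unfolding primitive_def by (rule integral_abs_bound)
  also have "\<dots> \<le> (LINT s|lborel. \<bar>F s\<bar>)"
  proof (rule integral_mono)
    show "integrable lborel (\<lambda>s. \<bar>indicator {..t} s * F s\<bar>)"
      by (intro integrable_abs integrable_indicator_mult F) simp
  qed (use F in \<open>auto simp: indicator_def\<close>)
  finally show ?thesis .
qed

text \<open>The product rule for primitives of merely integrable functions. The product of the two
  integrals is an integral over a square; cutting it along the diagonal and integrating each
  triangle in its inner variable gives the two terms.\<close>

lemma primitive_mult:
  assumes H: "integrable lborel H" and P: "integrable lborel P"
  shows "primitive H t * primitive P t = primitive (\<lambda>s. H s * primitive P s + primitive H s * P s) t"
proof -
  define h p where "h s = indicator {..t} s * H s" and "p s = indicator {..t} s * P s" for s :: real
  have ih: "integrable lborel h" and ip: "integrable lborel p"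
    unfolding h_def p_def by (intro integrable_indicator_mult H P; simp)+
  note J1 = integrable_triangle(1)[OF ip ih] and J2 = integrable_triangle(2)[OF ih ip]
  have 1: "(LINT r|lborel. indicator {..s} r * p r * h s) = h s * primitive P s" for s
  proof -
    have "(LINT r|lborel. indicator {..s} r * p r * h s) = (LINT r|lborel. h s * (indicator {..s} r * P r))"
      by (intro Bochner_Integration.integral_cong) (auto simp: indicator_def h_def p_def)
    then show ?thesis by (simp add: primitive_def)
  qed
  have 2: "(LINT s|lborel. indicator {..<r} s * h s * p r) = p r * primitive H r" for r
  proof -
    have "(LINT s|lborel. indicator {..<r} s * h s * p r) = (LINT s|lborel. p r * (indicator {..r} s * H s))"
    proof (rule integral_cong_AE)
      \<comment> \<open>The half-lines with and without their end point differ in the single point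
        r, a null set.\<close>
      show "AE s in lborel. indicator {..<r} s * h s * p r = p r * (indicator {..r} s * H s)"
        using AE_lborel_singleton[of r] by eventually_elim (auto simp: indicator_def h_def p_def)
    qed (use H ih in \<open>auto intro!: borel_measurable_times\<close>)
    then show ?thesis by (simp add: primitive_def)
  qed
  have "primitive H t * primitive P t = (LINT s|lborel. h s) * (LINT r|lborel. p r)"
    by (simp add: primitive_def h_def p_def)
  also have "\<dots> = (LINT s|lborel. LINT r|lborel. h s * p r)" by simp
  also have "\<dots> = (LINT s|lborel. h s * primitive P s + (LINT r|lborel. indicator {..<r} s * h s * p r))"
  proof (rule integral_cong_AE)
    have "AE s in lborel. integrable lborel (\<lambda>r. indicator {..<r} s * h s * p r)"
      by (rule lborel_pair.AE_integrable_fst[OF J2])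
    moreover have "AE s in lborel. integrable lborel (\<lambda>r. indicator {..s} r * p r * h s)"
      by (rule lborel_pair.AE_integrable_snd[OF J1])
    ultimately show "AE s in lborel. (LINT r|lborel. h s * p r) = h s * primitive P s + (LINT r|lborel. indicator {..<r} s * h s * p r)"
    proof eventually_elim
      case (elim s)
      have "(LINT r|lborel. h s * p r) = (LINT r|lborel. indicator {..s} r * p r * h s + indicator {..<r} s * h s * p r)"
        by (intro Bochner_Integration.integral_cong) (auto simp: indicator_def)
      also have "\<dots> = (LINT r|lborel. indicator {..s} r * p r * h s) + (LINT r|lborel. indicator {..<r} s * h s * p r)"
        using elim by simp
      finally show ?case unfolding 1 .
    qed
    show "(\<lambda>s. LINT r|lborel. h s * p r) \<in> borel_measurable lborel" using ih by auto
    show "(\<lambda>s. h s * primitive P s + (LINT r|lborel. indicator {..<r} s * h s * p r)) \<in> borel_measurable lborel"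
      using ih primitive_borel[of P] P lborel_pair.integrable_fst[OF J2]
      by (intro borel_measurable_add borel_measurable_times) auto
  qed
  also have "\<dots> = (LINT s|lborel. h s * primitive P s) + (LINT s|lborel. LINT r|lborel. indicator {..<r} s * h s * p r)"
    using lborel_pair.integrable_fst[OF J2] lborel_pair.integrable_snd[OF J1] unfolding 1
    by (intro Bochner_Integration.integral_add) auto
  also have "(LINT s|lborel. LINT r|lborel. indicator {..<r} s * h s * p r) = (LINT r|lborel. p r * primitive H r)"
    using lborel_pair.Fubini_integral[OF J2] unfolding 2 by simp
  also have "(LINT s|lborel. h s * primitive P s) + (LINT r|lborel. p r * primitive H r) =
    (LINT s|lborel. h s * primitive P s + p s * primitive H s)"
    using lborel_pair.integrable_fst[OF integrable_triangle(1)[OF ih ip]] lborel_pair.integrable_snd[OF J1]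
      lborel_pair.integrable_snd[OF J2] unfolding 1 2
    by (intro Bochner_Integration.integral_add[symmetric]) auto
  also have "\<dots> = primitive (\<lambda>s. H s * primitive P s + primitive H s * P s) t"
    unfolding primitive_def by (intro Bochner_Integration.integral_cong) (auto simp: h_def p_def primitive_def indicator_def)
  finally show ?thesis .
qed

text \<open>The integral of exp(-l t) over t from s to T. It is at most exp(-l s)/l, and this gain
  of 1/l plays the role of the exponential factor in Gronwall's inequality.\<close>

definition tail_weight :: "real \<Rightarrow> real \<Rightarrow> real \<Rightarrow> real" where
  "tail_weight l T s = (exp (- l * s) - exp (- l * T)) / l"

text \<open>Exchanging the order of integration over the triangle s \<le> t integrates the
  exponential from s to T.\<close>

lemma weighted_primitive:
  assumes Q: "integrable lborel Q" and Q0: "\<And>s. s \<notin> {0<..<T} \<Longrightarrow> Q s = 0" and l: "l > 0"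
  shows "(LINT t|lborel. indicator {0..T} t * exp (- l * t) * primitive Q t) = (LINT s|lborel. tail_weight l T s * Q s)"
proof -
  define e where "e t = indicator {0..T} t * exp (- l * t)" for t
  have ie: "integrable lborel e"
  proof -
    have "continuous_on {0..T} (\<lambda>t. exp (- l * t))" by (intro continuous_intros)
    from borel_integrable_compact[OF compact_Icc this] show ?thesis by (simp add: e_def[abs_def])
  qed
  note J = integrable_triangle(1)[OF Q ie]
  have 1: "(LINT s|lborel. indicator {..t} s * Q s * e t) = e t * primitive Q t" for t
    by (simp add: primitive_def)
  have 2: "(LINT t|lborel. indicator {..t} s * Q s * e t) = tail_weight l T s * Q s" for s
  proof (cases "s \<in> {0<..<T}")
    case True
    have "(LINT t|lborel. indicator {..t} s * Q s * e t) = (LINT t|lborel. Q s * (indicator {s..T} t *\<^sub>R exp (- l * t)))"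
      using True by (intro Bochner_Integration.integral_cong) (auto simp: e_def indicator_def)
    also have "\<dots> = Q s * (LINT t|lborel. indicator {s..T} t *\<^sub>R exp (- l * t))" by simp
    also have "(LINT t|lborel. indicator {s..T} t *\<^sub>R exp (- l * t)) = (- exp (- l * T) / l) - (- exp (- l * s) / l)"
      using True l
      by (intro integral_FTC_atLeastAtMost)
         (auto intro!: continuous_intros derivative_eq_intros simp: has_real_derivative_iff_has_vector_derivative[symmetric])
    finally show ?thesis using l by (simp add: tail_weight_def field_simps)
  qed (simp add: Q0)
  show ?thesis using lborel_pair.Fubini_integral[OF J] unfolding 1 2 by (simp add: e_def)
qed

text \<open>The weighted and time-integrated form of (W V)' = H V + W P with zero initial values,
  for functions that agree with primitives only almost everywhere.\<close>

lemma weighted_product: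
  assumes H: "integrable lborel H" and P: "integrable lborel P"
    and W: "W \<in> borel_measurable borel" and V: "V \<in> borel_measurable borel"
    and 0: "\<And>t. t \<notin> {0<..<T} \<Longrightarrow> W t = 0" "\<And>t. t \<notin> {0<..<T} \<Longrightarrow> V t = 0"
      "\<And>t. t \<notin> {0<..<T} \<Longrightarrow> H t = 0" "\<And>t. t \<notin> {0<..<T} \<Longrightarrow> P t = 0"
    and WH: "AE t in lborel. t \<in> {0<..<T} \<longrightarrow> W t = primitive H t"
    and VP: "AE t in lborel. t \<in> {0<..<T} \<longrightarrow> V t = primitive P t" and l: "l > 0"
  shows "(LINT t|lborel. indicator {0..T} t * exp (- l * t) * (W t * V t)) = 
    (LINT t|lborel. tail_weight l T t * (H t * V t + W t * P t))"
proof -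
  define Q where "Q s = H s * primitive P s + primitive H s * P s" for s
  have mH [measurable]: "H \<in> borel_measurable borel" "P \<in> borel_measurable borel" using H P by auto
  note [measurable] = primitive_borel[OF mH(1)] primitive_borel[OF mH(2)] W V
  have mQ [measurable]: "Q \<in> borel_measurable borel" unfolding Q_def[abs_def] by measurable
  have iQ: "integrable lborel Q"
    unfolding Q_def using integrable_times_bounded[OF P primitive_borel[OF mH(1)] primitive_bound[OF H]]
    by (intro Bochner_Integration.integrable_add integrable_times_bounded[OF H primitive_borel[OF mH(2)] primitive_bound[OF P]])
       (simp add: mult.commute)
  have [measurable]: "tail_weight l T \<in> borel_measurable borel" unfolding tail_weight_def[abs_def] by measurable
  have "(LINT t|lborel. indicator {0..T} t * exp (- l * t) * (W t * V t)) = 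
     (LINT t|lborel. indicator {0..T} t * exp (- l * t) * primitive Q t)"
  proof (rule integral_cong_AE)
    show "AE t in lborel. indicator {0..T} t * exp (- l * t) * (W t * V t) = indicator {0..T} t * exp (- l * t) * primitive Q t"
      using WH VP AE_lborel_singleton[of 0] AE_lborel_singleton[of T]
    proof eventually_elim
      case (elim t)
      then show ?case using primitive_mult[OF H P, of t]
        by (cases "t \<in> {0<..<T}") (auto simp: indicator_def Q_def[abs_def])
    qed
  qed (use primitive_borel[OF mQ] in measurable)
  also have "\<dots> = (LINT t|lborel. tail_weight l T t * Q t)"
    by (rule weighted_primitive[OF iQ _ l]) (simp add: Q_def 0)
  also have "\<dots> = (LINT t|lborel. tail_weight l T t * (H t * V t + W t * P t))"
  proof (rule integral_cong_AE)
    show "AE t in lborel. tail_weight l T t * Q t = tail_weight l T t * (H t * V t + W t * P t)"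
      using WH VP
    proof eventually_elim
      case (elim t)
      then show ?case by (cases "t \<in> {0<..<T}") (auto simp: Q_def 0)
    qed
  qed measurable
  finally show ?thesis .
qed

text \<open>Positive and negative part of \<open>U\<close> are densities of two measures that agree
  on all half-lines and are finite there; the measures are equal, hence also the densities almost
  everywhere.\<close>

lemma AE_eq_0_of_integrals:
  fixes U :: "real \<Rightarrow> real"
  assumes U: "integrable lborel U" and 0: "\<And>x. (LINT t|lborel. indicator {x<..} t * U t) = 0"
  shows "AE t in lborel. U t = 0"
proof -
  have [measurable]: "U \<in> borel_measurable borel" using U by auto
  define M where "M = density lborel (\<lambda>t. ennreal (max 0 (U t)))"
  define N where "N = density lborel (\<lambda>t. ennreal (max 0 (- U t)))"
  have i: "integrable lborel (\<lambda>t. indicator {x<..} t * max 0 (U t))" "integrable lborel (\<lambda>t. indicator {x<..} t * max 0 (- U t))" for x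
    using U by (auto intro!: integrable_indicator_mult integrable_max)
  have M: "emeasure M {x<..} = ennreal (LINT t|lborel. indicator {x<..} t * max 0 (U t))" for x
  proof -
    have "emeasure M {x<..} = (\<integral>\<^sup>+t. ennreal (indicator {x<..} t * max 0 (U t)) \<partial>lborel)"
      unfolding M_def by (subst emeasure_density) (auto intro!: nn_integral_cong simp: indicator_def)
    also have "\<dots> = ennreal (LINT t|lborel. indicator {x<..} t * max 0 (U t))"
      by (intro nn_integral_eq_integral i AE_I2) auto
    finally show ?thesis .
  qed
  have N: "emeasure N {x<..} = ennreal (LINT t|lborel. indicator {x<..} t * max 0 (- U t))" for x
  proof -
    have "emeasure N {x<..} = (\<integral>\<^sup>+t. ennreal (indicator {x<..} t * max 0 (- U t)) \<partial>lborel)"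
      unfolding N_def by (subst emeasure_density) (auto intro!: nn_integral_cong simp: indicator_def)
    also have "\<dots> = ennreal (LINT t|lborel. indicator {x<..} t * max 0 (- U t))"
      by (intro nn_integral_eq_integral i AE_I2) auto
    finally show ?thesis .
  qed
  have eq: "(LINT t|lborel. indicator {x<..} t * max 0 (U t)) = (LINT t|lborel. indicator {x<..} t * max 0 (- U t))" for x
  proof -
    have "(LINT t|lborel. indicator {x<..} t * max 0 (U t)) - (LINT t|lborel. indicator {x<..} t * max 0 (- U t)) =
      (LINT t|lborel. indicator {x<..} t * U t)"
      unfolding Bochner_Integration.integral_diff[OF i, symmetric]
      by (intro Bochner_Integration.integral_cong) (auto simp: max_def indicator_def)
    then show ?thesis using 0 by simp
  qed
  have "M = N"
    by (rule measure_eqI_lessThan) (use eq in \<open>auto simp: M N\<close>, simp_all add: M_def N_def)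
  then have "AE t in lborel. ennreal (max 0 (U t)) = ennreal (max 0 (- U t))"
    unfolding M_def N_def by (intro sigma_finite_measure.density_unique[OF lborel.sigma_finite_measure_axioms]) auto
  then show ?thesis
    by eventually_elim (auto simp: max_def split: if_splits)
qed

text \<open>Vanishing mean is what lets the antiderivative return to 0 on both sides. The formula by
  an integral over the half-line to the right of s is recorded because it is the form to which
  Fubini applies.\<close>

lemma smooth_antiderivative_compact:
  fixes \<psi> :: "real \<Rightarrow> real"
  assumes \<psi>: "smooth \<psi>" and ab: "a \<le> b" and 0: "\<And>t. t \<le> a \<Longrightarrow> \<psi> t = 0" "\<And>t. b \<le> t \<Longrightarrow> \<psi> t = 0" 
    and int: "(LINT t|lborel. \<psi> t) = 0"
  obtains \<theta> where "smooth \<theta>" "\<And>t. (\<theta> has_real_derivative \<psi> t) (at t)" "\<And>t. t \<notin> {a..b} \<Longrightarrow> \<theta> t = 0"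
    "\<And>s. \<theta> s = - (LINT t|lborel. indicator {..t} s * \<psi> t)"
proof -
  have "\<exists>F. \<forall>x::real. - \<infinity> < ereal x \<longrightarrow> ereal x < \<infinity> \<longrightarrow> (F has_vector_derivative \<psi> x) (at x)"
    by (rule einterval_antiderivative) (auto intro: smooth_continuous_at \<psi>)
  then obtain F where F: "\<And>x. (F has_real_derivative \<psi> x) (at x)"
    by (auto simp: has_real_derivative_iff_has_vector_derivative)
  have FTC: "(LINT t|lborel. indicator {x..y} t *\<^sub>R \<psi> t) = F y - F x" if "x \<le> y" for x y
    using that F by (intro integral_FTC_atLeastAtMost smooth_continuous_on \<psi>)
      (auto simp: has_real_derivative_iff_has_vector_derivative[symmetric] intro: has_field_derivative_at_within)
  define c where "c = F b"
  have key: "F s - c = - (LINT t|lborel. indicator {..t} s * \<psi> t)" for s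
  proof (cases "s \<le> b")
    case True
    have "(LINT t|lborel. indicator {..t} s * \<psi> t) = (LINT t|lborel. indicator {s..b} t *\<^sub>R \<psi> t)"
      using 0 True by (intro Bochner_Integration.integral_cong) (auto simp: indicator_def)
    then show ?thesis using FTC[OF True] by (simp add: c_def)
  next
    case False
    have "(LINT t|lborel. indicator {..t} s * \<psi> t) = (LINT t::real|lborel. 0)"
      using 0 False by (intro Bochner_Integration.integral_cong) (auto simp: indicator_def)
    moreover have "F s - F b = (LINT t|lborel. indicator {b..s} t *\<^sub>R \<psi> t)" using FTC[of b s] False by simp
    moreover have "\<dots> = (LINT t::real|lborel. 0)"
      using 0 by (intro Bochner_Integration.integral_cong) (auto simp: indicator_def)
    ultimately show ?thesis by (simp add: c_def)
  qed
  show ?thesis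
  proof (rule that[of "\<lambda>t. F t - c"])
    show d: "((\<lambda>t. F t - c) has_real_derivative \<psi> t) (at t)" for t
      using F[of t] by (auto intro!: derivative_eq_intros)
    show "smooth (\<lambda>t. F t - c)" by (rule smooth_antideriv[OF d \<psi>])
    show "F s - c = - (LINT t|lborel. indicator {..t} s * \<psi> t)" for s by (rule key)
    show "F s - c = 0" if "s \<notin> {a..b}" for s
    proof (cases "s < a")
      case True
      have "(LINT t|lborel. indicator {..t} s * \<psi> t) = (LINT t|lborel. \<psi> t)"
        using 0 True by (intro Bochner_Integration.integral_cong) (auto simp: indicator_def)
      then show ?thesis using key[of s] int by simp
    next
      case False
      have "(LINT t|lborel. indicator {..t} s * \<psi> t) = (LINT t::real|lborel. 0)"
        using 0 False that by (intro Bochner_Integration.integral_cong) (auto simp: indicator_def)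
      then show ?thesis using key[of s] by simp
    qed
  qed
qed

section \<open>The du Bois-Reymond lemma with an initial condition\<close>

lemma bump_tendsto_1: "(bump \<longlongrightarrow> 1) at_top"
proof -
  have "((\<lambda>x::real. exp (- inverse x)) \<longlongrightarrow> exp (- 0)) at_top"
    by (intro tendsto_intros tendsto_inverse_0_at_top filterlim_ident)
  then have "((\<lambda>x::real. exp (- inverse x)) \<longlongrightarrow> 1) at_top" by simp
  then show ?thesis
    by (rule Lim_transform_eventually)
       (use eventually_gt_at_top[of 0] in \<open>auto elim!: eventually_mono simp: bump_eq inverse_eq_divide\<close>)
qed

lemma smooth_bump_affine: "smooth (\<lambda>t. bump (c * t + d))"
  by (intro smooth_compose[OF smooth_bump] smooth_add smooth_mult smooth_const smooth_ident)

text \<open>The test functions vanish near T but are free at time 0. This is why W is the primitive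
  itself and not the primitive plus a constant: the freedom at 0 encodes the zero initial
  value.\<close>

lemma du_Bois_Reymond:
  fixes W H :: "real \<Rightarrow> real"
  assumes T: "T > 0" and W: "integrable lborel W" and H: "integrable lborel H"
    and 0: "\<And>t. t \<notin> {0<..<T} \<Longrightarrow> W t = 0" "\<And>t. t \<notin> {0<..<T} \<Longrightarrow> H t = 0"
    and weak: "\<And>\<theta> \<theta>' c. smooth \<theta> \<Longrightarrow> (\<And>t. (\<theta> has_real_derivative \<theta>' t) (at t)) \<Longrightarrow> c < T \<Longrightarrow> 
      (\<And>t. t \<notin> {-1..c} \<Longrightarrow> \<theta> t = 0) \<Longrightarrow> (LINT t|lborel. \<theta>' t * W t) + (LINT t|lborel. \<theta> t * H t) = 0"
  shows "AE t in lborel. t \<in> {0<..<T} \<longrightarrow> W t = primitive H t"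
proof -
  have mH: "H \<in> borel_measurable borel" using H by auto
  define U where "U t = W t - indicator {0<..<T} t * primitive H t" for t
  have iT: "integrable lborel (indicator {0<..<T} :: real \<Rightarrow> real)"
    using T by (intro integrable_real_indicator) simp_all
  have iU2: "integrable lborel (\<lambda>t. indicator {0<..<T} t * primitive H t)"
    by (rule integrable_times_bounded[OF iT primitive_borel[OF mH] primitive_bound[OF H]])
  have iU: "integrable lborel U" unfolding U_def by (intro Bochner_Integration.integrable_diff W iU2)
  \<comment> \<open>A bump on (-1,0), invisible to W and H, which vanish there. It serves to correct
    the mean of a test function without changing its pairing.\<close>
  define \<psi>0 where "\<psi>0 t = bump (-1 * t + 0) * bump (1 * t + 1)" for t
  have s0: "smooth \<psi>0" unfolding \<psi>0_def by (intro smooth_mult smooth_bump_affine)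
  have z0: "\<psi>0 t = 0" if "t \<le> -1 \<or> 0 \<le> t" for t using that by (auto simp: \<psi>0_def bump_eq)
  have t0: "\<psi>0 \<in> test_functions" by (rule test_functionsI[OF s0, of "{-1..0}"]) (auto intro!: z0)
  have p0: "0 \<le> \<psi>0 t" for t unfolding \<psi>0_def by (intro mult_nonneg_nonneg bump_bounds)
  define c0 where "c0 = (LINT t|lborel. \<psi>0 t)"
  have c0: "c0 \<noteq> 0"
  proof
    assume "c0 = 0"
    then have "AE t in lborel. \<psi>0 t = 0"
      unfolding c0_def by (subst (asm) integral_nonneg_eq_0_iff_AE[OF test_integrable[OF t0]]) (auto simp: p0)
    then have "AE t in lborel. t \<notin> {-1<..<0::real}"
    proof eventually_elim
      case (elim t)
      have "\<psi>0 t > 0" if "-1 < t" "t < 0" unfolding \<psi>0_def using that by (intro mult_pos_pos bump_pos) auto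
      then show ?case using elim by force
    qed
    then have "emeasure lborel {-1<..<0::real} = 0" by (subst (asm) AE_iff_measurable[of "{-1<..<0}"]) auto
    then show False by simp
  qed
  have test: "(LINT t|lborel. \<psi> t * U t) = 0" 
    if \<psi>: "smooth \<psi>" and b: "0 \<le> b" "b < T" and z: "\<And>t. t \<le> 0 \<Longrightarrow> \<psi> t = 0" "\<And>t. b \<le> t \<Longrightarrow> \<psi> t = 0" for \<psi> b
  proof -
    have tpsi: "\<psi> \<in> test_functions"
    proof (rule test_functionsI[OF \<psi>, of "{0..b}"])
      show "\<psi> t = 0" if "t \<notin> {0..b}" for t using that z[of t] by force
    qed simp
    \<comment> \<open>The corrected function has mean 0 and so has a compactly supported
      antiderivative; on (0,T) it still equals \<open>\<psi>\<close>.\<close>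
    define \<psi>' where "\<psi>' t = \<psi> t - (LINT t|lborel. \<psi> t) / c0 * \<psi>0 t" for t
    have s': "smooth \<psi>'" unfolding \<psi>'_def by (intro smooth_diff smooth_mult smooth_const \<psi> s0)
    have i': "(LINT t|lborel. \<psi>' t) = 0"
      unfolding \<psi>'_def using test_integrable[OF tpsi] test_integrable[OF t0] c0 by (simp add: c0_def[symmetric])
    have "-1 \<le> b" using b by simp
    then obtain \<theta> where \<theta>: "smooth \<theta>" "\<And>t. (\<theta> has_real_derivative \<psi>' t) (at t)" "\<And>t. t \<notin> {-1..b} \<Longrightarrow> \<theta> t = 0"
      "\<And>s. \<theta> s = - (LINT t|lborel. indicator {..t} s * \<psi>' t)"
      using smooth_antiderivative_compact[OF s' _ _ _ i', of "-1" b] b z z0 by (auto simp: \<psi>'_def)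
    have 1: "(LINT t|lborel. \<psi>' t * W t) = (LINT t|lborel. \<psi> t * W t)"
    proof (intro Bochner_Integration.integral_cong refl)
      fix t show "\<psi>' t * W t = \<psi> t * W t" by (cases "t \<in> {0<..<T}") (auto simp: 0 \<psi>'_def z0)
    qed
    note J = integrable_triangle(1)[OF H test_integrable[OF tpsi]]
    have 2: "\<theta> s * H s = - (LINT t|lborel. indicator {..t} s * H s * \<psi> t)" for s
    proof (cases "s \<in> {0<..<T}")
      case True
      have "(LINT t|lborel. indicator {..t} s * \<psi>' t) = (LINT t|lborel. indicator {..t} s * \<psi> t)"
        using True by (intro Bochner_Integration.integral_cong) (auto simp: \<psi>'_def z0 indicator_def)
      moreover have "(LINT t|lborel. indicator {..t} s * H s * \<psi> t) = (LINT t|lborel. H s * (indicator {..t} s * \<psi> t))"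
        by (intro Bochner_Integration.integral_cong) auto
      ultimately show ?thesis by (simp add: \<theta>(4))
    qed (simp add: 0)
    have "(LINT s|lborel. \<theta> s * H s) = - (LINT s|lborel. LINT t|lborel. indicator {..t} s * H s * \<psi> t)"
      unfolding 2 by simp
    also have "\<dots> = - (LINT t|lborel. LINT s|lborel. indicator {..t} s * H s * \<psi> t)"
      using lborel_pair.Fubini_integral[OF J] by simp
    also have "\<dots> = - (LINT t|lborel. \<psi> t * (indicator {0<..<T} t * primitive H t))"
    proof -
      have "(LINT s|lborel. indicator {..t} s * H s * \<psi> t) = \<psi> t * (indicator {0<..<T} t * primitive H t)" for t
        using z(1)[of t] z(2)[of t] b by (cases "t \<in> {0<..<T}") (auto simp: primitive_def)
      then show ?thesis by presburger
    qed
    finally have 3: "(LINT s|lborel. \<theta> s * H s) = - (LINT t|lborel. \<psi> t * (indicator {0<..<T} t * primitive H t))" .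
    obtain B where B: "\<And>t. \<bar>\<psi> t\<bar> \<le> B" using test_bounded[OF tpsi] by metis
    have "(LINT t|lborel. \<psi> t * U t) = (LINT t|lborel. \<psi> t * W t) - (LINT t|lborel. \<psi> t * (indicator {0<..<T} t * primitive H t))"
      using integrable_times_bounded[OF W test_borel[OF tpsi] B] integrable_times_bounded[OF iU2 test_borel[OF tpsi] B]
      unfolding U_def right_diff_distrib by (intro Bochner_Integration.integral_diff) (simp_all add: mult.commute mult.left_commute)
    also have "\<dots> = (LINT t|lborel. \<psi>' t * W t) + (LINT s|lborel. \<theta> s * H s)" unfolding 1 3 by simp
    also have "\<dots> = 0" using weak[OF \<theta>(1,2) b(2) \<theta>(3)] by simp
    finally show ?thesis .
  qed
  have "(LINT t|lborel. indicator {x<..} t * U t) = 0" for x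
  proof -
    define a where "a = max x 0"
    \<comment> \<open>Smooth functions increasing to the indicator of (a,T) in the limit sense: the
      arguments are n(t - a) and n(T - t) - 1 with n replaced by \<open>Suc n\<close>. The
      subtracted 1 keeps the support away from T, as the weak identity requires.\<close>
    define \<psi> where "\<psi> n t = bump (real (Suc n) * t + (- real (Suc n) * a)) * bump (- real (Suc n) * t + (real (Suc n) * T - 1))" for n t
    have \<psi>s: "smooth (\<psi> n)" for n unfolding \<psi>_def by (intro smooth_mult smooth_bump_affine)
    have \<psi>b: "\<bar>\<psi> n t\<bar> \<le> 1" for n t
      unfolding \<psi>_def abs_mult using bump_bounds by (intro mult_le_one) (auto simp: abs_le_iff intro: order_trans[of _ 0])
    have \<psi>a: "\<psi> n t = 0" if "t \<le> a" for n t
    proof -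
      have "real (Suc n) * t \<le> real (Suc n) * a" by (intro mult_left_mono that) simp
      then have "bump (real (Suc n) * t + (- real (Suc n) * a)) = 0" unfolding bump_eq by (intro if_not_P) linarith
      then show ?thesis by (simp add: \<psi>_def)
    qed
    have \<psi>T: "\<psi> n t = 0" if "T - 1 / real (Suc n) \<le> t" for n t
    proof -
      have "real (Suc n) * (T - 1 / real (Suc n)) \<le> real (Suc n) * t" using that by (intro mult_left_mono) auto
      then have "- real (Suc n) * t + (real (Suc n) * T - 1) \<le> 0" by (simp add: right_diff_distrib del: of_nat_Suc)
      then have "bump (- real (Suc n) * t + (real (Suc n) * T - 1)) = 0" unfolding bump_eq by (intro if_not_P) linarith
      then show ?thesis by (simp add: \<psi>_def)
    qed
    have \<psi>0: "(LINT t|lborel. \<psi> n t * U t) = 0" for n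
    proof (rule test[OF \<psi>s, of "max 0 (T - 1 / real (Suc n))"])
      show "max 0 (T - 1 / real (Suc n)) < T" using T by simp
      show "\<psi> n t = 0" if "t \<le> 0" for t using that by (intro \<psi>a) (simp add: a_def le_max_iff_disj)
      show "\<psi> n t = 0" if "max 0 (T - 1 / real (Suc n)) \<le> t" for t using that by (intro \<psi>T) simp
    qed simp
    have lim: "(\<lambda>n. \<psi> n t * U t) \<longlonglongrightarrow> indicator {x<..} t * U t" for t
    proof (cases "t \<in> {0<..<T} \<and> a < t")
      case True
      have f: "filterlim (\<lambda>n. real (Suc n) * c + d) at_top sequentially" if "c > 0" for c d
      proof -
        have "filterlim (\<lambda>n. real (Suc n)) at_top sequentially"
          by (rule filterlim_compose[OF filterlim_real_sequentially filterlim_Suc])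
        then have "filterlim (\<lambda>n. c * real (Suc n)) at_top sequentially"
          by (rule filterlim_tendsto_pos_mult_at_top[OF tendsto_const that])
        from filterlim_tendsto_add_at_top[OF tendsto_const[of d] this] show ?thesis by (simp add: mult.commute add.commute)
      qed
      have "(\<lambda>n. bump (real (Suc n) * (t - a) + 0)) \<longlonglongrightarrow> 1" "(\<lambda>n. bump (real (Suc n) * (T - t) + (-1))) \<longlonglongrightarrow> 1"
        using True by (intro filterlim_compose[OF bump_tendsto_1] f; simp)+
      from tendsto_mult[OF this] have "(\<lambda>n. \<psi> n t) \<longlonglongrightarrow> 1"
        by (simp add: \<psi>_def algebra_simps)
      from tendsto_mult[OF this tendsto_const[of "U t"]] show ?thesis using True by (simp add: indicator_def a_def)
    next
      case False
      then have "U t = 0 \<or> (t \<le> a \<and> \<not> x < t)" by (auto simp: U_def 0 a_def indicator_def)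
      then show ?thesis using \<psi>a by auto
    qed
    have "(\<lambda>n. LINT t|lborel. \<psi> n t * U t) \<longlonglongrightarrow> (LINT t|lborel. indicator {x<..} t * U t)"
    proof (rule integral_dominated_convergence[where w="\<lambda>t. \<bar>U t\<bar>"])
      show "AE t in lborel. norm (\<psi> n t * U t) \<le> \<bar>U t\<bar>" for n
        using \<psi>b by (intro AE_I2) (simp add: abs_mult mult_left_le_one_le)
      show "(\<lambda>t. \<psi> n t * U t) \<in> borel_measurable lborel" for n
        using iU smooth_borel[OF \<psi>s] by (intro borel_measurable_times) auto
      show "(\<lambda>t. indicator {x<..} t * U t) \<in> borel_measurable lborel"
        using iU by (intro borel_measurable_times) auto
    qed (use iU lim in auto)
    then show ?thesis unfolding \<psi>0 by (simp add: LIMSEQ_const_iff)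
  qed
  from AE_eq_0_of_integrals[OF iU this] show ?thesis
    by eventually_elim (auto simp: U_def indicator_def)
qed

section \<open>The energy identity\<close>

lemma partial_deriv_reflect:
  fixes f :: "'a::euclidean_space \<Rightarrow> real"
  assumes "smooth f"
  shows "partial_deriv e (\<lambda>y. f (x - y)) y = - partial_deriv e f (x - y)"
proof -
  have d: "f differentiable (at (- y + x))" by (rule smooth_differentiable[OF assms])
  interpret linear "frechet_derivative f (at (- y + x))" using d by (rule linear_frechet_derivative)
  have "partial_deriv e (\<lambda>y. f (- y + x)) y = frechet_derivative f (at (- y + x)) (- e)"
    by (rule partial_deriv_eq[OF partial_deriv_affine(1)[OF bounded_linear_minus[OF bounded_linear_ident] d]])
  then show ?thesis using neg[of e] by (simp add: partial_deriv_def)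
qed

lemma partial_deriv_fst:
  fixes F :: "real \<times> 'a::euclidean_space \<Rightarrow> real"
  assumes "smooth F"
  shows "partial_deriv (1, 0) F (s, x) = deriv (\<lambda>s. F (s, x)) s"
proof -
  have "((\<lambda>s. (s, x)) has_derivative (\<lambda>v. (v, 0))) (at s)"
    by (auto intro!: derivative_eq_intros)
  from has_derivative_compose[OF this frechet_has[OF smooth_differentiable[OF assms]]]
  have d: "((\<lambda>s. F (s, x)) has_derivative (\<lambda>v. frechet_derivative F (at (s, x)) (v, 0))) (at s)" .
  then have "(\<lambda>s. F (s, x)) differentiable (at s)" by (auto simp: differentiable_def)
  from DERIV_imp_deriv[OF deriv_has_real[OF this]]
  show ?thesis using partial_deriv_eq[OF d] by (simp add: partial_deriv_def)
qed

text \<open>Testing with a time function times the kernel reflected at x freezes x: the equation on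
  space-time turns into a scalar equation in time for the convolution at x. The lower end -1 leaves
  the time function free at 0.\<close>

lemma tensor_test_function:
  fixes k :: "'a::euclidean_space \<Rightarrow> real"
  assumes \<theta>: "smooth \<theta>" and c: "c < T" and 0: "\<And>t. t \<notin> {-1..c} \<Longrightarrow> \<theta> t = 0" and k: "k \<in> test_functions"
  shows "(\<lambda>p. \<theta> (fst p) * k (x - snd p)) \<in> test_functions_upto T"
proof -
  obtain K where K: "compact K" "\<And>y. y \<notin> K \<Longrightarrow> k (x - y) = 0"
    using test_functionsE[OF test_reflect[OF k, of x]] by metis
  have s1: "smooth (\<lambda>p::real \<times> 'a. \<theta> (fst p))" using smooth_affine[OF bounded_linear_fst \<theta>, of 0] by simp
  have s2: "smooth (\<lambda>p::real \<times> 'a. k (x - snd p))"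
    using smooth_affine[OF bounded_linear_minus[OF bounded_linear_snd] test_smooth[OF k], of x] by simp
  have cK: "compact ({-1..c} \<times> K)" by (intro compact_Times K) simp
  have z: "\<theta> (fst p) * k (x - snd p) = 0" if "p \<notin> {-1..c} \<times> K" for p
    using that 0 K(2) by (cases p) auto
  have "closure {p. \<theta> (fst p) * k (x - snd p) \<noteq> 0} \<subseteq> {-1..c} \<times> K"
    using z cK by (intro closure_minimal) (auto dest: compact_imp_closed simp del: mult_eq_0_iff)
  also have "\<dots> \<subseteq> {..<T} \<times> UNIV" using c by auto
  finally show ?thesis
    using test_functionsI[OF smooth_mult[OF s1 s2] cK z] by (simp add: test_functions_upto_def)
qed

lemma square_integrable_test:
  "k \<in> test_functions \<Longrightarrow> square_integrable lborel k"
  using test_integrable[OF test_mult[OF test_smooth, of k k]] test_borel[of k]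
  by (simp add: square_integrable_def power2_eq_square)

text \<open>Valid at every x and not just at almost every one, because the kernel is a test function
  and the reflected kernel, restricted to the bounded time interval, is square integrable on
  space-time.\<close>

lemma xconv_slice:
  fixes v :: "real \<times> 'a::euclidean_space \<Rightarrow> real"
  assumes v: "square_integrable lborel v" and v0: "\<forall>p. fst p \<notin> {0<..<T} \<longrightarrow> v p = 0" and T: "T > 0"
    and k: "k \<in> test_functions"
  shows "integrable lborel (\<lambda>t. xconv k v (t, x))"
    and "m \<in> borel_measurable borel \<Longrightarrow> (\<And>t. \<bar>m t\<bar> \<le> B) \<Longrightarrow> integrable lborel (\<lambda>p. m (fst p) * k (x - snd p) * v p)"
    and "m \<in> borel_measurable borel \<Longrightarrow> (\<And>t. \<bar>m t\<bar> \<le> B) \<Longrightarrow> 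
      (LINT p|lborel. m (fst p) * k (x - snd p) * v p) = (LINT t|lborel. m t * xconv k v (t, x))"
proof -
  have mv: "v \<in> borel_measurable borel" using square_integrableD(1)[OF v] by simp
  note kx = test_reflect[OF k, of x]
  have eq: "xconv k v (t, x) = (LINT y|lborel. k (x - y) * v (t, y))" for t
  proof -
    have "(\<lambda>y. k y * v ((t, x) - (0, y))) \<in> borel_measurable borel"
      by (intro borel_measurable_times test_borel[OF k] borel_measurable_compose_continuous[OF mv] continuous_intros)
    from integral_lborel_reflect[OF this, of x] show ?thesis by (simp add: xconv_def)
  qed
  have I: "integrable lborel (\<lambda>p. m (fst p) * k (x - snd p) * v p)"
    if m: "m \<in> borel_measurable borel" and B: "\<And>t. \<bar>m t\<bar> \<le> B" for m B
  proof -
    \<comment> \<open>The indicator changes nothing in the product, since v vanishes outside the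
      interval, but it makes a merely bounded time factor square integrable.\<close>
    define w where "w p = indicator {0<..<T} (fst p) * m (fst p) * k (x - snd p)" for p :: "real \<times> 'a"
    have mw: "w \<in> borel_measurable borel"
    proof -
      have "(\<lambda>t. indicator {0<..<T} t * m t) \<in> borel_measurable borel" using m by measurable
      then show ?thesis unfolding w_def
        by (intro borel_measurable_times[of "\<lambda>p. indicator {0<..<T} (fst p) * m (fst p)"] 
            borel_measurable_compose_continuous[OF _ continuous_on_fst[OF continuous_on_id], of "\<lambda>t. indicator {0<..<T} t * m t"]
            borel_measurable_compose_continuous[OF test_borel[OF kx] continuous_on_snd[OF continuous_on_id]])
    qed
    have iT: "integrable lborel (indicator {0<..<T} :: real \<Rightarrow> real)"
      using T by (intro integrable_real_indicator) simp_all
    have "\<bar>(m t)\<^sup>2\<bar> \<le> B\<^sup>2" for t using power_mono[OF B[of t], of 2] by simp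
    then have "integrable lborel (\<lambda>t. indicator {0<..<T} t * (m t)\<^sup>2)"
      using m by (intro integrable_times_bounded[OF iT, of _ "B\<^sup>2"]) auto
    from integrable_pair_mult[OF this square_integrableD(2)[OF square_integrable_test[OF kx]]]
    have "integrable lborel (\<lambda>p. (w p)\<^sup>2)"
      unfolding lborel_prod w_def by (simp add: case_prod_unfold power_mult_distrib power2_eq_square[of "indicator A x" for A x] mult_indicator_subset)
    then have "square_integrable lborel w" using mw by (simp add: square_integrable_def)
    from square_integrable_mult_integrable[OF this v]
    have "integrable lborel (\<lambda>p. w p * v p)" .
    moreover have "w p * v p = m (fst p) * k (x - snd p) * v p" for p
      using v0[rule_format, of p] by (cases "fst p \<in> {0<..<T}") (auto simp: w_def)
    ultimately show ?thesis by simp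
  qed
  then show "m \<in> borel_measurable borel \<Longrightarrow> (\<And>t. \<bar>m t\<bar> \<le> B) \<Longrightarrow> integrable lborel (\<lambda>p. m (fst p) * k (x - snd p) * v p)" .
  have J: "integrable (lborel \<Otimes>\<^sub>M lborel) (\<lambda>(t, y). m t * k (x - y) * v (t, y))"
    if "m \<in> borel_measurable borel" and "\<And>t. \<bar>m t\<bar> \<le> B" for m B
    using I[OF that] unfolding lborel_prod by (simp add: case_prod_unfold)
  have "integrable lborel (\<lambda>t. LINT y|lborel. 1 * k (x - y) * v (t, y))"
    by (rule lborel_pair.integrable_fst[OF J[of "\<lambda>_. 1" 1]]) simp_all
  then show "integrable lborel (\<lambda>t. xconv k v (t, x))" unfolding eq by simp
  assume m: "m \<in> borel_measurable borel" "\<And>t. \<bar>m t\<bar> \<le> B"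
  have "(LINT p|lborel. m (fst p) * k (x - snd p) * v p) = (LINT t|lborel. LINT y|lborel. m t * k (x - y) * v (t, y))"
    using lborel_pair.integral_fst[OF J[OF m]] unfolding lborel_prod by (simp add: case_prod_unfold)
  also have "\<dots> = (LINT t|lborel. m t * xconv k v (t, x))"
    unfolding eq by (simp add: mult.assoc)
  finally show "(LINT p|lborel. m (fst p) * k (x - snd p) * v p) = (LINT t|lborel. m t * xconv k v (t, x))" .
qed

text \<open>The convolution of k with \<Delta>f - div g, all derivatives being placed on the kernel;
  that is, the time derivative of the convolution of k with z.\<close>

definition xconv_flux ::
  "('a::euclidean_space \<Rightarrow> real) \<Rightarrow> (real \<times> 'a \<Rightarrow> real) \<Rightarrow> ('a \<Rightarrow> real \<times> 'a \<Rightarrow> real) \<Rightarrow> real \<times> 'a \<Rightarrow> real" where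
  "xconv_flux k f g p = (\<Sum>e\<in>Basis. xconv (partial_deriv e (partial_deriv e k)) f p) - (\<Sum>e\<in>Basis. xconv (partial_deriv e k) (g e) p)"

lemma xconv_laplacian:
  assumes k: "k \<in> test_functions" and u: "square_integrable lborel u"
  shows "AE p in lborel. xconv (laplacian k) u p = (\<Sum>e\<in>Basis. xconv (partial_deriv e (partial_deriv e k)) u p)"
  unfolding laplacian_def[abs_def]
  by (rule xconv_sum_kernel) (auto intro!: test_integrable test_partial_deriv k u)

text \<open>Two partial integrations in each direction; the two signs cancel.\<close>

lemma xconv_laplacian_symmetric:
  assumes k: "k \<in> test_functions" and l: "l \<in> test_functions"
    and u: "square_integrable lborel u" and v: "square_integrable lborel v"
  shows "(LINT p|lborel. (\<Sum>e\<in>Basis. xconv (partial_deriv e (partial_deriv e k)) u p) * xconv l v p) =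
    (LINT p|lborel. xconv k u p * (\<Sum>e\<in>Basis. xconv (partial_deriv e (partial_deriv e l)) v p))"
proof -
  note t = test_partial_deriv k l
  have i: "integrable lborel (\<lambda>p. xconv a u p * xconv b v p)" if "a \<in> test_functions" "b \<in> test_functions" for a b
    using that by (intro square_integrable_mult_integrable square_integrable_xconv test_integrable u v)
  have "(LINT p|lborel. (\<Sum>e\<in>Basis. xconv (partial_deriv e (partial_deriv e k)) u p) * xconv l v p) =
    (\<Sum>e\<in>Basis. LINT p|lborel. xconv (partial_deriv e (partial_deriv e k)) u p * xconv l v p)"
    unfolding sum_distrib_right by (rule Bochner_Integration.integral_sum) (intro i t)
  also have "\<dots> = (\<Sum>e\<in>Basis. LINT p|lborel. xconv k u p * xconv (partial_deriv e (partial_deriv e l)) v p)"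
    by (intro sum.cong refl) (simp add: xconv_partial_integration t u v)
  also have "\<dots> = (LINT p|lborel. xconv k u p * (\<Sum>e\<in>Basis. xconv (partial_deriv e (partial_deriv e l)) v p))"
    unfolding sum_distrib_left by (rule Bochner_Integration.integral_sum[symmetric]) (intro i t)
  finally show ?thesis .
qed

lemma even_partial_deriv:
  assumes k: "smooth k" and ev: "\<And>x. k (- x) = k x" and e: "e \<in> Basis"
  shows "partial_deriv e k (- x) = - partial_deriv e k x"
    and "partial_deriv e (partial_deriv e k) (- x) = partial_deriv e (partial_deriv e k) x"
proof -
  have 1: "partial_deriv e k (- x) = - partial_deriv e k x" for x
    using partial_deriv_reflect[OF k, of e 0 x] ev by simp
  show "partial_deriv e k (- x) = - partial_deriv e k x" by (rule 1)
  have "partial_deriv e (\<lambda>y. - partial_deriv e k y) x = - partial_deriv e (partial_deriv e k) x"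
    using partial_deriv_cmult[OF smooth_differentiable[OF smooth_partial_deriv[OF k e]], of e "-1" x] by simp
  then show "partial_deriv e (partial_deriv e k) (- x) = partial_deriv e (partial_deriv e k) x"
    using partial_deriv_reflect[OF smooth_partial_deriv[OF k e], of e 0 x] 1 by simp
qed

section \<open>Time weights and pairings on space-time\<close>

lemma integrable_time_weight:
  fixes h :: "real \<times> 'a::euclidean_space \<Rightarrow> real"
  assumes h: "integrable lborel h" and m: "m \<in> borel_measurable borel" and B: "\<And>t. \<bar>m t\<bar> \<le> B"
  shows "integrable lborel (\<lambda>p. m (fst p) * h p)"
proof -
  have "(\<lambda>p::real \<times> 'a. m (fst p)) \<in> borel_measurable borel"
    by (intro borel_measurable_compose_continuous[OF m] continuous_intros)
  from integrable_times_bounded[OF h this B] show ?thesis by (simp add: mult.commute)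
qed

lemma square_integrable_time_weight:
  fixes h :: "real \<times> 'a::euclidean_space \<Rightarrow> real"
  assumes h: "square_integrable lborel h" and m: "m \<in> borel_measurable borel" and B: "\<And>t. \<bar>m t\<bar> \<le> B"
  shows "square_integrable lborel (\<lambda>p. m (fst p) * h p)"
proof (rule square_integrable_bound[OF h])
  have "(\<lambda>p::real \<times> 'a. m (fst p)) \<in> borel_measurable borel"
    by (intro borel_measurable_compose_continuous[OF m] continuous_intros)
  then show "(\<lambda>p. m (fst p) * h p) \<in> borel_measurable lborel" using square_integrableD(1)[OF h] by auto
  show "AE p in lborel. \<bar>m (fst p) * h p\<bar> \<le> B * \<bar>h p\<bar>"
    by (intro AE_I2) (simp add: abs_mult B mult_right_mono)
qed

definition exp_weight :: "real \<Rightarrow> real \<Rightarrow> real \<Rightarrow> real" where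
  "exp_weight l T t = indicator {0..T} t * exp (- l * t)"

text \<open>The tail of the exponential weight, set to 0 off (0,T): beyond T the formula would turn
  negative, and for times going to minus infinity it would be unbounded.\<close>

definition int_weight :: "real \<Rightarrow> real \<Rightarrow> real \<Rightarrow> real" where
  "int_weight l T t = indicator {0<..<T} t * tail_weight l T t"

lemma weights:
  assumes l: "l > 0"
  shows "exp_weight l T \<in> borel_measurable borel" "int_weight l T \<in> borel_measurable borel"
    and "0 \<le> exp_weight l T t" "\<bar>exp_weight l T t\<bar> \<le> 1"
    and "0 \<le> int_weight l T t" "int_weight l T t \<le> exp_weight l T t / l" "\<bar>int_weight l T t\<bar> \<le> 1 / l"
proof -
  show "exp_weight l T \<in> borel_measurable borel" unfolding exp_weight_def[abs_def] by measurable
  show "int_weight l T \<in> borel_measurable borel" unfolding int_weight_def[abs_def] tail_weight_def by measurable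
  show e0: "0 \<le> exp_weight l T t" by (simp add: exp_weight_def)
  show e1: "\<bar>exp_weight l T t\<bar> \<le> 1" using l by (simp add: exp_weight_def indicator_def)
  show i0: "0 \<le> int_weight l T t" using l by (simp add: int_weight_def tail_weight_def indicator_def)
  show i1: "int_weight l T t \<le> exp_weight l T t / l"
    using l by (simp add: int_weight_def exp_weight_def tail_weight_def indicator_def divide_right_mono)
  have "exp_weight l T t / l \<le> 1 / l" using e1 l by (intro divide_right_mono) auto
  then show "\<bar>int_weight l T t\<bar> \<le> 1 / l" using i0 i1 by linarith
qed

abbreviation ip :: "('b::euclidean_space \<Rightarrow> real) \<Rightarrow> ('b \<Rightarrow> real) \<Rightarrow> real" where
  "ip u v \<equiv> LINT p|lborel. u p * v p"

abbreviation L2b :: "('b::euclidean_space \<Rightarrow> real) \<Rightarrow> bool" where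
  "L2b \<equiv> square_integrable lborel"

lemma ip_commute: "ip u v = ip v u"
  by (simp add: mult.commute)

lemma ip_diff_right: "L2b u \<Longrightarrow> L2b v \<Longrightarrow> L2b w \<Longrightarrow> ip u (\<lambda>p. v p - w p) = ip u v - ip u w"
  unfolding right_diff_distrib
  by (intro Bochner_Integration.integral_diff square_integrable_mult_integrable)

lemma ip_sum_right: "L2b u \<Longrightarrow> (\<And>i. i \<in> I \<Longrightarrow> L2b (v i)) \<Longrightarrow> ip u (\<lambda>p. \<Sum>i\<in>I. v i p) = (\<Sum>i\<in>I. ip u (v i))"
  unfolding sum_distrib_left
  by (intro Bochner_Integration.integral_sum square_integrable_mult_integrable)

lemma ip_cong_right: "L2b u \<Longrightarrow> L2b v \<Longrightarrow> L2b w \<Longrightarrow> (AE p in lborel. v p = w p) \<Longrightarrow> ip u v = ip u w"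
  by (rule integral_cong_AE) (auto dest!: square_integrableD(1))

lemma xconv_swap_even:
  assumes k: "integrable lborel k" and l: "integrable lborel l" and u: "L2b u" and v: "L2b v"
    and ev: "\<And>y. k (- y) = k y" "\<And>y. l (- y) = l y"
  shows "ip (xconv k u) (xconv l v) = ip (xconv l u) (xconv k v)"
  using xconv_swap[OF k l u v] by (simp add: ev)

lemma xconv_uminus: "xconv (\<lambda>y. - k y) u = (\<lambda>p. - xconv k u p)"
  by (simp add: xconv_def fun_eq_iff)

text \<open>The case of an even kernel against a first derivative of an even one, where the
  reflection leaves one sign behind.\<close>

lemma xconv_swap_odd:
  assumes k: "integrable lborel k" and l: "integrable lborel l" and u: "L2b u" and v: "L2b v"
    and ev: "\<And>y. k (- y) = k y" "\<And>y. l (- y) = - l y"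
  shows "ip (xconv k u) (xconv l v) = - ip (xconv l u) (xconv k v)"
  using xconv_swap[OF k l u v] by (simp add: ev xconv_uminus)

lemma xconv_resolvent_kernel:
  assumes k: "k \<in> test_functions" and v: "L2b v"
  shows "AE p in lborel. xconv (\<lambda>x. k x - laplacian k x) v p = xconv k v p - (\<Sum>e\<in>Basis. xconv (partial_deriv e (partial_deriv e k)) v p)"
  using xconv_diff_kernel[OF test_integrable[OF k] test_integrable[OF test_laplacian[OF k]] v] xconv_laplacian[OF k v]
  by eventually_elim simp

lemma L2b_xconv: "k \<in> test_functions \<Longrightarrow> L2b u \<Longrightarrow> L2b (xconv k u)"
  by (intro square_integrable_xconv test_integrable)

text \<open>The right-hand side is the H^1 pairing of two convolutions with k, a regularised H^-1
  pairing of u and v. Writing it with a single pairing lets the product rule in time act on two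
  functions only.\<close>

lemma ip_xconv_resolvent:
  assumes k: "k \<in> test_functions" and u: "L2b u" and v: "L2b v"
  shows "ip (xconv k u) (xconv (\<lambda>x. k x - laplacian k x) v) =
     ip (xconv k u) (xconv k v) + (\<Sum>e\<in>Basis. ip (xconv (partial_deriv e k) u) (xconv (partial_deriv e k) v))"
proof -
  note t = test_partial_deriv k test_diff test_laplacian
  have "ip (xconv k u) (xconv (\<lambda>x. k x - laplacian k x) v) =
    ip (xconv k u) (\<lambda>p. xconv k v p - (\<Sum>e\<in>Basis. xconv (partial_deriv e (partial_deriv e k)) v p))"
    by (intro ip_cong_right L2b_xconv square_integrable_diff square_integrable_sum t u v xconv_resolvent_kernel)
  also have "\<dots> = ip (xconv k u) (xconv k v) - ip (xconv k u) (\<lambda>p. \<Sum>e\<in>Basis. xconv (partial_deriv e (partial_deriv e k)) v p)"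
    by (intro ip_diff_right L2b_xconv square_integrable_sum t u v)
  also have "ip (xconv k u) (\<lambda>p. \<Sum>e\<in>Basis. xconv (partial_deriv e (partial_deriv e k)) v p) =
     (\<Sum>e\<in>Basis. ip (xconv k u) (xconv (partial_deriv e (partial_deriv e k)) v))"
    by (intro ip_sum_right L2b_xconv square_integrable_sum t u v)
  also have "(\<Sum>e\<in>Basis. ip (xconv k u) (xconv (partial_deriv e (partial_deriv e k)) v)) =
     (\<Sum>e\<in>Basis. - ip (xconv (partial_deriv e k) u) (xconv (partial_deriv e k) v))"
    by (intro sum.cong refl) (simp add: xconv_partial_integration t u v)
  finally show ?thesis by (simp add: sum_negf)
qed

text \<open>The equation z_t = \<Delta>f - div g with f and g as independent data; their relation to
  z enters only through the pointwise bounds of the final estimates. Everything is extended by 0 in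
  time to work on the whole space-time, and since test functions need not vanish at time 0, an
  identity without an initial term means zero initial datum.\<close>

locale weak_flux_equation =
  fixes T :: real and z f :: "real \<times> 'a::euclidean_space \<Rightarrow> real" and g :: "'a \<Rightarrow> real \<times> 'a \<Rightarrow> real"
  assumes T: "T > 0" and z: "L2b z" and f: "L2b f" and g: "\<And>e. e \<in> Basis \<Longrightarrow> L2b (g e)"
    and z0: "\<And>p. fst p \<notin> {0<..<T} \<Longrightarrow> z p = 0" and f0: "\<And>p. fst p \<notin> {0<..<T} \<Longrightarrow> f p = 0"
    and g0: "\<And>e p. e \<in> Basis \<Longrightarrow> fst p \<notin> {0<..<T} \<Longrightarrow> g e p = 0"
    and weak: "\<And>\<phi>. \<phi> \<in> test_functions_upto T \<Longrightarrow>
      (LINT p|lborel. partial_deriv (1, 0) \<phi> p * z p + (\<Sum>e\<in>Basis. partial_deriv (0, e) (partial_deriv (0, e) \<phi>) p * f p) +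
         (\<Sum>e\<in>Basis. partial_deriv (0, e) \<phi> p * g e p)) = 0"
begin

lemma L2b_xconv_flux: "k \<in> test_functions \<Longrightarrow> L2b (xconv_flux k f g)"
  unfolding xconv_flux_def[abs_def]
  by (intro square_integrable_diff square_integrable_sum L2b_xconv test_partial_deriv f g)

text \<open>At each fixed x the weak equation is a scalar one in time, and the lemma of du
  Bois-Reymond type applies with the flux as derivative.\<close>

lemma slice_primitive:
  assumes k: "k \<in> test_functions"
  shows "integrable lborel (\<lambda>t. xconv_flux k f g (t, x))"
    and "AE t in lborel. t \<in> {0<..<T} \<longrightarrow> xconv k z (t, x) = primitive (\<lambda>t. xconv_flux k f g (t, x)) t"
proof -
  note tk = test_partial_deriv k
  have v0: "\<forall>p. fst p \<notin> {0<..<T} \<longrightarrow> z p = 0" "\<forall>p. fst p \<notin> {0<..<T} \<longrightarrow> f p = 0"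
    "\<And>e. e \<in> Basis \<Longrightarrow> \<forall>p. fst p \<notin> {0<..<T} \<longrightarrow> g e p = 0" using z0 f0 g0 by auto
  note sz = xconv_slice[OF z v0(1) T] and sf = xconv_slice[OF f v0(2) T] and sg = xconv_slice[OF g v0(3) T]
  show iF: "integrable lborel (\<lambda>t. xconv_flux k f g (t, x))"
    unfolding xconv_flux_def
    by (intro Bochner_Integration.integrable_diff Bochner_Integration.integrable_sum sf(1) sg(1) tk)
  show "AE t in lborel. t \<in> {0<..<T} \<longrightarrow> xconv k z (t, x) = primitive (\<lambda>t. xconv_flux k f g (t, x)) t"
  proof (rule du_Bois_Reymond[OF T sz(1)[OF k] iF])
    show "xconv k z (t, x) = 0" if "t \<notin> {0<..<T}" for t using that z0 by (simp add: xconv_def)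
    show "xconv_flux k f g (t, x) = 0" if "t \<notin> {0<..<T}" for t
      using that f0 g0 by (simp add: xconv_flux_def xconv_def)
    fix \<theta> \<theta>' :: "real \<Rightarrow> real" and c
    assume \<theta>: "smooth \<theta>" "\<And>t. (\<theta> has_real_derivative \<theta>' t) (at t)" "c < T" "\<And>t. t \<notin> {-1..c} \<Longrightarrow> \<theta> t = 0"
    have tt: "\<theta> \<in> test_functions" by (rule test_functionsI[OF \<theta>(1), of "{-1..c}"]) (use \<theta>(4) in auto)
    have \<theta>': "partial_deriv 1 \<theta> = \<theta>'" using partial_deriv_real[OF \<theta>(2), of 1] by auto
    have tt': "\<theta>' \<in> test_functions" using test_partial_deriv[OF tt, of 1] by (simp add: \<theta>')
    obtain B where B: "\<And>t. \<bar>\<theta> t\<bar> \<le> B" using test_bounded[OF tt] by metis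
    obtain B' where B': "\<And>t. \<bar>\<theta>' t\<bar> \<le> B'" using test_bounded[OF tt'] by metis
    note m = test_borel[OF tt] test_borel[OF tt']
    define \<phi> where "\<phi> p = \<theta> (fst p) * k (x - snd p)" for p :: "real \<times> 'a"
    have \<phi>: "\<phi> \<in> test_functions_upto T" unfolding \<phi>_def by (rule tensor_test_function[OF \<theta>(1,3,4) k])
    then have s\<phi>: "smooth \<phi>" by (auto simp: test_functions_upto_def test_smooth)
    have B2: "(0, e) \<in> Basis" if "e \<in> Basis" for e :: 'a using that by (simp add: Basis_prod_def)
    have d1: "partial_deriv (1, 0) \<phi> p = \<theta>' (fst p) * k (x - snd p)" for p
    proof -
      have "((\<lambda>s. \<theta> s * k (x - snd p)) has_real_derivative \<theta>' (fst p) * k (x - snd p)) (at (fst p))"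
        using \<theta>(2)[of "fst p"] by (auto intro!: derivative_eq_intros)
      from DERIV_imp_deriv[OF this] show ?thesis
        using partial_deriv_fst[OF s\<phi>, of "fst p" "snd p"] by (simp add: \<phi>_def)
    qed
    have cm: "partial_deriv e (\<lambda>y. a * h (x - y)) y = - (a * partial_deriv e h (x - y))"
      if h: "h \<in> test_functions" for h :: "'a \<Rightarrow> real" and a y e
      using partial_deriv_cmult[OF smooth_differentiable[OF test_smooth[OF test_reflect[OF h, of x]]], of e a y]
        partial_deriv_reflect[OF test_smooth[OF h], of e x y] by simp
    have d2: "partial_deriv (0, e) \<phi> = (\<lambda>p. - \<theta> (fst p) * partial_deriv e k (x - snd p))" for e
    proof
      fix p
      show "partial_deriv (0, e) \<phi> p = - \<theta> (fst p) * partial_deriv e k (x - snd p)"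
        using partial_deriv_snd[OF s\<phi>, of e "fst p" "snd p"] cm[OF k, of e "\<theta> (fst p)" "snd p"] by (simp add: \<phi>_def)
    qed
    have d3: "partial_deriv (0, e) (partial_deriv (0, e) \<phi>) p = \<theta> (fst p) * partial_deriv e (partial_deriv e k) (x - snd p)"
      if e: "e \<in> Basis" for e p
      using partial_deriv_snd[OF smooth_partial_deriv[OF s\<phi> B2[OF e]], of e "fst p" "snd p"]
        cm[OF tk(1)[OF k e], of e "- \<theta> (fst p)" "snd p"] by (simp add: d2)
    \<comment> \<open>Differentiating in the variable y of k(x - y) changes the sign of the
      first-order term and leaves the second-order one; this produces the minus sign in
      \<open>xconv_flux\<close>.\<close>
    have "0 = (LINT p|lborel. \<theta>' (fst p) * k (x - snd p) * z p + 
        (\<Sum>e\<in>Basis. \<theta> (fst p) * partial_deriv e (partial_deriv e k) (x - snd p) * f p) -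
        (\<Sum>e\<in>Basis. \<theta> (fst p) * partial_deriv e k (x - snd p) * g e p))"
    proof (rule trans[OF weak[OF \<phi>, symmetric]], rule Bochner_Integration.integral_cong[OF refl])
      fix p
      have "(\<Sum>e\<in>Basis. partial_deriv (0, e) (partial_deriv (0, e) \<phi>) p * f p) =
        (\<Sum>e\<in>Basis. \<theta> (fst p) * partial_deriv e (partial_deriv e k) (x - snd p) * f p)"
        by (intro sum.cong refl) (simp only: d3)
      moreover have "(\<Sum>e\<in>Basis. partial_deriv (0, e) \<phi> p * g e p) = - (\<Sum>e\<in>Basis. \<theta> (fst p) * partial_deriv e k (x - snd p) * g e p)"
        by (simp add: d2 sum_negf)
      ultimately show "partial_deriv (1, 0) \<phi> p * z p + (\<Sum>e\<in>Basis. partial_deriv (0, e) (partial_deriv (0, e) \<phi>) p * f p) +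
         (\<Sum>e\<in>Basis. partial_deriv (0, e) \<phi> p * g e p) = 
        \<theta>' (fst p) * k (x - snd p) * z p + 
        (\<Sum>e\<in>Basis. \<theta> (fst p) * partial_deriv e (partial_deriv e k) (x - snd p) * f p) -
        (\<Sum>e\<in>Basis. \<theta> (fst p) * partial_deriv e k (x - snd p) * g e p)"
        by (simp only: d1)
    qed
    also have "\<dots> = (LINT t|lborel. \<theta>' t * xconv k z (t, x)) + 
        ((\<Sum>e\<in>Basis. LINT t|lborel. \<theta> t * xconv (partial_deriv e (partial_deriv e k)) f (t, x)) -
        (\<Sum>e\<in>Basis. LINT t|lborel. \<theta> t * xconv (partial_deriv e k) (g e) (t, x)))"
    proof -
      have tke: "partial_deriv e k \<in> test_functions" "partial_deriv e (partial_deriv e k) \<in> test_functions" if "e \<in> Basis" for e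
        using that by (intro tk; assumption)+
      have i: "integrable lborel (\<lambda>p. \<theta>' (fst p) * k (x - snd p) * z p)"
        by (rule sz(2)[OF k m(2) B'])
      have i1: "integrable lborel (\<lambda>p. \<theta> (fst p) * partial_deriv e (partial_deriv e k) (x - snd p) * f p)" if "e \<in> Basis" for e
        by (rule sf(2)[OF tke(2)[OF that] m(1) B])
      have i2: "integrable lborel (\<lambda>p. \<theta> (fst p) * partial_deriv e k (x - snd p) * g e p)" if "e \<in> Basis" for e
        by (rule sg(2)[OF that that tke(1)[OF that] m(1) B])
      have s1: "(LINT p|lborel. (\<Sum>e\<in>Basis. \<theta> (fst p) * partial_deriv e (partial_deriv e k) (x - snd p) * f p)) =
        (\<Sum>e\<in>Basis. LINT t|lborel. \<theta> t * xconv (partial_deriv e (partial_deriv e k)) f (t, x))"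
      proof (subst Bochner_Integration.integral_sum)
        show "(\<Sum>e\<in>Basis. LINT p|lborel. \<theta> (fst p) * partial_deriv e (partial_deriv e k) (x - snd p) * f p) =
          (\<Sum>e\<in>Basis. LINT t|lborel. \<theta> t * xconv (partial_deriv e (partial_deriv e k)) f (t, x))"
          by (intro sum.cong refl sf(3)[OF tke(2) m(1) B])
      qed (rule i1)
      have s2: "(LINT p|lborel. (\<Sum>e\<in>Basis. \<theta> (fst p) * partial_deriv e k (x - snd p) * g e p)) =
        (\<Sum>e\<in>Basis. LINT t|lborel. \<theta> t * xconv (partial_deriv e k) (g e) (t, x))"
      proof (subst Bochner_Integration.integral_sum)
        show "(\<Sum>e\<in>Basis. LINT p|lborel. \<theta> (fst p) * partial_deriv e k (x - snd p) * g e p) =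
          (\<Sum>e\<in>Basis. LINT t|lborel. \<theta> t * xconv (partial_deriv e k) (g e) (t, x))"
          by (intro sum.cong refl sg(3)[OF _ _ tke(1) m(1) B])
      qed (rule i2)
      show ?thesis
        unfolding s1[symmetric] s2[symmetric] sz(3)[OF k m(2) B', of x, symmetric]
        using i i1 i2 by (simp add: Bochner_Integration.integrable_sum)
    qed
    also have "(\<Sum>e\<in>Basis. LINT t|lborel. \<theta> t * xconv (partial_deriv e (partial_deriv e k)) f (t, x)) -
        (\<Sum>e\<in>Basis. LINT t|lborel. \<theta> t * xconv (partial_deriv e k) (g e) (t, x)) =
        (LINT t|lborel. \<theta> t * xconv_flux k f g (t, x))"
    proof -
      have i: "integrable lborel (\<lambda>t. \<theta> t * xconv (partial_deriv e (partial_deriv e k)) f (t, x))"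
         "integrable lborel (\<lambda>t. \<theta> t * xconv (partial_deriv e k) (g e) (t, x))" if "e \<in> Basis" for e
        using integrable_times_bounded[OF sf(1)[OF tk(1)[OF tk(1)[OF k that] that]] m(1) B]
          integrable_times_bounded[OF sg(1)[OF that that tk(1)[OF k that]] m(1) B] by (simp_all add: mult.commute)
      show ?thesis
        unfolding xconv_flux_def right_diff_distrib sum_distrib_left
        using i by (subst Bochner_Integration.integral_diff) (auto simp: Bochner_Integration.integral_sum)
    qed
    finally show "(LINT t|lborel. \<theta>' t * xconv k z (t, x)) + (LINT t|lborel. \<theta> t * xconv_flux k f g (t, x)) = 0" by simp
  qed
qed

text \<open>The weighted product rule holds at each x; integrating it over x with Fubini gives the
  statement on space-time. Two kernels are needed because the energy pairs k with k -
  \<Delta>k.\<close>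

lemma energy_product:
  assumes k: "k \<in> test_functions" and q: "q \<in> test_functions" and l: "l > 0"
  shows "(LINT p|lborel. exp_weight l T (fst p) * (xconv k z p * xconv q z p)) =
    (LINT p|lborel. int_weight l T (fst p) * (xconv_flux k f g p * xconv q z p + xconv k z p * xconv_flux q f g p))"
proof -
  have mx: "xconv k z \<in> borel_measurable borel" "xconv q z \<in> borel_measurable borel"
    using L2b_xconv[OF k z] L2b_xconv[OF q z] by (auto dest!: square_integrableD(1))
  have i1: "integrable lborel (\<lambda>p. exp_weight l T (fst p) * (xconv k z p * xconv q z p))"
    by (intro integrable_time_weight[OF _ weights(1)[OF l] weights(4)[OF l]] square_integrable_mult_integrable L2b_xconv k q z)
  have i2: "integrable lborel (\<lambda>p. int_weight l T (fst p) * (xconv_flux k f g p * xconv q z p + xconv k z p * xconv_flux q f g p))"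
    by (intro integrable_time_weight[OF _ weights(2)[OF l] weights(7)[OF l]] Bochner_Integration.integrable_add 
        square_integrable_mult_integrable L2b_xconv L2b_xconv_flux k q z)
  have eq: "(LINT t|lborel. exp_weight l T t * (xconv k z (t, x) * xconv q z (t, x))) =
    (LINT t|lborel. int_weight l T t * (xconv_flux k f g (t, x) * xconv q z (t, x) + xconv k z (t, x) * xconv_flux q f g (t, x)))" for x
  proof -
    have xz: "xconv \<kappa> z (t, x) = 0" if "t \<notin> {0<..<T}" for \<kappa> t using that z0 by (simp add: xconv_def)
    have fz: "xconv_flux \<kappa> f g (t, x) = 0" if "t \<notin> {0<..<T}" for \<kappa> t
      using that f0 g0 by (simp add: xconv_flux_def xconv_def)
    have "(LINT t|lborel. indicator {0..T} t * exp (- l * t) * (xconv k z (t, x) * xconv q z (t, x))) =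
      (LINT t|lborel. tail_weight l T t * (xconv_flux k f g (t, x) * xconv q z (t, x) + xconv k z (t, x) * xconv_flux q f g (t, x)))"
      by (rule weighted_product[OF slice_primitive(1)[OF k] slice_primitive(1)[OF q] _ _ _ _ _ _ 
            slice_primitive(2)[OF k] slice_primitive(2)[OF q] l])
         (auto intro!: xz fz borel_measurable_compose_continuous[OF mx(1)] borel_measurable_compose_continuous[OF mx(2)] continuous_intros)
    also have "\<dots> = (LINT t|lborel. int_weight l T t * (xconv_flux k f g (t, x) * xconv q z (t, x) + xconv k z (t, x) * xconv_flux q f g (t, x)))"
    proof (intro Bochner_Integration.integral_cong refl)
      fix t
      show "tail_weight l T t * (xconv_flux k f g (t, x) * xconv q z (t, x) + xconv k z (t, x) * xconv_flux q f g (t, x)) =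
        int_weight l T t * (xconv_flux k f g (t, x) * xconv q z (t, x) + xconv k z (t, x) * xconv_flux q f g (t, x))"
        by (cases "t \<in> {0<..<T}") (simp_all add: int_weight_def xz)
    qed
    finally show ?thesis by (simp add: exp_weight_def)
  qed
  have "(LINT p|lborel. exp_weight l T (fst p) * (xconv k z p * xconv q z p)) =
    (LINT x|lborel. LINT t|lborel. exp_weight l T t * (xconv k z (t, x) * xconv q z (t, x)))"
    using lborel_pair.integral_snd[of "\<lambda>t x. exp_weight l T t * (xconv k z (t, x) * xconv q z (t, x))"] i1
    unfolding lborel_prod by (simp add: case_prod_unfold)
  also have "\<dots> = (LINT x|lborel. LINT t|lborel. int_weight l T t * 
     (xconv_flux k f g (t, x) * xconv q z (t, x) + xconv k z (t, x) * xconv_flux q f g (t, x)))"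
    unfolding eq ..
  also have "\<dots> = (LINT p|lborel. int_weight l T (fst p) * (xconv_flux k f g p * xconv q z p + xconv k z p * xconv_flux q f g p))"
    using lborel_pair.integral_snd[of "\<lambda>t x. int_weight l T t * (xconv_flux k f g (t, x) * xconv q z (t, x) + xconv k z (t, x) * xconv_flux q f g (t, x))"] i2
    unfolding lborel_prod by (simp add: case_prod_unfold)
  finally show ?thesis .
qed

text \<open>The energy is the pairing of the convolutions of z with k and q. Its derivative consists
  of two flux pairings, equal because the kernels are even; this is the factor 2. In the diffusion
  term \<Delta>k is replaced by k - q, which separates the lower-order part from the
  dissipation.\<close>

lemma energy_identity:
  fixes k :: "'a \<Rightarrow> real" and l :: real
  assumes k: "k \<in> test_functions" and ev: "\<And>x. k (- x) = k x" and l: "l > 0"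
  defines "q \<equiv> \<lambda>x. k x - laplacian k x"
  defines "zw \<equiv> \<lambda>p. int_weight l T (fst p) * z p"
  shows "(LINT p|lborel. exp_weight l T (fst p) * ((xconv k z p)\<^sup>2 + (\<Sum>e\<in>Basis. (xconv (partial_deriv e k) z p)\<^sup>2))) =
    2 * (ip (xconv k zw) (xconv q f) + (\<Sum>e\<in>Basis. ip (xconv (partial_deriv e k) zw) (xconv q (g e))) - ip (xconv q zw) (xconv q f))"
proof -
  have q: "q \<in> test_functions" unfolding q_def by (intro test_diff test_laplacian k)
  have evL: "laplacian k (- x) = laplacian k x" for x
    unfolding laplacian_def by (intro sum.cong refl even_partial_deriv(2) test_smooth k ev)
  have evq: "q (- x) = q x" for x by (simp add: q_def ev evL)
  note od = even_partial_deriv(1)[OF test_smooth[OF k] ev]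
  note ev2 = even_partial_deriv(2)[OF test_smooth[OF k] ev]
  note tk = test_partial_deriv k q
  note ti = test_integrable tk
  define zm where "zm p = exp_weight l T (fst p) * z p" for p
  have zm: "L2b zm" unfolding zm_def
    by (rule square_integrable_time_weight[OF z weights(1)[OF l] weights(4)[OF l]])
  have zw: "L2b zw" unfolding zw_def
    by (rule square_integrable_time_weight[OF z weights(2)[OF l] weights(7)[OF l]])
  have xm: "xconv \<kappa> zm p = exp_weight l T (fst p) * xconv \<kappa> z p" for \<kappa> p
    unfolding zm_def by (rule xconv_time_multiplier)
  have xw: "xconv \<kappa> zw p = int_weight l T (fst p) * xconv \<kappa> z p" for \<kappa> p
    unfolding zw_def by (rule xconv_time_multiplier)
  note L = L2b_xconv square_integrable_sum square_integrable_diff tk z zm zw f g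
  have LHS: "(LINT p|lborel. exp_weight l T (fst p) * ((xconv k z p)\<^sup>2 + (\<Sum>e\<in>Basis. (xconv (partial_deriv e k) z p)\<^sup>2))) =
    ip (xconv k z) (xconv q zm)"
  proof -
    have i: "integrable lborel (\<lambda>p. xconv \<kappa> z p * xconv \<kappa> zm p)" if "\<kappa> \<in> test_functions" for \<kappa>
      using that by (intro square_integrable_mult_integrable L)
    have "(LINT p|lborel. exp_weight l T (fst p) * ((xconv k z p)\<^sup>2 + (\<Sum>e\<in>Basis. (xconv (partial_deriv e k) z p)\<^sup>2))) =
      (LINT p|lborel. xconv k z p * xconv k zm p + (\<Sum>e\<in>Basis. xconv (partial_deriv e k) z p * xconv (partial_deriv e k) zm p))"
      by (intro Bochner_Integration.integral_cong refl)
         (simp add: xm distrib_left sum_distrib_left power2_eq_square mult.commute mult.left_commute)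
    also have "\<dots> = ip (xconv k z) (xconv k zm) + (\<Sum>e\<in>Basis. ip (xconv (partial_deriv e k) z) (xconv (partial_deriv e k) zm))"
    proof -
      have "(LINT p|lborel. (\<Sum>e\<in>Basis. xconv (partial_deriv e k) z p * xconv (partial_deriv e k) zm p)) =
          (\<Sum>e\<in>Basis. ip (xconv (partial_deriv e k) z) (xconv (partial_deriv e k) zm))"
        by (rule Bochner_Integration.integral_sum) (intro i tk)
      then show ?thesis
        by (subst Bochner_Integration.integral_add) (auto intro!: i tk Bochner_Integration.integrable_sum)
    qed
    also have "\<dots> = ip (xconv k z) (xconv q zm)"
      unfolding q_def by (rule ip_xconv_resolvent[symmetric, OF k z zm])
    finally show ?thesis .
  qed
  \<comment> \<open>One half of the derivative of the energy: the flux for k paired with the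
    convolution with q.\<close>
  define A where "A = ip (xconv q zw) (xconv_flux k f g)"
  have fl: "ip w (xconv_flux \<kappa> f g) = ip w (\<lambda>p. \<Sum>e\<in>Basis. xconv (partial_deriv e (partial_deriv e \<kappa>)) f p) -
      (\<Sum>e\<in>Basis. ip w (xconv (partial_deriv e \<kappa>) (g e)))" if "L2b w" "\<kappa> \<in> test_functions" for w \<kappa>
  proof -
    have "ip w (xconv_flux \<kappa> f g) = ip w (\<lambda>p. (\<Sum>e\<in>Basis. xconv (partial_deriv e (partial_deriv e \<kappa>)) f p) - (\<Sum>e\<in>Basis. xconv (partial_deriv e \<kappa>) (g e) p))"
      by (simp add: xconv_flux_def)
    also have "\<dots> = ip w (\<lambda>p. \<Sum>e\<in>Basis. xconv (partial_deriv e (partial_deriv e \<kappa>)) f p) -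
       ip w (\<lambda>p. \<Sum>e\<in>Basis. xconv (partial_deriv e \<kappa>) (g e) p)"
      by (intro ip_diff_right that L)
    also have "ip w (\<lambda>p. \<Sum>e\<in>Basis. xconv (partial_deriv e \<kappa>) (g e) p) = (\<Sum>e\<in>Basis. ip w (xconv (partial_deriv e \<kappa>) (g e)))"
      by (intro ip_sum_right that L)
    finally show ?thesis .
  qed
  \<comment> \<open>The other half, with k and q in exchanged roles. For the drift one sign comes
    from partial integration and one from the odd kernel, and they cancel.\<close>
  have B: "ip (xconv k zw) (xconv_flux q f g) = A"
  proof -
    have 1: "ip (xconv k zw) (\<lambda>p. \<Sum>e\<in>Basis. xconv (partial_deriv e (partial_deriv e q)) f p) =
       ip (xconv q zw) (\<lambda>p. \<Sum>e\<in>Basis. xconv (partial_deriv e (partial_deriv e k)) f p)"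
    proof -
      have "ip (xconv k zw) (\<lambda>p. \<Sum>e\<in>Basis. xconv (partial_deriv e (partial_deriv e q)) f p) =
        ip (\<lambda>p. \<Sum>e\<in>Basis. xconv (partial_deriv e (partial_deriv e k)) zw p) (xconv q f)"
        by (rule xconv_laplacian_symmetric[symmetric, OF k q zw f])
      also have "\<dots> = ip (xconv q f) (\<lambda>p. \<Sum>e\<in>Basis. xconv (partial_deriv e (partial_deriv e k)) zw p)"
        by (rule ip_commute)
      also have "\<dots> = (\<Sum>e\<in>Basis. ip (xconv q f) (xconv (partial_deriv e (partial_deriv e k)) zw))"
        by (intro ip_sum_right L)
      also have "\<dots> = (\<Sum>e\<in>Basis. ip (xconv q zw) (xconv (partial_deriv e (partial_deriv e k)) f))"
      proof (intro sum.cong refl)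
        fix e :: 'a assume e: "e \<in> Basis"
        have "ip (xconv q f) (xconv (partial_deriv e (partial_deriv e k)) zw) = ip (xconv (partial_deriv e (partial_deriv e k)) zw) (xconv q f)"
          by (rule ip_commute)
        also have "\<dots> = ip (xconv q zw) (xconv (partial_deriv e (partial_deriv e k)) f)"
          by (intro xconv_swap_even ti zw f e evq ev2)
        finally show "ip (xconv q f) (xconv (partial_deriv e (partial_deriv e k)) zw) = ip (xconv q zw) (xconv (partial_deriv e (partial_deriv e k)) f)" .
      qed
      also have "\<dots> = ip (xconv q zw) (\<lambda>p. \<Sum>e\<in>Basis. xconv (partial_deriv e (partial_deriv e k)) f p)"
        by (intro ip_sum_right[symmetric] L)
      finally show ?thesis .
    qed
    have 2: "ip (xconv k zw) (xconv (partial_deriv e q) (g e)) = ip (xconv q zw) (xconv (partial_deriv e k) (g e))" if e: "e \<in> Basis" for e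
    proof -
      have "ip (xconv k zw) (xconv (partial_deriv e q) (g e)) = - ip (xconv (partial_deriv e k) zw) (xconv q (g e))"
        using xconv_partial_integration[OF k q e zw g[OF e]] by simp
      also have "\<dots> = ip (xconv q zw) (xconv (partial_deriv e k) (g e))"
        using xconv_swap_odd[OF test_integrable[OF q] test_integrable[OF tk(1)[OF k e]] zw g[OF e] evq od[OF e]] by simp
      finally show ?thesis .
    qed
    show ?thesis unfolding A_def fl[OF L2b_xconv[OF k zw] q] fl[OF L2b_xconv[OF q zw] k] 1 by (simp add: 2)
  qed
  have A: "A = ip (xconv k zw) (xconv q f) + (\<Sum>e\<in>Basis. ip (xconv (partial_deriv e k) zw) (xconv q (g e))) - ip (xconv q zw) (xconv q f)"
  proof -
    \<comment> \<open>Here \<Delta>k = k - q enters: its q part is the dissipation term, its k part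
      is moved to the other factor.\<close>
    have "AE p in lborel. (\<Sum>e\<in>Basis. xconv (partial_deriv e (partial_deriv e k)) f p) = xconv k f p - xconv q f p"
      using xconv_resolvent_kernel[OF k f] unfolding q_def by eventually_elim simp
    then have "ip (xconv q zw) (\<lambda>p. \<Sum>e\<in>Basis. xconv (partial_deriv e (partial_deriv e k)) f p) =
      ip (xconv q zw) (\<lambda>p. xconv k f p - xconv q f p)"
      by (intro ip_cong_right L)
    also have "\<dots> = ip (xconv q zw) (xconv k f) - ip (xconv q zw) (xconv q f)"
      by (intro ip_diff_right L)
    also have "ip (xconv q zw) (xconv k f) = ip (xconv k zw) (xconv q f)"
      by (intro xconv_swap_even ti zw f ev evq)
    finally have 1: "ip (xconv q zw) (\<lambda>p. \<Sum>e\<in>Basis. xconv (partial_deriv e (partial_deriv e k)) f p) =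
      ip (xconv k zw) (xconv q f) - ip (xconv q zw) (xconv q f)" .
    have 2: "ip (xconv q zw) (xconv (partial_deriv e k) (g e)) = - ip (xconv (partial_deriv e k) zw) (xconv q (g e))" if e: "e \<in> Basis" for e
      by (rule xconv_swap_odd[OF test_integrable[OF q] test_integrable[OF tk(1)[OF k e]] zw g[OF e] evq od[OF e]])
    show ?thesis unfolding A_def fl[OF L2b_xconv[OF q zw] k] 1 by (simp add: 2 sum_negf)
  qed
  have "ip (xconv k z) (xconv q zm) = (LINT p|lborel. exp_weight l T (fst p) * (xconv k z p * xconv q z p))"
    by (simp add: xm mult.left_commute)
  also have "\<dots> = (LINT p|lborel. int_weight l T (fst p) * (xconv_flux k f g p * xconv q z p + xconv k z p * xconv_flux q f g p))"
    by (rule energy_product[OF k q l])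
  also have "\<dots> = (LINT p|lborel. xconv q zw p * xconv_flux k f g p + xconv k zw p * xconv_flux q f g p)"
    by (intro Bochner_Integration.integral_cong refl) (simp add: xw algebra_simps)
  also have "\<dots> = A + ip (xconv k zw) (xconv_flux q f g)"
    unfolding A_def by (intro Bochner_Integration.integral_add square_integrable_mult_integrable L2b_xconv L2b_xconv_flux k q zw)
  finally show ?thesis unfolding LHS B using A by simp
qed

end

text \<open>Young's inequality contributes the constants \<gamma>/2 and 1/(2\<gamma>). Convolution
  with q at most doubles the L2 norm, so the second one is multiplied by 4.\<close>

lemma weighted_young:
  assumes u: "L2b u" and G: "L2b G" and q: "q \<in> test_functions" and q2: "(LINT x|lborel. \<bar>q x\<bar>) \<le> 2"
    and l: "l > 0" and \<gamma>: "\<gamma> > 0" and k: "k \<in> test_functions"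
  shows "ip (xconv k (\<lambda>p. int_weight l T (fst p) * u p)) (xconv q G) \<le>
    \<gamma> / 2 * (LINT p|lborel. int_weight l T (fst p) * (xconv k u p)\<^sup>2) +
    2 / \<gamma> * (LINT p|lborel. int_weight l T (fst p) * (G p)\<^sup>2)"
proof -
  define w where "w = int_weight l T"
  have mw: "w \<in> borel_measurable borel" unfolding w_def by (rule weights(2)[OF l])
  have w0: "0 \<le> w t" and w1: "\<bar>w t\<bar> \<le> 1 / l" for t unfolding w_def using weights(5,7)[OF l] by auto
  define X where "X = xconv k u"
  define Y where "Y = xconv q G"
  have X: "L2b X" unfolding X_def by (rule L2b_xconv[OF k u])
  have Y: "L2b Y" unfolding Y_def by (rule L2b_xconv[OF q G])
  have iX: "integrable lborel (\<lambda>p. w (fst p) * (X p)\<^sup>2)"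
    by (rule integrable_time_weight[OF square_integrableD(2)[OF X] mw w1])
  have iY: "integrable lborel (\<lambda>p. w (fst p) * (Y p)\<^sup>2)"
    by (rule integrable_time_weight[OF square_integrableD(2)[OF Y] mw w1])
  have iXY: "integrable lborel (\<lambda>p. w (fst p) * (X p * Y p))"
    by (rule integrable_time_weight[OF square_integrable_mult_integrable[OF X Y] mw w1])
  \<comment> \<open>The square root of the weight passes through the convolution, so the unweighted
    norm bound for convolutions yields the weighted one.\<close>
  define r where "r t = sqrt (w t)" for t
  have mr: "r \<in> borel_measurable borel" unfolding r_def using mw by measurable
  have r1: "\<bar>r t\<bar> \<le> sqrt (1 / l)" for t unfolding r_def using w0 w1[of t] by simp
  have r2: "(r t)\<^sup>2 = w t" for t unfolding r_def using w0 by simp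
  have rG: "L2b (\<lambda>p. r (fst p) * G p)" by (rule square_integrable_time_weight[OF G mr r1])
  have "(LINT p|lborel. w (fst p) * (Y p)\<^sup>2) = (l2norm lborel (xconv q (\<lambda>p. r (fst p) * G p)))\<^sup>2"
    unfolding l2norm_sq by (simp add: xconv_time_multiplier power_mult_distrib r2 Y_def)
  also have "\<dots> \<le> ((LINT x|lborel. \<bar>q x\<bar>) * l2norm lborel (\<lambda>p. r (fst p) * G p))\<^sup>2"
    by (intro power_mono l2norm_xconv test_integrable q rG l2norm_nonneg)
  also have "\<dots> \<le> (2 * l2norm lborel (\<lambda>p. r (fst p) * G p))\<^sup>2"
    by (intro power_mono mult_right_mono q2 mult_nonneg_nonneg l2norm_nonneg) simp
  also have "\<dots> = 4 * (LINT p|lborel. w (fst p) * (G p)\<^sup>2)"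
    unfolding power_mult_distrib l2norm_sq by (simp add: power_mult_distrib r2)
  finally have Yle: "(LINT p|lborel. w (fst p) * (Y p)\<^sup>2) \<le> 4 * (LINT p|lborel. w (fst p) * (G p)\<^sup>2)" .
  have "ip (xconv k (\<lambda>p. w (fst p) * u p)) (xconv q G) = (LINT p|lborel. w (fst p) * (X p * Y p))"
    by (simp add: xconv_time_multiplier X_def Y_def mult.assoc)
  also have "\<dots> \<le> (LINT p|lborel. \<gamma> / 2 * (w (fst p) * (X p)\<^sup>2) + 1 / (2 * \<gamma>) * (w (fst p) * (Y p)\<^sup>2))"
  proof (rule integral_mono[OF iXY])
    show "integrable lborel (\<lambda>p. \<gamma> / 2 * (w (fst p) * (X p)\<^sup>2) + 1 / (2 * \<gamma>) * (w (fst p) * (Y p)\<^sup>2))"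
      by (intro Bochner_Integration.integrable_add integrable_mult_right iX iY)
    fix p
    have "0 \<le> (\<gamma> * X p - Y p)\<^sup>2 / (2 * \<gamma>)" using \<gamma> by simp
    also have "\<dots> = \<gamma> / 2 * (X p)\<^sup>2 + 1 / (2 * \<gamma>) * (Y p)\<^sup>2 - X p * Y p"
      using \<gamma> by (simp add: power2_eq_square field_simps)
    finally have "w (fst p) * (X p * Y p) \<le> w (fst p) * (\<gamma> / 2 * (X p)\<^sup>2 + 1 / (2 * \<gamma>) * (Y p)\<^sup>2)"
      by (intro mult_left_mono w0) simp
    then show "w (fst p) * (X p * Y p) \<le> \<gamma> / 2 * (w (fst p) * (X p)\<^sup>2) + 1 / (2 * \<gamma>) * (w (fst p) * (Y p)\<^sup>2)"
      by (simp add: distrib_left mult.left_commute)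
  qed
  also have "\<dots> = \<gamma> / 2 * (LINT p|lborel. w (fst p) * (X p)\<^sup>2) + 1 / (2 * \<gamma>) * (LINT p|lborel. w (fst p) * (Y p)\<^sup>2)"
    using iX iY by simp
  also have "\<dots> \<le> \<gamma> / 2 * (LINT p|lborel. w (fst p) * (X p)\<^sup>2) + 1 / (2 * \<gamma>) * (4 * (LINT p|lborel. w (fst p) * (G p)\<^sup>2))"
    using \<gamma> by (intro add_left_mono mult_left_mono Yle) simp
  finally show ?thesis by (simp add: w_def X_def)
qed

context weak_flux_equation
begin

text \<open>There are d + 1 lower-order terms, one for f and one for each component of g. Each costs
  (2/\<gamma>) A F, where F is the weighted integral of z f; after the doubling in the energy
  identity the choice of \<gamma> makes their sum 2 F. The remaining \<gamma> times the energy comes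
  with the weight of size 1/l, and l = 2 \<gamma> turns it into half of the left side.\<close>

lemma energy_estimate:
  fixes k :: "'a \<Rightarrow> real" and A :: real
  assumes k: "k \<in> test_functions" and ev: "\<And>x. k (- x) = k x" 
    and q2: "(LINT x|lborel. \<bar>k x - laplacian k x\<bar>) \<le> 2" and A: "A > 0"
    and fA: "AE p in lborel. (f p)\<^sup>2 \<le> A * (z p * f p)"
    and gA: "\<And>e. e \<in> Basis \<Longrightarrow> AE p in lborel. (g e p)\<^sup>2 \<le> A * (z p * f p)"
  defines "\<gamma> \<equiv> 2 * A * (real DIM('a) + 1)"
  defines "q \<equiv> \<lambda>x. k x - laplacian k x"
  defines "zw \<equiv> \<lambda>p. int_weight (2 * \<gamma>) T (fst p) * z p"
  shows "(LINT p|lborel. exp_weight (2 * \<gamma>) T (fst p) * (xconv k z p)\<^sup>2) \<le>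
    4 * (ip zw f - ip (xconv q zw) (xconv q f))"
proof -
  define l where "l = 2 * \<gamma>"
  have \<gamma>: "\<gamma> > 0" unfolding \<gamma>_def using A by simp
  have l: "l > 0" using \<gamma> by (simp add: l_def)
  define w where "w = int_weight l T"
  define m where "m = exp_weight l T"
  have zw: "zw = (\<lambda>p. w (fst p) * z p)" by (simp add: zw_def w_def l_def)
  have mw: "w \<in> borel_measurable borel" "m \<in> borel_measurable borel" unfolding w_def m_def by (intro weights l)+
  have w0: "0 \<le> w t" and w1: "\<bar>w t\<bar> \<le> 1 / l" and wm: "w t \<le> m t / l" and m0: "0 \<le> m t" and m1: "\<bar>m t\<bar> \<le> 1" for t
    unfolding w_def m_def using weights[OF l] by auto
  have q: "q \<in> test_functions" unfolding q_def by (intro test_diff test_laplacian k)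
  note tk = test_partial_deriv k
  define F where "F = (LINT p|lborel. w (fst p) * (z p * f p))"
  have ipF: "ip zw f = F" by (simp add: zw F_def mult.assoc)
  have izf: "integrable lborel (\<lambda>p. w (fst p) * (z p * f p))"
    by (rule integrable_time_weight[OF square_integrable_mult_integrable[OF z f] mw(1) w1])
  have GF: "(LINT p|lborel. w (fst p) * (G p)\<^sup>2) \<le> A * F" 
    if G: "L2b G" and le: "AE p in lborel. (G p)\<^sup>2 \<le> A * (z p * f p)" for G
  proof -
    have "(LINT p|lborel. w (fst p) * (G p)\<^sup>2) \<le> (LINT p|lborel. A * (w (fst p) * (z p * f p)))"
    proof (rule integral_mono_AE)
      show "integrable lborel (\<lambda>p. w (fst p) * (G p)\<^sup>2)"
        by (rule integrable_time_weight[OF square_integrableD(2)[OF G] mw(1) w1])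
      show "AE p in lborel. w (fst p) * (G p)\<^sup>2 \<le> A * (w (fst p) * (z p * f p))"
        using le
      proof eventually_elim
        case (elim p)
        from mult_left_mono[OF elim w0[of "fst p"]] show ?case
          unfolding mult.left_commute[of A "w (fst p)"] .
      qed
    qed (use izf in simp)
    then show ?thesis by (simp add: F_def)
  qed
  have AF: "0 \<le> A * F" using GF[OF f fA] by (rule order_trans[rotated]) (simp add: w0)
  have F0: "0 \<le> F" using AF A by (simp add: zero_le_mult_iff)
  define S where "S \<kappa> = (LINT p|lborel. w (fst p) * (xconv \<kappa> z p)\<^sup>2)" for \<kappa>
  have iS: "integrable lborel (\<lambda>p. w (fst p) * (xconv \<kappa> z p)\<^sup>2)" and iM: "integrable lborel (\<lambda>p. m (fst p) * (xconv \<kappa> z p)\<^sup>2)" 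
    if "\<kappa> \<in> test_functions" for \<kappa>
    using integrable_time_weight[OF square_integrableD(2)[OF L2b_xconv[OF that z]] mw(1) w1]
      integrable_time_weight[OF square_integrableD(2)[OF L2b_xconv[OF that z]] mw(2) m1] by auto
  have young: "ip (xconv \<kappa> zw) (xconv q G) \<le> \<gamma> / 2 * S \<kappa> + 2 / \<gamma> * (A * F)"
    if "\<kappa> \<in> test_functions" "L2b G" "AE p in lborel. (G p)\<^sup>2 \<le> A * (z p * f p)" for \<kappa> G
  proof -
    have "ip (xconv \<kappa> zw) (xconv q G) \<le> \<gamma> / 2 * S \<kappa> + 2 / \<gamma> * (LINT p|lborel. w (fst p) * (G p)\<^sup>2)"
      unfolding zw S_def w_def by (rule weighted_young[OF z that(2) q _ l \<gamma> that(1)]) (use q2 in \<open>simp add: q_def\<close>)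
    also have "\<dots> \<le> \<gamma> / 2 * S \<kappa> + 2 / \<gamma> * (A * F)"
      using \<gamma> GF[OF that(2,3)] by (intro add_left_mono mult_left_mono) auto
    finally show ?thesis .
  qed
  define E where "E = (LINT p|lborel. m (fst p) * ((xconv k z p)\<^sup>2 + (\<Sum>e\<in>Basis. (xconv (partial_deriv e k) z p)\<^sup>2)))"
  have E: "E = (LINT p|lborel. m (fst p) * (xconv k z p)\<^sup>2) + (\<Sum>e\<in>Basis. LINT p|lborel. m (fst p) * (xconv (partial_deriv e k) z p)\<^sup>2)"
  proof -
    have "(LINT p|lborel. (\<Sum>e\<in>Basis. m (fst p) * (xconv (partial_deriv e k) z p)\<^sup>2)) =
      (\<Sum>e\<in>Basis. LINT p|lborel. m (fst p) * (xconv (partial_deriv e k) z p)\<^sup>2)"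
      by (rule Bochner_Integration.integral_sum) (intro iM tk)
    then show ?thesis unfolding E_def distrib_left sum_distrib_left
      by (subst Bochner_Integration.integral_add) (auto intro!: iM tk Bochner_Integration.integrable_sum)
  qed
  \<comment> \<open>The integrated weight is at most 1/l times the exponential one: the step that
    stands in for Gronwall.\<close>
  have Sm: "S \<kappa> \<le> (LINT p|lborel. m (fst p) * (xconv \<kappa> z p)\<^sup>2) / l" if "\<kappa> \<in> test_functions" for \<kappa>
  proof -
    have "S \<kappa> \<le> (LINT p|lborel. 1 / l * (m (fst p) * (xconv \<kappa> z p)\<^sup>2))"
      unfolding S_def
    proof (rule integral_mono[OF iS[OF that]])
      show "integrable lborel (\<lambda>p. 1 / l * (m (fst p) * (xconv \<kappa> z p)\<^sup>2))" using iM[OF that] by simp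
      show "w (fst p) * (xconv \<kappa> z p)\<^sup>2 \<le> 1 / l * (m (fst p) * (xconv \<kappa> z p)\<^sup>2)" for p
        using mult_right_mono[OF wm[of "fst p"], of "(xconv \<kappa> z p)\<^sup>2"] by simp
    qed
    then show ?thesis by simp
  qed
  have "S k + (\<Sum>e\<in>Basis. S (partial_deriv e k)) \<le> (LINT p|lborel. m (fst p) * (xconv k z p)\<^sup>2) / l +
     (\<Sum>e\<in>Basis. (LINT p|lborel. m (fst p) * (xconv (partial_deriv e k) z p)\<^sup>2) / l)"
    by (intro add_mono sum_mono Sm tk)
  also have "\<dots> = E / l" by (simp add: E add_divide_distrib sum_divide_distrib)
  finally have SE: "S k + (\<Sum>e\<in>Basis. S (partial_deriv e k)) \<le> E / l" .
  have "E = 2 * (ip (xconv k zw) (xconv q f) + (\<Sum>e\<in>Basis. ip (xconv (partial_deriv e k) zw) (xconv q (g e))) - ip (xconv q zw) (xconv q f))"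
    using energy_identity[OF k ev l] unfolding E_def m_def zw w_def q_def by simp
  also have "\<dots> \<le> 2 * ((\<gamma> / 2 * S k + 2 / \<gamma> * (A * F)) + (\<Sum>e\<in>(Basis::'a set). \<gamma> / 2 * S (partial_deriv e k) + 2 / \<gamma> * (A * F)) - ip (xconv q zw) (xconv q f))"
    by (intro mult_left_mono diff_right_mono add_mono sum_mono young tk f g fA gA) auto
  also have "\<dots> = \<gamma> * (S k + (\<Sum>e\<in>Basis. S (partial_deriv e k))) + 4 * A * (real DIM('a) + 1) / \<gamma> * F - 2 * ip (xconv q zw) (xconv q f)"
    by (simp add: sum.distrib sum_distrib_left algebra_simps add_divide_distrib)
  also have "4 * A * (real DIM('a) + 1) / \<gamma> = 2"
  proof -
    have *: "4 * A * (real DIM('a) + 1) = 2 * \<gamma>" by (simp add: \<gamma>_def)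
    show ?thesis unfolding * using \<gamma> by simp
  qed
  also have "\<gamma> * (S k + (\<Sum>e\<in>Basis. S (partial_deriv e k))) \<le> \<gamma> * (E / l)" using \<gamma> by (intro mult_left_mono SE) simp
  also have "\<gamma> * (E / l) = E / 2" using \<gamma> by (simp add: l_def)
  \<comment> \<open>What precedes reads E \<le> E/2 + 2 F - 2 times the regularised dissipation, and
    E is finite.\<close>
  finally have "E \<le> 4 * (F - ip (xconv q zw) (xconv q f))" by simp
  moreover have "(LINT p|lborel. m (fst p) * (xconv k z p)\<^sup>2) \<le> E"
    unfolding E using m0 by (simp add: sum_nonneg)
  ultimately show ?thesis unfolding ipF m_def l_def by linarith
qed

text \<open>The regularised dissipation tends to its unregularised counterpart, so the right side of
  the estimate tends to 0 and with it the convolutions of z with \<open>k n\<close>. These kernels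
  are smoothing and do not tend to the identity; z = 0 is obtained by duality against the
  convolutions of z with \<open>q j\<close>.\<close>

lemma vanishes:
  fixes A :: real
  assumes A: "A > 0"
    and fA: "AE p in lborel. (f p)\<^sup>2 \<le> A * (z p * f p)"
    and gA: "\<And>e. e \<in> Basis \<Longrightarrow> AE p in lborel. (g e p)\<^sup>2 \<le> A * (z p * f p)"
  shows "AE p in lborel. z p = 0"
proof (rule kernel_sequence[where 'a='a])
  fix k :: "nat \<Rightarrow> 'a \<Rightarrow> real"
  assume k: "\<And>n. k n \<in> test_functions" "\<And>n x. k n (- x) = k n x"
    "\<And>n. (LINT x|lborel. \<bar>k n x - laplacian (k n) x\<bar>) \<le> 2"
    "\<And>u. square_integrable lborel u \<Longrightarrow>
       (\<lambda>n. l2norm lborel (\<lambda>p. xconv (\<lambda>x. k n x - laplacian (k n) x) u p - u p)) \<longlonglongrightarrow> 0"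
  define \<gamma> where "\<gamma> = 2 * A * (real DIM('a) + 1)"
  define l where "l = 2 * \<gamma>"
  have l: "l > 0" using A by (simp add: l_def \<gamma>_def)
  define q where "q n x = k n x - laplacian (k n) x" for n x
  have q: "q n \<in> test_functions" for n unfolding q_def[abs_def] by (intro test_diff test_laplacian k)
  have qlim: "(\<lambda>n. l2norm lborel (\<lambda>p. xconv (q n) u p - u p)) \<longlonglongrightarrow> 0" if "L2b u" for u
    using k(4)[OF that] by (simp add: q_def[abs_def])
  define zw where "zw p = int_weight l T (fst p) * z p" for p
  have zw: "L2b zw" unfolding zw_def by (rule square_integrable_time_weight[OF z weights(2)[OF l] weights(7)[OF l]])
  have "(\<lambda>n. ip (xconv (q n) zw) (xconv (q n) f)) \<longlonglongrightarrow> ip zw f"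
    by (intro l2_inner_tendsto L2b_xconv q zw f qlim)
  then have lim: "(\<lambda>n. 4 * (ip zw f - ip (xconv (q n) zw) (xconv (q n) f))) \<longlonglongrightarrow> 4 * (ip zw f - ip zw f)"
    by (intro tendsto_intros)
  have est: "(l2norm lborel (xconv (k n) z))\<^sup>2 \<le> exp (l * T) * (4 * (ip zw f - ip (xconv (q n) zw) (xconv (q n) f)))" for n
  proof -
    have x0: "xconv (k n) z p = 0" if "fst p \<notin> {0<..<T}" for p using that z0 by (simp add: xconv_def)
    \<comment> \<open>The weight is at least exp(-l T) on (0,T), and the convolution vanishes at all
      other times.\<close>
    have "(xconv (k n) z p)\<^sup>2 \<le> exp (l * T) * (exp_weight l T (fst p) * (xconv (k n) z p)\<^sup>2)" for p
    proof (cases "fst p \<in> {0<..<T}")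
      case True
      then have "1 \<le> exp (l * T) * exp_weight l T (fst p)"
        using l by (simp add: exp_weight_def mult_le_cancel_left flip: exp_add)
      from mult_right_mono[OF this, of "(xconv (k n) z p)\<^sup>2"] show ?thesis by simp
    qed (simp add: x0)
    then have "(l2norm lborel (xconv (k n) z))\<^sup>2 \<le> (LINT p|lborel. exp (l * T) * (exp_weight l T (fst p) * (xconv (k n) z p)\<^sup>2))"
      unfolding l2norm_sq
      using square_integrableD(2)[OF L2b_xconv[OF k(1) z]] 
      by (intro integral_mono integrable_mult_right integrable_time_weight[OF _ weights(1)[OF l] weights(4)[OF l]])
    also have "\<dots> = exp (l * T) * (LINT p|lborel. exp_weight l T (fst p) * (xconv (k n) z p)\<^sup>2)" by simp
    also have "\<dots> \<le> exp (l * T) * (4 * (ip zw f - ip (xconv (q n) zw) (xconv (q n) f)))"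
      using energy_estimate[OF k(1) k(2) k(3) A fA gA, of n]
      by (intro mult_left_mono) (simp_all add: l_def \<gamma>_def zw_def[abs_def] q_def[abs_def])
    finally show ?thesis .
  qed
  have "(\<lambda>n. exp (l * T) * (4 * (ip zw f - ip (xconv (q n) zw) (xconv (q n) f)))) \<longlonglongrightarrow> 0"
    using tendsto_mult_left[OF lim, of "exp (l * T)"] by simp
  then have "(\<lambda>n. (l2norm lborel (xconv (k n) z))\<^sup>2) \<longlonglongrightarrow> 0"
  proof (rule Lim_null_comparison[rotated], intro always_eventually allI)
    show "norm ((l2norm lborel (xconv (k n) z))\<^sup>2) \<le> exp (l * T) * (4 * (ip zw f - ip (xconv (q n) zw) (xconv (q n) f)))" for n
      using est[of n] unfolding real_norm_def abs_power2 .
  qed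
  from tendsto_real_sqrt[OF this] have klim: "(\<lambda>n. l2norm lborel (xconv (k n) z)) \<longlonglongrightarrow> 0"
    by (simp add: l2norm_nonneg)
  \<comment> \<open>For fixed j the operator 1 - \<Delta> is shifted from \<open>k n\<close> to the
    smooth kernel \<open>q j\<close>, giving a function v that does not depend on n. Then n tends to
    infinity: one side tends to the pairing of z with its convolution by \<open>q j\<close>, the
    other to 0.\<close>
  have orth: "ip z (xconv (q j) z) = 0" for j
  proof -
    define v where "v p = xconv (q j) z p - (\<Sum>e\<in>Basis. xconv (partial_deriv e (partial_deriv e (q j))) z p)" for p
    have v: "L2b v" unfolding v_def[abs_def]
      by (intro square_integrable_diff square_integrable_sum L2b_xconv test_partial_deriv q z)
    have eq: "ip (xconv (q n) z) (xconv (q j) z) = ip (xconv (k n) z) v" for n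
    proof -
      note L = L2b_xconv square_integrable_sum square_integrable_diff test_partial_deriv q k(1) z
      have qe: "q n = (\<lambda>x. k n x - laplacian (k n) x)" by (simp add: q_def fun_eq_iff)
      have res: "AE p in lborel. xconv (q n) z p = xconv (k n) z p - (\<Sum>e\<in>Basis. xconv (partial_deriv e (partial_deriv e (k n))) z p)"
        unfolding qe by (rule xconv_resolvent_kernel[OF k(1) z])
      have "ip (xconv (q n) z) (xconv (q j) z) = ip (xconv (q j) z) (xconv (q n) z)" by (rule ip_commute)
      also have "\<dots> = ip (xconv (q j) z) (\<lambda>p. xconv (k n) z p - (\<Sum>e\<in>Basis. xconv (partial_deriv e (partial_deriv e (k n))) z p))"
        by (intro ip_cong_right L res)
      also have "\<dots> = ip (xconv (q j) z) (xconv (k n) z) - ip (xconv (q j) z) (\<lambda>p. \<Sum>e\<in>Basis. xconv (partial_deriv e (partial_deriv e (k n))) z p)"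
        by (intro ip_diff_right L)
      also have "ip (xconv (q j) z) (\<lambda>p. \<Sum>e\<in>Basis. xconv (partial_deriv e (partial_deriv e (k n))) z p) =
         ip (xconv (k n) z) (\<lambda>p. \<Sum>e\<in>Basis. xconv (partial_deriv e (partial_deriv e (q j))) z p)"
        using xconv_laplacian_symmetric[OF k(1)[of n] q[of j] z z] by (simp add: ip_commute)
      also have "ip (xconv (q j) z) (xconv (k n) z) = ip (xconv (k n) z) (xconv (q j) z)" by (rule ip_commute)
      also have "ip (xconv (k n) z) (xconv (q j) z) - ip (xconv (k n) z) (\<lambda>p. \<Sum>e\<in>Basis. xconv (partial_deriv e (partial_deriv e (q j))) z p) =
        ip (xconv (k n) z) v"
        unfolding v_def by (intro ip_diff_right[symmetric] L)
      finally show ?thesis .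
    qed
    have zero: "L2b (\<lambda>p. 0)" by (simp add: square_integrable_def)
    have "(\<lambda>n. ip (xconv (k n) z) v) \<longlonglongrightarrow> ip (\<lambda>p. 0) v"
    proof (rule l2_inner_tendsto)
      show "(\<lambda>n. l2norm lborel (\<lambda>p. xconv (k n) z p - 0)) \<longlonglongrightarrow> 0" using klim by simp
      show "(\<lambda>n. l2norm lborel (\<lambda>p. v p - v p)) \<longlonglongrightarrow> 0" by (simp add: l2norm_def)
    qed (intro L2b_xconv k z v zero)+
    moreover have "(\<lambda>n. ip (xconv (q n) z) (xconv (q j) z)) \<longlonglongrightarrow> ip z (xconv (q j) z)"
    proof (rule l2_inner_tendsto)
      show "(\<lambda>n. l2norm lborel (\<lambda>p. xconv (q j) z p - xconv (q j) z p)) \<longlonglongrightarrow> 0" by (simp add: l2norm_def)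
    qed (intro L2b_xconv q z qlim)+
    ultimately show ?thesis unfolding eq by (simp add: LIMSEQ_unique)
  qed
  \<comment> \<open>The second limit, now in the index of the fixed kernel: the pairings, all 0,
    converge to the squared norm of z.\<close>
  have "(\<lambda>n. ip z (xconv (q n) z)) \<longlonglongrightarrow> ip z z"
  proof (rule l2_inner_tendsto)
    show "(\<lambda>n. l2norm lborel (\<lambda>p. z p - z p)) \<longlonglongrightarrow> 0" by (simp add: l2norm_def)
  qed (intro L2b_xconv q z qlim)+
  then have "ip z z = 0" unfolding orth by (simp add: LIMSEQ_const_iff)
  then have "(LINT p|lborel. (z p)\<^sup>2) = 0" by (simp add: power2_eq_square)
  then have "AE p in lborel. (z p)\<^sup>2 = 0"
    by (subst (asm) integral_nonneg_eq_0_iff_AE[OF square_integrableD(2)[OF z]]) auto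
  then show ?thesis by simp
qed

end

section \<open>Borel representatives\<close>

lemma space_time_borel: "{0<..<T::real} \<times> (UNIV :: 'a::euclidean_space set) \<in> sets borel"
  by (intro borel_open open_Times) auto

lemma borel_measurable_space_time_indicator:
  fixes h :: "real \<times> 'a::euclidean_space \<Rightarrow> real"
  shows "h \<in> borel_measurable borel \<Longrightarrow> (\<lambda>p. indicator ({0<..<T} \<times> UNIV) p * h p) \<in> borel_measurable borel"
  by (intro borel_measurable_times borel_measurable_indicator space_time_borel)

lemma space_time_lebesgue: "{0<..<T::real} \<times> (UNIV :: 'a::euclidean_space set) \<inter> space lebesgue \<in> sets lebesgue"
proof -
  have "{0<..<T::real} \<times> (UNIV :: 'a set) \<in> sets lebesgue"
    by (rule sets_completionI_sets) (simp add: space_time_borel)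
  then show ?thesis by simp
qed

lemma AE_lebesgue_iff: "(AE x in lebesgue. P x) \<longleftrightarrow> (AE x in lborel. P x)"
  by (rule AE_completion_iff)

lemma AE_space_time_iff:
  "(AE p in space_time T. P p) \<longleftrightarrow> (AE p in lborel. p \<in> {0<..<T} \<times> (UNIV :: 'a::euclidean_space set) \<longrightarrow> P p)"
  unfolding AE_restrict_space_iff[OF space_time_lebesgue] AE_lebesgue_iff ..

text \<open>The data are Lebesgue measurable on the strip, while convolution and Fubini are carried
  out for Borel functions on the whole space-time. The two worlds meet only through representatives
  agreeing almost everywhere on the strip.\<close>

lemma space_time_borel_representative:
  fixes h :: "real \<times> 'a::euclidean_space \<Rightarrow> real"
  assumes "h \<in> borel_measurable (space_time T)"
  obtains h' where "h' \<in> borel_measurable borel" "AE p in lborel. p \<in> {0<..<T} \<times> UNIV \<longrightarrow> h p = h' p"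
proof -
  have "(\<lambda>p. indicator ({0<..<T} \<times> UNIV) p *\<^sub>R h p) \<in> borel_measurable lebesgue"
    using assms borel_measurable_restrict_space_iff[OF space_time_lebesgue] by blast
  from completion_ex_borel_measurable_real[OF this] obtain h' where
    "h' \<in> borel_measurable lborel" "AE p in lborel. indicator ({0<..<T} \<times> UNIV) p *\<^sub>R h p = h' p" by blast
  then show ?thesis by (intro that[of h']) (auto elim: eventually_mono)
qed

lemma space_time_measurable_AE:
  fixes h h' :: "real \<times> 'a::euclidean_space \<Rightarrow> real"
  assumes h': "h' \<in> borel_measurable borel" and ae: "AE p in lborel. p \<in> {0<..<T} \<times> UNIV \<longrightarrow> h p = h' p"
  shows "h \<in> borel_measurable (space_time T)"
proof -
  have "(\<lambda>p. indicator ({0<..<T} \<times> UNIV) p *\<^sub>R h' p) \<in> borel_measurable lebesgue"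
    using borel_measurable_space_time_indicator[OF h', of T] by (intro measurable_completion) simp
  moreover have "AE p in lebesgue. indicator ({0<..<T} \<times> UNIV) p *\<^sub>R h' p = indicator ({0<..<T} \<times> UNIV) p *\<^sub>R h p"
    unfolding AE_lebesgue_iff using ae by eventually_elim (auto simp: indicator_def)
  ultimately have "(\<lambda>p. indicator ({0<..<T} \<times> UNIV) p *\<^sub>R h p) \<in> borel_measurable lebesgue"
    by (rule borel_measurable_AE)
  then show ?thesis using borel_measurable_restrict_space_iff[OF space_time_lebesgue] by blast
qed

lemma space_time_integral:
  fixes h h' :: "real \<times> 'a::euclidean_space \<Rightarrow> real"
  assumes h': "h' \<in> borel_measurable borel" and ae: "AE p in lborel. p \<in> {0<..<T} \<times> UNIV \<longrightarrow> h p = h' p"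
  shows "(LINT p|space_time T. h p) = (LINT p|lborel. indicator ({0<..<T} \<times> UNIV) p * h' p)"
    and "integrable (space_time T) h \<longleftrightarrow> integrable lborel (\<lambda>p. indicator ({0<..<T} \<times> UNIV) p * h' p)"
proof -
  let ?S = "{0<..<T} \<times> (UNIV :: 'a set)"
  have m: "(\<lambda>p. indicator ?S p * h' p) \<in> borel_measurable lborel" using borel_measurable_space_time_indicator[OF h', of T] by simp
  have m2: "(\<lambda>p. indicator ?S p *\<^sub>R h p) \<in> borel_measurable lebesgue"
    using space_time_measurable_AE[OF h' ae] borel_measurable_restrict_space_iff[OF space_time_lebesgue] by blast
  have ae2: "AE p in lebesgue. indicator ?S p *\<^sub>R h p = indicator ?S p * h' p"
    unfolding AE_lebesgue_iff using ae by eventually_elim (auto simp: indicator_def)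
  have "(LINT p|space_time T. h p) = (LINT p|lebesgue. indicator ?S p *\<^sub>R h p)"
    by (rule integral_restrict_space[OF space_time_lebesgue])
  also have "\<dots> = (LINT p|lebesgue. indicator ?S p * h' p)"
    by (rule integral_cong_AE[OF m2 measurable_completion[OF m] ae2])
  also have "\<dots> = (LINT p|lborel. indicator ?S p * h' p)" by (rule integral_completion[OF m])
  finally show "(LINT p|space_time T. h p) = (LINT p|lborel. indicator ?S p * h' p)" .
  have "integrable (space_time T) h \<longleftrightarrow> integrable lebesgue (\<lambda>p. indicator ?S p *\<^sub>R h p)"
    by (rule integrable_restrict_space[OF space_time_lebesgue])
  also have "\<dots> \<longleftrightarrow> integrable lebesgue (\<lambda>p. indicator ?S p * h' p)"
    by (rule integrable_cong_AE[OF m2 measurable_completion[OF m] ae2])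
  also have "\<dots> \<longleftrightarrow> integrable lborel (\<lambda>p. indicator ?S p * h' p)" by (rule integrable_completion[OF m])
  finally show "integrable (space_time T) h \<longleftrightarrow> integrable lborel (\<lambda>p. indicator ?S p * h' p)" .
qed

lemma L2_space_time_representative:
  fixes y :: "real \<times> 'a::euclidean_space \<Rightarrow> real"
  assumes "y \<in> L2 (space_time T)"
  obtains y' where "y' \<in> borel_measurable borel" "AE p in lborel. p \<in> {0<..<T} \<times> UNIV \<longrightarrow> y p = y' p"
    "L2b (\<lambda>p. indicator ({0<..<T} \<times> UNIV) p * y' p)"
proof -
  have y: "y \<in> borel_measurable (space_time T)" "integrable (space_time T) (\<lambda>p. (norm (y p))\<^sup>2)"
    using assms by (auto simp: L2_def)
  obtain y' where y': "y' \<in> borel_measurable borel" "AE p in lborel. p \<in> {0<..<T} \<times> UNIV \<longrightarrow> y p = y' p"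
    using space_time_borel_representative[OF y(1)] by metis
  have m: "(\<lambda>p. (y' p)\<^sup>2) \<in> borel_measurable borel" using y'(1) by measurable
  have "AE p in lborel. p \<in> {0<..<T} \<times> UNIV \<longrightarrow> (norm (y p))\<^sup>2 = (y' p)\<^sup>2" using y'(2) by eventually_elim simp
  from space_time_integral(2)[OF m this] y(2)
  have "integrable lborel (\<lambda>p. indicator ({0<..<T} \<times> UNIV) p * (y' p)\<^sup>2)" by simp
  moreover have "indicator ({0<..<T} \<times> UNIV) p * (y' p)\<^sup>2 = (indicator ({0<..<T} \<times> UNIV) p * y' p)\<^sup>2" for p
    by (simp add: indicator_def)
  ultimately have "L2b (\<lambda>p. indicator ({0<..<T} \<times> UNIV) p * y' p)"
    using borel_measurable_space_time_indicator[OF y'(1), of T] by (simp add: square_integrable_def)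
  with y' show ?thesis by (rule that)
qed

text \<open>A null set in space is contained in a Borel null set, and the cylinder over the latter
  is null by Fubini.\<close>

lemma AE_lborel_snd:
  assumes "AE y in (lborel :: 'a::euclidean_space measure). P y"
  shows "AE p in (lborel :: (real \<times> 'a) measure). P (snd p)"
proof -
  obtain N where N: "{y \<in> space lborel. \<not> P y} \<subseteq> N" "emeasure lborel N = 0" "N \<in> sets lborel"
    using assms by (rule AE_E)
  then have nN: "N \<in> null_sets lborel" by auto
  have "AE y in lborel. y \<notin> N" by (rule AE_not_in[OF nN])
  then have "AE t in (lborel :: real measure). AE y in lborel. snd (t, y) \<notin> N" by simp
  moreover have "{p \<in> space (lborel \<Otimes>\<^sub>M lborel). snd p \<notin> N} \<in> sets (lborel \<Otimes>\<^sub>M (lborel :: 'a measure) :: (real \<times> 'a) measure)"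
    using N(3) by measurable
  ultimately have "AE p in (lborel \<Otimes>\<^sub>M lborel :: (real \<times> 'a) measure). snd p \<notin> N"
    by (intro lborel_pair.AE_pair_measure)
  then have "AE p in (lborel :: (real \<times> 'a) measure). snd p \<notin> N" unfolding lborel_prod .
  then show ?thesis by eventually_elim (use N(1) in auto)
qed

section \<open>Bounds for the coefficients\<close>

lemma beta_facts:
  assumes "hyp_j \<beta>"
  shows "(\<beta> has_real_derivative deriv \<beta> r) (at r)" "deriv \<beta> r \<ge> 0" "\<beta> 0 = 0" "continuous_on UNIV (deriv \<beta>)"
    and "beta_quot \<beta> r \<ge> 0" "beta_quot \<beta> \<in> borel_measurable borel"
proof -
  obtain D where D: "\<And>x. (\<beta> has_vector_derivative D x) (at x)" "continuous_on UNIV D"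
    using assms by (auto simp: hyp_j_def C1_differentiable_on_def)
  have "deriv \<beta> = D"
    using D(1) by (auto simp: has_real_derivative_iff_has_vector_derivative[symmetric] intro!: DERIV_imp_deriv)
  with D show d: "(\<beta> has_real_derivative deriv \<beta> r) (at r)" and "continuous_on UNIV (deriv \<beta>)" for r
    by (auto simp: has_real_derivative_iff_has_vector_derivative)
  show d0: "deriv \<beta> r \<ge> 0" and b0: "\<beta> 0 = 0" for r using assms by (auto simp: hyp_j_def)
  have mono: "\<beta> x \<le> \<beta> y" if "x \<le> y" for x y
    using that d d0 by (intro DERIV_nonneg_imp_nondecreasing[of x y \<beta>]) auto
  show "beta_quot \<beta> r \<ge> 0"
    using mono[of 0 r] mono[of r 0] b0 d0 by (cases "r \<ge> 0") (auto simp: beta_quot_def divide_nonpos_nonpos zero_le_divide_iff)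
  have "continuous_on UNIV \<beta>" using d by (meson DERIV_isCont continuous_at_imp_continuous_on)
  then have [measurable]: "\<beta> \<in> borel_measurable borel" by (rule borel_measurable_continuous_onI)
  show "beta_quot \<beta> \<in> borel_measurable borel" unfolding beta_quot_def[abs_def] by measurable
qed

text \<open>Both B - h and B + h are nondecreasing on [-C,C] and vanish at 0, so each has the sign
  of r there.\<close>

lemma abs_le_of_deriv_bound:
  fixes B h :: "real \<Rightarrow> real"
  assumes B: "\<And>r. (B has_real_derivative B' r) (at r)" and h: "\<And>r. (h has_real_derivative h' r) (at r)"
    and 0: "B 0 = 0" "h 0 = 0" and le: "\<And>r. \<bar>r\<bar> \<le> C \<Longrightarrow> \<bar>h' r\<bar> \<le> B' r" and r: "\<bar>r\<bar> \<le> C"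
  shows "\<bar>h r\<bar> \<le> \<bar>B r\<bar>"
proof -
  have d: "((\<lambda>r. B r - h r) has_real_derivative B' r - h' r) (at r)" "((\<lambda>r. B r + h r) has_real_derivative B' r + h' r) (at r)" for r
    using B[of r] h[of r] by (auto intro!: derivative_eq_intros)
  have n: "0 \<le> B' x - h' x" "0 \<le> B' x + h' x" if "\<bar>x\<bar> \<le> C" for x using le[OF that] by linarith+
  have m1: "B x - h x \<le> B y - h y" if "x \<le> y" "\<bar>x\<bar> \<le> C" "\<bar>y\<bar> \<le> C" for x y
    using that by (intro DERIV_nonneg_imp_nondecreasing[of x y "\<lambda>r. B r - h r"]) (auto intro!: d(1) n(1) exI conjI)
  have m2: "B x + h x \<le> B y + h y" if "x \<le> y" "\<bar>x\<bar> \<le> C" "\<bar>y\<bar> \<le> C" for x y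
    using that by (intro DERIV_nonneg_imp_nondecreasing[of x y "\<lambda>r. B r + h r"]) (auto intro!: d(2) n(2) exI conjI)
  show ?thesis
  proof (cases "0 \<le> r")
    case True
    then show ?thesis using m1[of 0 r] m2[of 0 r] 0 r by auto
  next
    case False
    then show ?thesis using m1[of r 0] m2[of r 0] 0 r by auto
  qed
qed

text \<open>The derivative of \<beta> is bounded on the compact interval of values; comparison of
  \<beta> with a linear function carries the bound to the quotient.\<close>

lemma beta_quot_bound:
  assumes \<beta>: "hyp_j \<beta>"
  obtains L where "L \<ge> 0" "\<And>r. \<bar>r\<bar> \<le> C \<Longrightarrow> beta_quot \<beta> r \<le> L"
proof -
  note bf = beta_facts[OF \<beta>]
  have "bounded (deriv \<beta> ` {-C..C})"
    by (intro compact_imp_bounded compact_continuous_image continuous_on_subset[OF bf(4)]) auto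
  then obtain L where L: "\<And>r. r \<in> {-C..C} \<Longrightarrow> norm (deriv \<beta> r) \<le> L" unfolding bounded_iff by blast
  define L' where "L' = max 0 L"
  have L': "\<bar>deriv \<beta> r\<bar> \<le> L'" if "\<bar>r\<bar> \<le> C" for r using L[of r] that by (auto simp: L'_def abs_le_iff)
  have "beta_quot \<beta> r \<le> L'" if r: "\<bar>r\<bar> \<le> C" for r
  proof (cases "r = 0")
    case True
    then show ?thesis using L'[OF r] by (simp add: beta_quot_def)
  next
    case False
    have "\<bar>\<beta> r\<bar> \<le> \<bar>L' * r\<bar>"
      by (rule abs_le_of_deriv_bound[of "\<lambda>r. L' * r" "\<lambda>_. L'" \<beta> "deriv \<beta>" C])
         (auto intro!: derivative_eq_intros bf(1) L' r simp: bf(3))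
    then have "\<bar>\<beta> r / r\<bar> \<le> L'" using False by (simp add: L'_def abs_mult divide_le_eq)
    then have "\<beta> r / r \<le> L'" using abs_ge_self[of "\<beta> r / r"] by linarith
    then show ?thesis using False by (simp add: beta_quot_def)
  qed
  then show ?thesis using that[of L'] by (simp add: L'_def)
qed

text \<open>Hypothesis (jv) compares the derivative of b(r) r with that of \<alpha> \<beta>(r).
  Integrated from 0 it gives |b(r) r| \<le> \<alpha> |\<beta>(r)|, and division by |r| is the claim;
  at r = 0 the hypothesis is the claim.\<close>

lemma drift_bound:
  assumes \<beta>: "hyp_j \<beta>" and b: "b C1_differentiable_on UNIV" and jv: "hyp_jv \<beta> b"
  obtains \<alpha> where "\<alpha> > 0" "\<And>r. \<bar>r\<bar> \<le> C \<Longrightarrow> \<bar>b r\<bar> \<le> \<alpha> * beta_quot \<beta> r"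
proof -
  note bf = beta_facts[OF \<beta>]
  have db: "(b has_real_derivative deriv b r) (at r)" for r
  proof -
    obtain D where D: "\<And>x. (b has_vector_derivative D x) (at x)"
      using b by (auto simp: C1_differentiable_on_def)
    then have "(b has_real_derivative D r) (at r)" by (simp add: has_real_derivative_iff_has_vector_derivative)
    with DERIV_imp_deriv[OF this] show ?thesis by simp
  qed
  obtain \<alpha> where \<alpha>: "\<alpha> > 0" "\<And>r. r \<in> {-C..C} \<Longrightarrow> \<bar>deriv b r * r + b r\<bar> \<le> \<alpha> * \<bar>deriv \<beta> r\<bar>"
    using jv unfolding hyp_jv_def by (meson compact_Icc)
  have "\<bar>b r\<bar> \<le> \<alpha> * beta_quot \<beta> r" if r: "\<bar>r\<bar> \<le> C" for r
  proof (cases "r = 0")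
    case True
    then show ?thesis using \<alpha>(2)[of 0] bf(2)[of 0] r by (simp add: beta_quot_def)
  next
    case False
    have "\<bar>b r * r\<bar> \<le> \<bar>\<alpha> * \<beta> r\<bar>"
    proof (rule abs_le_of_deriv_bound[of "\<lambda>r. \<alpha> * \<beta> r" "\<lambda>r. \<alpha> * deriv \<beta> r" _ "\<lambda>r. deriv b r * r + b r" C])
      show "((\<lambda>r. \<alpha> * \<beta> r) has_real_derivative \<alpha> * deriv \<beta> r) (at r)" for r
        by (intro DERIV_cmult bf(1))
      show "((\<lambda>r. b r * r) has_real_derivative deriv b r * r + b r) (at r)" for r
        using db[of r] by (auto intro!: derivative_eq_intros)
      show "\<bar>deriv b r * r + b r\<bar> \<le> \<alpha> * deriv \<beta> r" if "\<bar>r\<bar> \<le> C" for r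
        using \<alpha>(2)[of r] bf(2)[of r] that by (auto simp: abs_le_iff)
    qed (use bf(3) r in auto)
    then have "\<bar>b r\<bar> \<le> \<alpha> * (\<bar>\<beta> r\<bar> / \<bar>r\<bar>)" using False \<alpha>(1) by (simp add: abs_mult divide_simps)
    also have "\<bar>\<beta> r\<bar> / \<bar>r\<bar> = beta_quot \<beta> r" using False bf(5)[of r] by (simp add: beta_quot_def flip: abs_divide)
    finally show ?thesis .
  qed
  with \<alpha>(1) show ?thesis by (rule that)
qed

text \<open>The integrand of the weak formulation with partial derivatives of the test function on
  space-time instead of derivatives of its slices. The former are test functions again, so
  measurability and integrability come for free.\<close>

definition weak_operator ::
  "(real \<times> 'a::euclidean_space \<Rightarrow> real) \<Rightarrow> ('a \<Rightarrow> real \<times> 'a \<Rightarrow> real) \<Rightarrow> (real \<times> 'a \<Rightarrow> real) \<Rightarrow> real \<times> 'a \<Rightarrow> real" where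
  "weak_operator a c \<phi> p = partial_deriv (1, 0) \<phi> p +
     a p * (\<Sum>e\<in>Basis. partial_deriv (0, e) (partial_deriv (0, e) \<phi>) p) +
     (\<Sum>e\<in>Basis. c e p * partial_deriv (0, e) \<phi> p)"

lemma weak_operator_eq:
  fixes \<phi> :: "real \<times> 'a::euclidean_space \<Rightarrow> real"
  assumes s: "smooth \<phi>" and a: "a (t, x) = A" and c: "\<And>e. e \<in> Basis \<Longrightarrow> c e (t, x) = B * (d \<bullet> e)"
  shows "deriv (\<lambda>s. \<phi> (s, x)) t + A * laplacian (\<lambda>x. \<phi> (t, x)) x + B * (d \<bullet> grad (\<lambda>x. \<phi> (t, x)) x) =
    weak_operator a c \<phi> (t, x)"
proof -
  have B: "(0, e) \<in> Basis" if "e \<in> Basis" for e :: 'a using that by (simp add: Basis_prod_def)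
  have 1: "partial_deriv e (\<lambda>x. \<phi> (t, x)) = (\<lambda>x. partial_deriv (0, e) \<phi> (t, x))" for e
    by (simp add: partial_deriv_snd[OF s] fun_eq_iff)
  have "laplacian (\<lambda>x. \<phi> (t, x)) x = (\<Sum>e\<in>Basis. partial_deriv (0, e) (partial_deriv (0, e) \<phi>) (t, x))"
    unfolding laplacian_def 1 by (intro sum.cong refl partial_deriv_snd[symmetric] smooth_partial_deriv s B)
  moreover have "B * (d \<bullet> grad (\<lambda>x. \<phi> (t, x)) x) = (\<Sum>e\<in>Basis. c e (t, x) * partial_deriv (0, e) \<phi> (t, x))"
    unfolding grad_def 1 by (simp add: inner_sum_right sum_distrib_left c mult.assoc mult.commute mult.left_commute)
  ultimately show ?thesis by (simp add: weak_operator_def a partial_deriv_fst[OF s])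
qed

text \<open>The difference of the solutions, cut off to the strip, satisfies the abstract flux
  equation with f = a z and g = c z. Nonnegativity of a and the bound of the drift by a are
  precisely what the pointwise hypotheses of the vanishing result ask for.\<close>

lemma linearized_uniqueness:
  fixes D :: "'a::euclidean_space \<Rightarrow> 'a" and u y\<^sub>1 y\<^sub>2 :: "real \<times> 'a \<Rightarrow> real"
  assumes \<beta>: "hyp_j \<beta>" and D: "D \<in> Linf lebesgue" and b: "b C1_differentiable_on UNIV" and jv: "hyp_jv \<beta> b"
    and T: "T > 0" and u: "u \<in> Linf (space_time T)" and y1: "y\<^sub>1 \<in> L2 (space_time T)" and y2: "y\<^sub>2 \<in> L2 (space_time T)"
    and sol1: "linearized_solution \<beta> b D T u \<rho>\<^sub>0 y\<^sub>1" and sol2: "linearized_solution \<beta> b D T u \<rho>\<^sub>0 y\<^sub>2"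
  shows "AE p in space_time T. y\<^sub>1 p = y\<^sub>2 p"
proof -
  define S where "S = {0<..<T} \<times> (UNIV :: 'a set)"
  note bf = beta_facts[OF \<beta>]
  have mb: "b \<in> borel_measurable borel"
  proof -
    have "continuous_on UNIV b" using b by (rule C1_differentiable_imp_continuous_on)
    then show ?thesis by (rule borel_measurable_continuous_onI)
  qed
  have mu: "u \<in> borel_measurable (space_time T)" and "\<exists>C. AE p in space_time T. norm (u p) \<le> C"
    using u unfolding Linf_def by blast+
  then obtain C where uC: "AE p in space_time T. norm (u p) \<le> C" by blast
  obtain u' where u': "u' \<in> borel_measurable borel" "AE p in lborel. p \<in> S \<longrightarrow> u p = u' p"
    unfolding S_def by (rule space_time_borel_representative[OF mu])
  have "AE p in lborel. p \<in> S \<longrightarrow> norm (u p) \<le> C"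
    using uC unfolding AE_space_time_iff S_def .
  then have u'C: "AE p in lborel. p \<in> S \<longrightarrow> \<bar>u' p\<bar> \<le> C"
    using u'(2) by eventually_elim auto
  have mD: "D \<in> borel_measurable lebesgue" and "\<exists>C. AE x in lebesgue. norm (D x) \<le> C"
    using D unfolding Linf_def by blast+
  then obtain M0 where M0: "AE x in lebesgue. norm (D x) \<le> M0" by blast
  define M where "M = max 0 M0"
  have M: "AE x in lborel. norm (D x) \<le> M"
    using M0 unfolding AE_lebesgue_iff by eventually_elim (simp add: M_def)
  \<comment> \<open>The field is replaced by Borel versions of its components, one for each
    direction.\<close>
  have "\<exists>d'\<in>borel_measurable lborel. AE x in lborel. D x \<bullet> e = d' x" for e
    using mD by (intro completion_ex_borel_measurable_real) simp
  then obtain d where d: "\<And>e. d e \<in> borel_measurable borel" "\<And>e. AE x in lborel. D x \<bullet> e = d e x"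
    by (metis measurable_lborel2)
  have dM: "AE x in lborel. \<bar>d e x\<bar> \<le> M" if "e \<in> Basis" for e
    using M d(2)[of e]
  proof eventually_elim
    case (elim x)
    then show ?case using Basis_le_norm[OF that, of "D x"] by simp
  qed
  obtain L where L: "L \<ge> 0" "\<And>r. \<bar>r\<bar> \<le> C \<Longrightarrow> beta_quot \<beta> r \<le> L" using beta_quot_bound[OF \<beta>] by metis
  obtain \<alpha> where \<alpha>: "\<alpha> > 0" "\<And>r. \<bar>r\<bar> \<le> C \<Longrightarrow> \<bar>b r\<bar> \<le> \<alpha> * beta_quot \<beta> r" using drift_bound[OF \<beta> b jv] by metis
  define a where "a p = beta_quot \<beta> (u' p)" for p
  define c where "c e p = b (u' p) * d e (snd p)" for e p
  have ma: "a \<in> borel_measurable borel" unfolding a_def[abs_def]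
    by (rule measurable_compose[OF u'(1) bf(6)])
  have mc: "c e \<in> borel_measurable borel" for e
    unfolding c_def[abs_def]
    by (intro borel_measurable_times measurable_compose[OF u'(1) mb] 
        borel_measurable_compose_continuous[OF d(1)] continuous_intros)
  have a0: "0 \<le> a p" for p unfolding a_def by (rule bf(5))
  have aL: "AE p in lborel. p \<in> S \<longrightarrow> a p \<le> L"
    using u'C by eventually_elim (simp add: a_def L(2))
  have ca: "AE p in lborel. p \<in> S \<longrightarrow> \<bar>c e p\<bar> \<le> \<alpha> * M * a p" if "e \<in> Basis" for e
    using u'C AE_lborel_snd[OF dM[OF that]]
  proof eventually_elim
    case (elim p)
    show ?case
    proof
      assume "p \<in> S"
      then have "\<bar>b (u' p)\<bar> * \<bar>d e (snd p)\<bar> \<le> (\<alpha> * a p) * M"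
        using elim \<alpha> a0[of p] by (intro mult_mono) (auto simp: a_def)
      then show "\<bar>c e p\<bar> \<le> \<alpha> * M * a p" by (simp add: c_def abs_mult mult.commute mult.left_commute)
    qed
  qed
  obtain y1' where y1': "y1' \<in> borel_measurable borel" "AE p in lborel. p \<in> S \<longrightarrow> y\<^sub>1 p = y1' p" "L2b (\<lambda>p. indicator S p * y1' p)"
    unfolding S_def by (rule L2_space_time_representative[OF y1])
  obtain y2' where y2': "y2' \<in> borel_measurable borel" "AE p in lborel. p \<in> S \<longrightarrow> y\<^sub>2 p = y2' p" "L2b (\<lambda>p. indicator S p * y2' p)"
    unfolding S_def by (rule L2_space_time_representative[OF y2])
  define z where "z p = indicator S p * y1' p - indicator S p * y2' p" for p
  define f where "f p = a p * z p" for p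
  define g where "g e p = c e p * z p" for e p
  have z: "L2b z" unfolding z_def[abs_def] by (rule square_integrable_diff[OF y1'(3) y2'(3)])
  have mz: "z \<in> borel_measurable borel" using square_integrableD(1)[OF z] by simp
  have zS: "z p = 0" if "p \<notin> S" for p using that by (simp add: z_def)
  have f: "L2b f"
  proof (rule square_integrable_bound[OF z])
    show "f \<in> borel_measurable lborel" unfolding f_def[abs_def] using ma mz by simp
    show "AE p in lborel. \<bar>f p\<bar> \<le> L * \<bar>z p\<bar>"
      using aL
    proof eventually_elim
      case (elim p)
      then show ?case using a0[of p] by (cases "p \<in> S") (auto simp: f_def abs_mult zS intro!: mult_right_mono)
    qed
  qed
  have g: "L2b (g e)" if e: "e \<in> Basis" for e
  proof (rule square_integrable_bound[OF f])
    show "g e \<in> borel_measurable lborel" unfolding g_def[abs_def] using mc mz by simp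
    show "AE p in lborel. \<bar>g e p\<bar> \<le> (\<alpha> * M) * \<bar>f p\<bar>"
      using ca[OF e]
    proof eventually_elim
      case (elim p)
      show ?case
      proof (cases "p \<in> S")
        case True
        then have "\<bar>c e p\<bar> * \<bar>z p\<bar> \<le> (\<alpha> * M * a p) * \<bar>z p\<bar>" using elim by (intro mult_right_mono) auto
        then show ?thesis using a0[of p] by (simp add: g_def f_def abs_mult mult.assoc)
      qed (simp add: g_def f_def zS)
    qed
  qed
  have weak: "(LINT p|lborel. partial_deriv (1, 0) \<phi> p * z p + (\<Sum>e\<in>Basis. partial_deriv (0, e) (partial_deriv (0, e) \<phi>) p * f p) +
         (\<Sum>e\<in>Basis. partial_deriv (0, e) \<phi> p * g e p)) = 0" if \<phi>: "\<phi> \<in> test_functions_upto T" for \<phi>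
  proof -
    have t\<phi>: "\<phi> \<in> test_functions" using \<phi> by (simp add: test_functions_upto_def)
    note s\<phi> = test_smooth[OF t\<phi>]
    have B: "(0, e) \<in> Basis" if "e \<in> Basis" for e :: 'a using that by (simp add: Basis_prod_def)
    have B1: "(1, 0) \<in> (Basis :: (real \<times> 'a) set)" by (simp add: Basis_prod_def)
    define G where "G = weak_operator a c \<phi>"
    define \<phi>1 where "\<phi>1 = partial_deriv (1, 0) \<phi>"
    define \<phi>2 where "\<phi>2 p = (\<Sum>e\<in>Basis. partial_deriv (0, e) (partial_deriv (0, e) \<phi>) p)" for p
    have t1: "\<phi>1 \<in> test_functions" unfolding \<phi>1_def by (rule test_partial_deriv[OF t\<phi> B1])
    have t2: "\<phi>2 \<in> test_functions" unfolding \<phi>2_def[abs_def] by (intro test_sum test_partial_deriv t\<phi> B)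
    have t3: "partial_deriv (0, e) \<phi> \<in> test_functions" if "e \<in> Basis" for e by (rule test_partial_deriv[OF t\<phi> B[OF that]])
    have Geq: "G p = \<phi>1 p + a p * \<phi>2 p + (\<Sum>e\<in>Basis. c e p * partial_deriv (0, e) \<phi> p)" for p
      by (simp add: G_def weak_operator_def \<phi>1_def \<phi>2_def)
    have mG: "G \<in> borel_measurable borel"
      unfolding Geq[abs_def]
      by (intro borel_measurable_add borel_measurable_times borel_measurable_sum ma mc test_borel t1 t2 t3)
    have mS: "(\<lambda>p. indicator S p * h p) \<in> borel_measurable lborel" if "h \<in> borel_measurable borel" for h :: "real \<times> 'a \<Rightarrow> real"
      unfolding S_def using borel_measurable_space_time_indicator[OF that] by simp
    \<comment> \<open>Square integrability makes the integrals against both solutions finite, so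
      that the integral of the difference is the difference of the integrals.\<close>
    have GL: "L2b (\<lambda>p. indicator S p * G p)"
    proof -
      have "L2b (\<lambda>p. indicator S p * \<phi>1 p)"
      proof (rule square_integrable_bound[OF square_integrable_test[OF t1], of _ 1])
        show "(\<lambda>p. indicator S p * \<phi>1 p) \<in> borel_measurable lborel" by (intro mS test_borel t1)
      qed (auto simp: indicator_def)
      moreover have "L2b (\<lambda>p. indicator S p * (a p * \<phi>2 p))"
      proof (rule square_integrable_bound[OF square_integrable_test[OF t2]])
        show "AE p in lborel. \<bar>indicator S p * (a p * \<phi>2 p)\<bar> \<le> L * \<bar>\<phi>2 p\<bar>"
          using aL
        proof eventually_elim
          case (elim p)
          then show ?case using a0[of p] L(1) by (cases "p \<in> S") (auto simp: abs_mult intro!: mult_right_mono)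
        qed
      qed (intro mS borel_measurable_times ma test_borel t2)
      moreover have "L2b (\<lambda>p. \<Sum>e\<in>Basis. indicator S p * (c e p * partial_deriv (0, e) \<phi> p))"
      proof (rule square_integrable_sum)
        fix e :: 'a assume e: "e \<in> Basis"
        show "L2b (\<lambda>p. indicator S p * (c e p * partial_deriv (0, e) \<phi> p))"
        proof (rule square_integrable_bound[OF square_integrable_test[OF t3[OF e]]])
          show "AE p in lborel. \<bar>indicator S p * (c e p * partial_deriv (0, e) \<phi> p)\<bar> \<le> (\<alpha> * M * L) * \<bar>partial_deriv (0, e) \<phi> p\<bar>"
            using aL ca[OF e]
          proof eventually_elim
            case (elim p)
            have pos: "0 \<le> \<alpha> * M" using \<alpha>(1) by (simp add: M_def)
            show ?case
            proof (cases "p \<in> S")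
              case True
              then have "\<bar>c e p\<bar> \<le> \<alpha> * M * a p" using elim by simp
              also have "\<dots> \<le> \<alpha> * M * L" using elim True pos by (intro mult_left_mono) auto
              finally show ?thesis using True by (auto simp: abs_mult intro!: mult_right_mono)
            next
              case False
              then show ?thesis using pos L(1) by simp
            qed
          qed
        qed (intro mS borel_measurable_times mc test_borel t3 e)
      qed
      ultimately have "L2b (\<lambda>p. indicator S p * \<phi>1 p + indicator S p * (a p * \<phi>2 p) + (\<Sum>e\<in>Basis. indicator S p * (c e p * partial_deriv (0, e) \<phi> p)))"
        by (intro square_integrable_add)
      then show ?thesis by (simp add: Geq distrib_left sum_distrib_left)
    qed
    have dae: "AE p in (lborel :: (real \<times> 'a) measure). \<forall>e\<in>Basis. D (snd p) \<bullet> e = d e (snd p)"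
      by (rule AE_lborel_snd) (intro AE_finite_allI d(2) finite_Basis)
    have rep: "(LINT p|lborel. indicator S p * G p * (indicator S p * y' p)) = - signed_integral \<rho>\<^sub>0 (\<lambda>x. \<phi> (0, x))"
      if sol: "linearized_solution \<beta> b D T u \<rho>\<^sub>0 y" and y': "y' \<in> borel_measurable borel" "AE p in lborel. p \<in> S \<longrightarrow> y p = y' p" for y y'
    proof -
      have "AE p in lborel. p \<in> S \<longrightarrow>
         (case p of (t, x) \<Rightarrow> (deriv (\<lambda>s. \<phi> (s, x)) t + beta_quot \<beta> (u (t, x)) * laplacian (\<lambda>x. \<phi> (t, x)) x
            + b (u (t, x)) * (D x \<bullet> grad (\<lambda>x. \<phi> (t, x)) x)) * y (t, x)) = G p * y' p"
        using u'(2) dae y'(2)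
      proof eventually_elim
        case (elim p)
        obtain t x where p: "p = (t, x)" by (cases p)
        show ?case
        proof
          assume pS: "p \<in> S"
          have "deriv (\<lambda>s. \<phi> (s, x)) t + beta_quot \<beta> (u (t, x)) * laplacian (\<lambda>x. \<phi> (t, x)) x
            + b (u (t, x)) * (D x \<bullet> grad (\<lambda>x. \<phi> (t, x)) x) = G (t, x)"
            unfolding G_def using elim pS by (intro weak_operator_eq[OF s\<phi>]) (auto simp: p a_def c_def)
          then show "(case p of (t, x) \<Rightarrow> (deriv (\<lambda>s. \<phi> (s, x)) t + beta_quot \<beta> (u (t, x)) * laplacian (\<lambda>x. \<phi> (t, x)) x
            + b (u (t, x)) * (D x \<bullet> grad (\<lambda>x. \<phi> (t, x)) x)) * y (t, x)) = G p * y' p"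
            using elim pS by (simp add: p)
        qed
      qed
      from space_time_integral(1)[OF borel_measurable_times[OF mG y'(1)] this[unfolded S_def]]
      have "(LINT (t, x)|space_time T. (deriv (\<lambda>s. \<phi> (s, x)) t + beta_quot \<beta> (u (t, x)) * laplacian (\<lambda>x. \<phi> (t, x)) x
            + b (u (t, x)) * (D x \<bullet> grad (\<lambda>x. \<phi> (t, x)) x)) * y (t, x)) = (LINT p|lborel. indicator S p * (G p * y' p))"
        unfolding S_def .
      then have "(LINT p|lborel. indicator S p * (G p * y' p)) = - signed_integral \<rho>\<^sub>0 (\<lambda>x. \<phi> (0, x))"
        using sol \<phi> unfolding linearized_solution_def by (metis (no_types, lifting) add_eq_0_iff2)
      moreover have "indicator S p * G p * (indicator S p * y' p) = indicator S p * (G p * y' p)" for p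
        by (simp add: indicator_def)
      ultimately show ?thesis by presburger
    qed
    have "(LINT p|lborel. partial_deriv (1, 0) \<phi> p * z p + (\<Sum>e\<in>Basis. partial_deriv (0, e) (partial_deriv (0, e) \<phi>) p * f p) +
         (\<Sum>e\<in>Basis. partial_deriv (0, e) \<phi> p * g e p)) = 
       (LINT p|lborel. indicator S p * G p * (indicator S p * y1' p) - indicator S p * G p * (indicator S p * y2' p))"
    proof (intro Bochner_Integration.integral_cong refl)
      fix p
      have "\<phi>1 p * z p + (\<Sum>e\<in>Basis. partial_deriv (0, e) (partial_deriv (0, e) \<phi>) p * f p) +
         (\<Sum>e\<in>Basis. partial_deriv (0, e) \<phi> p * g e p) = G p * z p"
        unfolding Geq \<phi>2_def f_def g_def
        by (simp add: distrib_right distrib_left sum_distrib_right sum_distrib_left mult.assoc mult.commute mult.left_commute)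
      moreover have "G p * z p = indicator S p * G p * (indicator S p * y1' p) - indicator S p * G p * (indicator S p * y2' p)"
        by (simp add: z_def indicator_def right_diff_distrib)
      ultimately show "partial_deriv (1, 0) \<phi> p * z p + (\<Sum>e\<in>Basis. partial_deriv (0, e) (partial_deriv (0, e) \<phi>) p * f p) +
         (\<Sum>e\<in>Basis. partial_deriv (0, e) \<phi> p * g e p) = 
         indicator S p * G p * (indicator S p * y1' p) - indicator S p * G p * (indicator S p * y2' p)"
        by (simp add: \<phi>1_def)
    qed
    also have "\<dots> = (LINT p|lborel. indicator S p * G p * (indicator S p * y1' p)) - (LINT p|lborel. indicator S p * G p * (indicator S p * y2' p))"
      by (intro Bochner_Integration.integral_diff square_integrable_mult_integrable[OF GL] y1'(3) y2'(3))
    \<comment> \<open>Both integrals equal minus the same initial term, as the datum is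
      shared.\<close>
    also have "\<dots> = 0" unfolding rep[OF sol1 y1'(1,2)] rep[OF sol2 y2'(1,2)] by simp
    finally show ?thesis .
  qed
  interpret weak_flux_equation T z f g
  proof unfold_locales
    show z0: "z p = 0" if "fst p \<notin> {0<..<T}" for p using that by (intro zS) (auto simp: S_def)
    show "f p = 0" if "fst p \<notin> {0<..<T}" for p using z0[OF that] by (simp add: f_def)
    show "g e p = 0" if "fst p \<notin> {0<..<T}" for e p using z0[OF that] by (simp add: g_def)
  qed (rule T z f g weak, assumption?)+
  \<comment> \<open>One constant for all bounds: f^2 is at most L z f, each component of g has
    square at most (\<alpha> M)^2 f^2, and the 1 makes it positive.\<close>
  define A where "A = L + (\<alpha> * M)\<^sup>2 * L + 1"
  have A: "A > 0" unfolding A_def using L(1) by (intro add_nonneg_pos add_nonneg_nonneg mult_nonneg_nonneg) auto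
  have zf: "0 \<le> z p * f p" for p using a0[of p] by (simp add: f_def mult.left_commute)
  have fle: "AE p in lborel. (f p)\<^sup>2 \<le> L * (z p * f p)"
    using aL
  proof eventually_elim
    case (elim p)
    show ?case
    proof (cases "p \<in> S")
      case True
      then have "a p * (z p * f p) \<le> L * (z p * f p)" using elim zf by (intro mult_right_mono) auto
      then show ?thesis by (simp add: f_def power2_eq_square mult.assoc mult.left_commute)
    qed (simp add: f_def zS)
  qed
  have fA: "AE p in lborel. (f p)\<^sup>2 \<le> A * (z p * f p)"
    using fle
  proof eventually_elim
    case (elim p)
    have "L * (z p * f p) \<le> A * (z p * f p)"
      using L(1) zf by (intro mult_right_mono) (auto simp: A_def)
    with elim show ?case by linarith
  qed
  have gA: "AE p in lborel. (g e p)\<^sup>2 \<le> A * (z p * f p)" if e: "e \<in> Basis" for e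
    using fle ca[OF e]
  proof eventually_elim
    case (elim p)
    have "\<bar>g e p\<bar> \<le> \<alpha> * M * \<bar>f p\<bar>"
    proof (cases "p \<in> S")
      case True
      then have "\<bar>c e p\<bar> * \<bar>z p\<bar> \<le> (\<alpha> * M * a p) * \<bar>z p\<bar>" using elim by (intro mult_right_mono) auto
      then show ?thesis using a0[of p] by (simp add: g_def f_def abs_mult mult.assoc)
    qed (simp add: g_def f_def zS)
    then have "\<bar>g e p\<bar>\<^sup>2 \<le> (\<alpha> * M * \<bar>f p\<bar>)\<^sup>2" by (intro power_mono) auto
    then have "(g e p)\<^sup>2 \<le> (\<alpha> * M)\<^sup>2 * (f p)\<^sup>2" by (simp add: power_mult_distrib)
    also have "\<dots> \<le> (\<alpha> * M)\<^sup>2 * (L * (z p * f p))" using elim by (intro mult_left_mono) auto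
    also have "\<dots> = ((\<alpha> * M)\<^sup>2 * L) * (z p * f p)" by simp
    also have "\<dots> \<le> A * (z p * f p)"
      using L(1) zf by (intro mult_right_mono) (auto simp: A_def)
    finally show ?case .
  qed
  have "AE p in lborel. z p = 0" by (rule vanishes[OF A fA gA])
  then have "AE p in lborel. p \<in> S \<longrightarrow> y\<^sub>1 p = y\<^sub>2 p"
    using y1'(2) y2'(2) by eventually_elim (auto simp: z_def)
  then show ?thesis unfolding AE_space_time_iff S_def .
qed

theorem theorem4p1:
  fixes \<beta> b :: "real \<Rightarrow> real"
    and D :: "real ^ 'n \<Rightarrow> real ^ 'n"
    and T :: real
    and u y\<^sub>1 y\<^sub>2 :: "real \<times> (real ^ 'n) \<Rightarrow> real"
    and \<rho>\<^sub>0 :: "(real ^ 'n) set \<Rightarrow> real"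
  assumes "hyp_j \<beta>"
    and "D \<in> Linf lebesgue"
    and "b C1_differentiable_on UNIV"
    and "hyp_jv \<beta> b"
    and "T > 0"
    and "u \<in> Linf (space_time T)"
    and "y\<^sub>1 \<in> L2 (space_time T)" and "y\<^sub>2 \<in> L2 (space_time T)"
    and "(\<lambda>t. pairing (\<lambda>x. y\<^sub>1 (t, x) - y\<^sub>2 (t, x))) \<in> Linf_Hm1 T"
    and "signed_radon_measure_bv \<rho>\<^sub>0"
    and "linearized_solution \<beta> b D T u \<rho>\<^sub>0 y\<^sub>1"
    and "linearized_solution \<beta> b D T u \<rho>\<^sub>0 y\<^sub>2"
    and "\<forall>\<phi>\<in>test_functions.
           ((\<lambda>t. esssup (lebesgue_on {0<..<t})
                   (\<lambda>s. ereal \<bar>LINT x|lebesgue. (y\<^sub>1 (s, x) - y\<^sub>2 (s, x)) * \<phi> x\<bar>))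
             \<longlongrightarrow> 0) (at_right 0)"
  shows "AE z in space_time T. y\<^sub>1 z = y\<^sub>2 z"
  using assms(1-8,11,12) by (rule linearized_uniqueness)

end
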